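(* Let $(H,R,\alpha,\beta,\Delta_H,\epsilon_H,T)$ be a para Hopf algebroid over a $k$-algebra $R$ and let $(\mathcal{C},R)$ be an $H$-module coring with coproduct $\Delta$ and counit $\epsilon$. Regard $\mathcal{C}$ as a right $H$-module via $c\cdot h=T(h)c$, and $\mathcal{C}^{\otimes_R n}$ ($n\ge 1$) as a left $H$-module via the diagonal action $h\cdot(c_1\otimes_R\cdots\otimes_R c_n)=h^{(1)}c_1\otimes_R\cdots\otimes_R h^{(n)}c_n$; put $\mathcal{C}^{\otimes_R 0}=R$ with the left $H$-action $h\cdot r=\epsilon_H(h\alpha(r))$. Then $\{C^n=\mathcal{C}\otimes_H\mathcal{C}^{\otimes_R n}\}_{n\ge 0}$ together with the following maps (which in particular are well-defined) is a cocyclic $k$-module: Cofaces $\delta_i:C^n\to C^{n+1}$, $0\le i\le n+1$: for $n\ge 1$, $$\delta_i(c_0\otimes_H c_1\otimes_R\cdots\otimes_R c_n)=c_0\otimes_H c_1\otimes_R\cdots\otimes_R\Delta(c_i)\otimes_R\cdots\otimes_R c_n\quad(0\le i\le n),$$ (for $i=0$ this means $c_0^{(1)}\otimes_H c_0^{(2)}\otimes_R c_1\otimes_R\cdots\otimes_R c_n$), and $$\delta_{n+1}(c_0\otimes_H c_1\otimes_R\cdots\otimes_R c_n)=c_0^{(2)}\otimes_H c_1\otimes_R\cdots\otimes_R c_n\otimes_R c_0^{(1)};$$ for $n=0$, $$\delta_0(c\otimes_H r)=c^{(1)}\otimes_H\beta(r)c^{(2)},\qquad \delta_1(c\otimes_H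 r)=c^{(2)}\otimes_H\alpha(r)c^{(1)}.$$ Codegeneracies $\sigma_j:C^n\to C^{n-1}$, $0\le j\le n-1$: $$\sigma_j(c_0\otimes_H c_1\otimes_R\cdots\otimes_R c_n)=c_0\otimes_H c_1\otimes_R\cdots\otimes_R\epsilon(c_{j+1})\otimes_R\cdots\otimes_R c_n.$$ Cyclic operators $\tau:C^n\to C^n$: $$\tau(c_0\otimes_H c_1\otimes_R\cdots\otimes_R c_n)=c_1\otimes_H c_2\otimes_R\cdots\otimes_R c_n\otimes_R c_0\quad(n\ge1),\qquad \tau=\mathrm{id}\ \text{ on } C^0.$$
   Context: $k$ is the ground field; algebras are associative and unital over $k$, not necessarily commutative. A coring over $R$ is an $(R,R)$-bimodule $\mathcal{C}$ with $(R,R)$-bimodule maps $\Delta:\mathcal{C}\to\mathcal{C}\otimes_R\mathcal{C}$, $\epsilon:\mathcal{C}\to R$ that are coassociative and counital; Sweedler notation $\Delta(c)=c^{(1)}\otimes_R c^{(2)}$ (summation understood). A bialgebroid $(H,R,\alpha,\beta,\Delta_H,\epsilon_H)$ consists of algebras $H,R$, an algebra homomorphism $\alpha:R\to H$ and an algebra antihomomorphism $\beta:R\to H$ with $\alpha(a)\beta(b)=\beta(b)\alpha(a)$, so that $H$ is an $R$-bimodule by $axb=\alpha(a)\beta(b)x$, such that: (i) $(H,R,\Delta_H,\epsilon_H)$ is a coring over $R$; (ii) $\Delta_H(a)(\beta(r)\otimes 1-1\otimes\alpha(r))=0$ in $H\otimes_R H$ and $\Delta_H(ab)=\Delta_H(a)\Delta_H(b)$,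 where $H\otimes H$ acts on the right of $H\otimes_R H$ by $(a\otimes_R b)(a'\otimes b')=aa'\otimes_R bb'$; (iii) $\epsilon_H(1)=1$. One also requires $\epsilon_H(hg)=\epsilon_H(h\beta(\epsilon_H(g)))$ (automatic for para Hopf algebroids); then $h\cdot r=\epsilon_H(h\alpha(r))=\epsilon_H(h\beta(r))$ is an action of $H$ on $R$. A para Hopf algebroid is a bialgebroid with an antialgebra map $T:H\to H$ such that: $T\beta=\alpha$; $m_H(T\otimes\mathrm{id})\Delta_H=\beta\epsilon_H T$ ($m_H$ the multiplication); $T^2=\mathrm{id}_H$; and $T(h^{(1)})^{(1)}h^{(2)}\otimes_R T(h^{(1)})^{(2)}=1\otimes_R T(h)$ for all $h\in H$. An $H$-module coring is a coring $(\mathcal{C},R)$ with a left $H$-module structure on $\mathcal{C}$ such that $\alpha(r)c=r\cdot c$ and $\beta(r)c=c\cdot r$ (the given $R$-bimodule structure), and such that $\Delta$ and $\epsilon$ are $H$-linear, where $h\cdot(c\otimes_R d)=h^{(1)}c\otimes_R h^{(2)}d$ and $H$ acts on $R$ by $h\cdot r=\epsilon_H(h\alpha(r))=\epsilon_H(h\beta(r))$. A cocyclic $k$-module is a cosimplicial $k$-module $(C^n,\delta_i,\sigma_j)$ with operators $\tau=\tau_n:C^n\to C^n$ satisfying $\tau\delta_i=\delta_{i-1}\tau$ ($1\le i\le n+1$), $\tau\delta_0=\delta_{n+1}$, $\tau\sigma_j=\sigma_{j-1}\tau$ ($j\ge1$), $\tau\sigma_0=\sigma_n\tau^2$ and $\tau_n^{n+1}=\mathrm{id}$.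 *)

theory Defs
  imports
    "HOL-Library.Poly_Mapping"
    "HOL-Library.Set_Algebras"
    "HOL-Algebra.Module"
    "HOL-Algebra.Algebraic_Closure_Type"
begin

section \<open>Free vector spaces and their quotients\<close>

text \<open>
  The free \<open>k\<close>-vector space on a type \<open>'x\<close> is \<open>'x \<Rightarrow>\<^sub>0 'k\<close>.  Tensor products are
  its quotients, with cosets as elements.
\<close>

definition fscale :: "'k::field \<Rightarrow> ('x \<Rightarrow>\<^sub>0 'k) \<Rightarrow> ('x \<Rightarrow>\<^sub>0 'k)" where
  "fscale a f = Poly_Mapping.map ((*) a) f"

abbreviation gen :: "'x \<Rightarrow> ('x \<Rightarrow>\<^sub>0 'k::field)" where
  "gen x \<equiv> Poly_Mapping.single x 1"

text \<open>The linear extension of a map given on generators; \<open>sc\<close> is the scalar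
  multiplication of the target.\<close>

definition lin_ext ::
    "('k::field \<Rightarrow> 'v::ab_group_add \<Rightarrow> 'v) \<Rightarrow> ('x \<Rightarrow> 'v) \<Rightarrow> ('x \<Rightarrow>\<^sub>0 'k) \<Rightarrow> 'v" where
  "lin_ext sc \<phi> f = (\<Sum>x\<in>Poly_Mapping.keys f. sc (Poly_Mapping.lookup f x) (\<phi> x))"

text \<open>
  The quotient of a subspace \<open>F\<close> by a subspace \<open>N\<close>, as a module over the field \<open>'k\<close>.
  Adding \<open>N\<close> in the scalar multiplication matters only for the scalar \<open>0\<close>.  The fields
  \<open>mult\<close> and \<open>one\<close>, which the record type of modules inherits from rings, play no role.
\<close>

definition quot ::
    "('x \<Rightarrow>\<^sub>0 'k::field) set \<Rightarrow> ('x \<Rightarrow>\<^sub>0 'k) set \<Rightarrow> ('k, ('x \<Rightarrow>\<^sub>0 'k) set) module" where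
  "quot F N = \<lparr>carrier = {f +o N |f. f \<in> F}, monoid.mult = undefined, one = undefined,
     zero = N, add = (\<lambda>U V. U + V), module.smult = (\<lambda>a U. fscale a ` U + N)\<rparr>"

definition klinear :: "('k, 'x) module \<Rightarrow> ('k, 'y) module \<Rightarrow> ('x \<Rightarrow> 'y) \<Rightarrow> bool" where
  "klinear M N \<phi> \<longleftrightarrow>
     (\<forall>x\<in>carrier M. \<phi> x \<in> carrier N) \<and>
     (\<forall>x\<in>carrier M. \<forall>y\<in>carrier M. \<phi> (x \<oplus>\<^bsub>M\<^esub> y) = \<phi> x \<oplus>\<^bsub>N\<^esub> \<phi> y) \<and>
     (\<forall>a. \<forall>x\<in>carrier M. \<phi> (a \<odot>\<^bsub>M\<^esub> x) = a \<odot>\<^bsub>N\<^esub> \<phi> x)"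


section \<open>Algebras, bimodules and their tensor powers\<close>

text \<open>
  Algebras live on types of sort \<open>{ring, monoid_mult}\<close>: associative unital rings, the
  zero ring being allowed (unlike in \<open>ring_1\<close>).
\<close>

locale k_algebra = vector_space sc
  for sc :: "'k::field \<Rightarrow> 'a::{ring,monoid_mult} \<Rightarrow> 'a" +
  assumes scale_mult_left: "sc t (a * b) = sc t a * b"
    and scale_mult_right: "sc t (a * b) = a * sc t b"

record ('k, 'r, 'm) bimodule_data =
  bscale :: "'k \<Rightarrow> 'm \<Rightarrow> 'm"
  lact :: "'r \<Rightarrow> 'm \<Rightarrow> 'm"
  ract :: "'m \<Rightarrow> 'r \<Rightarrow> 'm"

locale bimodule =
  R: k_algebra sR + M: vector_space "bscale B"
  for sR :: "'k::field \<Rightarrow> 'r::{ring,monoid_mult} \<Rightarrow> 'r"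
    and B :: "('k, 'r, 'm::ab_group_add, 'z) bimodule_data_scheme" +
  assumes lact_add_left: "lact B (a + b) x = lact B a x + lact B b x"
    and lact_add_right: "lact B a (x + y) = lact B a x + lact B a y"
    and lact_mult: "lact B (a * b) x = lact B a (lact B b x)"
    and lact_one: "lact B 1 x = x"
    and lact_scale: "lact B (sR t a) x = bscale B t (lact B a x)"
    and ract_add_left: "ract B (x + y) a = ract B x a + ract B y a"
    and ract_add_right: "ract B x (a + b) = ract B x a + ract B x b"
    and ract_mult: "ract B x (a * b) = ract B (ract B x a) b"
    and ract_one: "ract B x 1 = x"
    and ract_scale: "ract B x (sR t a) = bscale B t (ract B x a)"
    and lact_ract: "lact B a (ract B x b) = ract B (lact B a x) b"

text \<open>
  For \<open>n \<ge> 1\<close>, the \<open>n\<close>-fold tensor power of a bimodule over \<open>R\<close> is the free vector space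
  on the words of length \<open>n\<close>, the word \<open>[c\<^sub>1, \<dots>, c\<^sub>n]\<close> standing for the tensor
  \<open>c\<^sub>1 \<otimes>\<^sub>R \<dots> \<otimes>\<^sub>R c\<^sub>n\<close>, modulo \<open>k\<close>-multilinearity and \<open>R\<close>-balancing.
\<close>

definition tens_rel ::
    "('k::field, 'r, 'm::ab_group_add, 'z) bimodule_data_scheme \<Rightarrow> nat \<Rightarrow> ('m list \<Rightarrow>\<^sub>0 'k) set" where
  "tens_rel B n = module.span fscale
     ({gen (u @ (x + y) # v) - gen (u @ x # v) - gen (u @ y # v) |u v x y.
         length u + length v + 1 = n} \<union>
      {gen (u @ bscale B t x # v) - fscale t (gen (u @ x # v)) |u v t x.
         length u + length v + 1 = n} \<union>
      {gen (u @ ract B x a # y # v) - gen (u @ x # lact B a y # v) |u v x a y.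
         length u + length v + 2 = n})"

definition tens ::
    "('k::field, 'r, 'm::ab_group_add, 'z) bimodule_data_scheme \<Rightarrow> nat \<Rightarrow>
      ('k, ('m list \<Rightarrow>\<^sub>0 'k) set) module" where
  "tens B n = quot {f. \<forall>w\<in>Poly_Mapping.keys f. length w = n} (tens_rel B n)"

definition tcls ::
    "('k::field, 'r, 'm::ab_group_add, 'z) bimodule_data_scheme \<Rightarrow> nat \<Rightarrow>
      ('m list \<Rightarrow>\<^sub>0 'k) \<Rightarrow> ('m list \<Rightarrow>\<^sub>0 'k) set" where
  "tcls B n f = f +o tens_rel B n"


section \<open>Corings\<close>

record (overloaded) ('k, 'r, 'm) coring_data = "('k, 'r, 'm) bimodule_data" +
  comult :: "'m \<Rightarrow> ('m list \<Rightarrow>\<^sub>0 'k) set"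
  counit :: "'m \<Rightarrow> 'r"

text \<open>
  \<open>swsum sc f \<phi>\<close> is the sum of the \<open>\<phi> c' c''\<close> for a linear combination \<open>f\<close> of two-letter
  words \<open>[c', c'']\<close>, and \<open>sweedler sc B c \<phi>\<close> is the Sweedler sum of \<open>\<phi> c\<^sup>1 c\<^sup>2\<close>, computed
  with some representative of \<open>\<Delta>(c)\<close>.  Below it is used only for expressions that are
  \<open>R\<close>-balanced (modulo the relations of the target), so that the class of the result does
  not depend on the representative.
\<close>

definition swsum ::
    "('k::field \<Rightarrow> 'v::ab_group_add \<Rightarrow> 'v) \<Rightarrow> ('m list \<Rightarrow>\<^sub>0 'k) \<Rightarrow> ('m \<Rightarrow> 'm \<Rightarrow> 'v) \<Rightarrow> 'v" where
  "swsum sc f \<phi> = lin_ext sc (\<lambda>w. \<phi> (w ! 0) (w ! 1)) f"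

definition sweedler ::
    "('k::field \<Rightarrow> 'v::ab_group_add \<Rightarrow> 'v) \<Rightarrow> ('k, 'r, 'm, 'z) coring_data_scheme \<Rightarrow> 'm \<Rightarrow>
      ('m \<Rightarrow> 'm \<Rightarrow> 'v) \<Rightarrow> 'v" where
  "sweedler sc B c \<phi> = swsum sc (SOME f. f \<in> comult B c) \<phi>"

text \<open>\<open>k\<close>-linearity of \<open>\<Delta>\<close> and \<open>\<epsilon>\<close> follows from \<open>R\<close>-linearity, as \<open>k\<close> acts through \<open>R\<close>.\<close>

locale coring = bimodule sR B
  for sR :: "'k::field \<Rightarrow> 'r::{ring,monoid_mult} \<Rightarrow> 'r"
    and B :: "('k, 'r, 'm::ab_group_add, 'z) coring_data_scheme" +
  assumes comult_closed: "comult B c \<in> carrier (tens B 2)"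
    and comult_add: "comult B (c + d) = comult B c \<oplus>\<^bsub>tens B 2\<^esub> comult B d"
    and comult_lact:
      "comult B (lact B a c) = tcls B 2 (sweedler fscale B c (\<lambda>x y. gen [lact B a x, y]))"
    and comult_ract:
      "comult B (ract B c a) = tcls B 2 (sweedler fscale B c (\<lambda>x y. gen [x, ract B y a]))"
    and counit_add: "counit B (c + d) = counit B c + counit B d"
    and counit_lact: "counit B (lact B a c) = a * counit B c"
    and counit_ract: "counit B (ract B c a) = counit B c * a"
    and coassoc:
      "tcls B 3 (sweedler fscale B c (\<lambda>x y. sweedler fscale B x (\<lambda>x1 x2. gen [x1, x2, y]))) =
       tcls B 3 (sweedler fscale B c (\<lambda>x y. sweedler fscale B y (\<lambda>y1 y2. gen [x, y1, y2])))"
    and counit_left: "sweedler (bscale B) B c (\<lambda>x y. lact B (counit B x) y) = c"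
    and counit_right: "sweedler (bscale B) B c (\<lambda>x y. ract B x (counit B y)) = c"


section \<open>Bialgebroids and para Hopf algebroids\<close>

record (overloaded) ('k, 'r, 'h) bialgebroid_data =
  scale_R :: "'k \<Rightarrow> 'r \<Rightarrow> 'r"
  scale_H :: "'k \<Rightarrow> 'h \<Rightarrow> 'h"
  src :: "'r \<Rightarrow> 'h"   \<comment> \<open>\<open>\<alpha>\<close>\<close>
  tgt :: "'r \<Rightarrow> 'h"   \<comment> \<open>\<open>\<beta>\<close>\<close>
  comult_H :: "'h \<Rightarrow> ('h list \<Rightarrow>\<^sub>0 'k) set"
  counit_H :: "'h \<Rightarrow> 'r"

record (overloaded) ('k, 'r, 'h) para_hopf_data = "('k, 'r, 'h) bialgebroid_data" +
  antipode :: "'h \<Rightarrow> 'h"   \<comment> \<open>\<open>T\<close>\<close>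

definition H_coring ::
    "('k, 'r, 'h::{ring,monoid_mult}, 'z) bialgebroid_data_scheme \<Rightarrow> ('k, 'r, 'h) coring_data" where
  "H_coring A = \<lparr>bscale = scale_H A, lact = (\<lambda>a x. src A a * x), ract = (\<lambda>x b. tgt A b * x),
     comult = comult_H A, counit = counit_H A\<rparr>"

text \<open>That \<open>\<Delta>(1) = 1 \<otimes> 1\<close> is not an axiom; in a para Hopf algebroid it follows from
  \<open>antipode_comult\<close> (below) for \<open>h = 1\<close>, multiplied by \<open>\<Delta>(1)\<close>.\<close>

locale bialgebroid =
  H: k_algebra "scale_H A" + coring "scale_R A" "H_coring A"
  for A :: "('k::field, 'r::{ring,monoid_mult}, 'h::{ring,monoid_mult}, 'z) bialgebroid_data_scheme" +
  assumes src_add: "src A (a + b) = src A a + src A b"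
    and src_scale: "src A (scale_R A t a) = scale_H A t (src A a)"
    and src_mult: "src A (a * b) = src A a * src A b"
    and src_one: "src A 1 = 1"
    and tgt_add: "tgt A (a + b) = tgt A a + tgt A b"
    and tgt_scale: "tgt A (scale_R A t a) = scale_H A t (tgt A a)"
    and tgt_mult: "tgt A (a * b) = tgt A b * tgt A a"
    and tgt_one: "tgt A 1 = 1"
    and src_tgt: "src A a * tgt A b = tgt A b * src A a"
    and comult_tgt_src:
      "sweedler fscale (H_coring A) h (\<lambda>x y. gen [x * tgt A a, y] - gen [x, y * src A a])
         \<in> tens_rel (H_coring A) 2"
    and comult_mult:
      "comult_H A (g * h) = tcls (H_coring A) 2
         (sweedler fscale (H_coring A) g (\<lambda>g1 g2.
            sweedler fscale (H_coring A) h (\<lambda>h1 h2. gen [g1 * h1, g2 * h2])))"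
    and counit_one: "counit_H A 1 = 1"
    and counit_mult: "counit_H A (h * g) = counit_H A (h * tgt A (counit_H A g))"

locale para_hopf_algebroid = bialgebroid A
  for A :: "('k::field, 'r::{ring,monoid_mult}, 'h::{ring,monoid_mult}, 'z) para_hopf_data_scheme" +
  assumes antipode_add: "antipode A (g + h) = antipode A g + antipode A h"
    and antipode_scale: "antipode A (scale_H A t h) = scale_H A t (antipode A h)"
    and antipode_mult: "antipode A (g * h) = antipode A h * antipode A g"
    and antipode_one: "antipode A 1 = 1"
    and antipode_tgt: "antipode A (tgt A a) = src A a"
    and antipode_convolution:
      "sweedler (scale_H A) (H_coring A) h (\<lambda>x y. antipode A x * y) =
         tgt A (counit_H A (antipode A h))"
    and antipode_antipode: "antipode A (antipode A h) = h"
    and antipode_comult: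
      "tcls (H_coring A) 2
         (sweedler fscale (H_coring A) h (\<lambda>h1 h2.
            sweedler fscale (H_coring A) (antipode A h1) (\<lambda>x y. gen [x * h2, y]))) =
       tcls (H_coring A) 2 (gen [1, antipode A h])"

definition act_R ::
    "('k, 'r, 'h::{ring,monoid_mult}, 'z) bialgebroid_data_scheme \<Rightarrow> 'h \<Rightarrow> 'r \<Rightarrow> 'r" where
  "act_R A h r = counit_H A (h * src A r)"


section \<open>Module corings\<close>

record (overloaded) ('k, 'r, 'h, 'm) module_coring_data = "('k, 'r, 'm) coring_data" +
  hact :: "'h \<Rightarrow> 'm \<Rightarrow> 'm"

locale module_coring = bialgebroid A + C: coring "scale_R A" C
  for A :: "('k::field, 'r::{ring,monoid_mult}, 'h::{ring,monoid_mult}, 'y) bialgebroid_data_scheme"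
    and C :: "('k, 'r, 'h, 'c::ab_group_add, 'z) module_coring_data_scheme" +
  assumes hact_add_left: "hact C (g + h) c = hact C g c + hact C h c"
    and hact_add_right: "hact C h (c + d) = hact C h c + hact C h d"
    and hact_mult: "hact C (g * h) c = hact C g (hact C h c)"
    and hact_one: "hact C 1 c = c"
    and hact_scale: "hact C (scale_H A t h) c = bscale C t (hact C h c)"
    and hact_src: "hact C (src A a) c = lact C a c"
    and hact_tgt: "hact C (tgt A a) c = ract C c a"
    and comult_hact:
      "comult C (hact C h c) = tcls C 2
         (sweedler fscale (H_coring A) h (\<lambda>h1 h2.
            sweedler fscale C c (\<lambda>c1 c2. gen [hact C h1 c1, hact C h2 c2])))"
    and counit_hact: "counit C (hact C h c) = act_R A h (counit C c)"


section \<open>The cochain modules\<close>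

text \<open>\<open>iter_comult B n c\<close> represents \<open>c\<^sup>1 \<otimes>\<^sub>R \<dots> \<otimes>\<^sub>R c\<^sup>n\<^sup>+\<^sup>1\<close> (\<open>n + 1\<close> factors, the
  upper indices being Sweedler's).\<close>

primrec iter_comult ::
    "('k::field, 'r, 'm, 'z) coring_data_scheme \<Rightarrow> nat \<Rightarrow> 'm \<Rightarrow> ('m list \<Rightarrow>\<^sub>0 'k)" where
  "iter_comult B 0 c = gen [c]"
| "iter_comult B (Suc n) c =
     sweedler fscale B c (\<lambda>x y. lin_ext fscale (\<lambda>w. gen (x # w)) (iter_comult B n y))"

text \<open>The diagonal action of \<open>H\<close> on the tensor power of \<open>n \<ge> 1\<close> factors, an element of
  which is a coset \<open>U\<close>.\<close>

definition diag_act ::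
    "('k::field, 'r, 'h::{ring,monoid_mult}, 'y) bialgebroid_data_scheme \<Rightarrow>
     ('k, 'r, 'h, 'c::ab_group_add, 'z) module_coring_data_scheme \<Rightarrow> nat \<Rightarrow>
     'h \<Rightarrow> ('c list \<Rightarrow>\<^sub>0 'k) set \<Rightarrow> ('c list \<Rightarrow>\<^sub>0 'k) set" where
  "diag_act A C n h U = tcls C n
     (lin_ext fscale (\<lambda>u. lin_ext fscale (\<lambda>v. gen (map2 (hact C) u v)) (SOME f. f \<in> U))
        (iter_comult (H_coring A) (n - 1) h))"

text \<open>
  The left \<open>H\<close>-modules over which the cochain modules are formed: \<open>R\<close> itself for \<open>n = 0\<close>, the
  \<open>n\<close>-fold tensor power of \<open>C\<close> for \<open>n \<ge> 1\<close>.  The two cases are put in one type by means of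
  \<open>Inl\<close> and \<open>Inr\<close>.
\<close>

primrec Cpow ::
    "('k::field, 'r::{ring,monoid_mult}, 'h::{ring,monoid_mult}, 'y) bialgebroid_data_scheme \<Rightarrow>
     ('k, 'r, 'h, 'c::ab_group_add, 'z) module_coring_data_scheme \<Rightarrow> nat \<Rightarrow>
     ('k, 'r + ('c list \<Rightarrow>\<^sub>0 'k) set) module" where
  "Cpow A C 0 = \<lparr>carrier = range Inl, monoid.mult = undefined, one = undefined, zero = Inl 0,
     add = (\<lambda>x y. Inl (projl x + projl y)), module.smult = (\<lambda>t x. Inl (scale_R A t (projl x)))\<rparr>"
| "Cpow A C (Suc n) = \<lparr>carrier = Inr ` carrier (tens C (Suc n)), monoid.mult = undefined, one = undefined,
     zero = Inr \<zero>\<^bsub>tens C (Suc n)\<^esub>,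
     add = (\<lambda>x y. Inr (projr x \<oplus>\<^bsub>tens C (Suc n)\<^esub> projr y)),
     module.smult = (\<lambda>t x. Inr (t \<odot>\<^bsub>tens C (Suc n)\<^esub> projr x))\<rparr>"

primrec Cpow_act ::
    "('k::field, 'r, 'h::{ring,monoid_mult}, 'y) bialgebroid_data_scheme \<Rightarrow>
     ('k, 'r, 'h, 'c::ab_group_add, 'z) module_coring_data_scheme \<Rightarrow> nat \<Rightarrow>
     'h \<Rightarrow> 'r + ('c list \<Rightarrow>\<^sub>0 'k) set \<Rightarrow> 'r + ('c list \<Rightarrow>\<^sub>0 'k) set" where
  "Cpow_act A C 0 h x = Inl (act_R A h (projl x))"
| "Cpow_act A C (Suc n) h x = Inr (diag_act A C (Suc n) h (projr x))"

text \<open>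
  The tensor product over \<open>H\<close> of a right \<open>H\<close>-module (scalar multiplication \<open>sc\<close>, action
  \<open>rho\<close>, on the whole type) and a left \<open>H\<close>-module (\<open>M\<close> with action \<open>lam\<close>).
\<close>

definition htens_rel ::
    "('k::field \<Rightarrow> 'c::ab_group_add \<Rightarrow> 'c) \<Rightarrow> ('c \<Rightarrow> 'h \<Rightarrow> 'c) \<Rightarrow>
     ('k, 'm) module \<Rightarrow> ('h \<Rightarrow> 'm \<Rightarrow> 'm) \<Rightarrow> ('c \<times> 'm \<Rightarrow>\<^sub>0 'k) set" where
  "htens_rel sc rho M lam = module.span fscale
     ({gen (x + y, m) - gen (x, m) - gen (y, m) |x y m. m \<in> carrier M} \<union>
      {gen (x, m \<oplus>\<^bsub>M\<^esub> m') - gen (x, m) - gen (x, m') |x m m'. m \<in> carrier M \<and> m' \<in> carrier M} \<union>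
      {gen (sc t x, m) - fscale t (gen (x, m)) |t x m. m \<in> carrier M} \<union>
      {gen (x, t \<odot>\<^bsub>M\<^esub> m) - fscale t (gen (x, m)) |t x m. m \<in> carrier M} \<union>
      {gen (rho x h, m) - gen (x, lam h m) |x h m. m \<in> carrier M})"

definition htens ::
    "('k::field \<Rightarrow> 'c::ab_group_add \<Rightarrow> 'c) \<Rightarrow> ('c \<Rightarrow> 'h \<Rightarrow> 'c) \<Rightarrow>
     ('k, 'm) module \<Rightarrow> ('h \<Rightarrow> 'm \<Rightarrow> 'm) \<Rightarrow> ('k, ('c \<times> 'm \<Rightarrow>\<^sub>0 'k) set) module" where
  "htens sc rho M lam =
     quot {f. \<forall>p\<in>Poly_Mapping.keys f. snd p \<in> carrier M} (htens_rel sc rho M lam)"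

definition right_act ::
    "('k, 'r, 'h, 'y) para_hopf_data_scheme \<Rightarrow>
     ('k, 'r, 'h, 'c, 'z) module_coring_data_scheme \<Rightarrow> 'c \<Rightarrow> 'h \<Rightarrow> 'c" where
  "right_act A C c h = hact C (antipode A h) c"

type_synonym ('k, 'r, 'c) cochain = "('c \<times> ('r + ('c list \<Rightarrow>\<^sub>0 'k) set) \<Rightarrow>\<^sub>0 'k) set"

definition cochains ::
    "('k::field, 'r::{ring,monoid_mult}, 'h::{ring,monoid_mult}, 'y) para_hopf_data_scheme \<Rightarrow>
     ('k, 'r, 'h, 'c::ab_group_add, 'z) module_coring_data_scheme \<Rightarrow> nat \<Rightarrow>
     ('k, ('k, 'r, 'c) cochain) module" where
  "cochains A C n = htens (bscale C) (right_act A C) (Cpow A C n) (Cpow_act A C n)"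

definition cochain_cls ::
    "('k::field, 'r::{ring,monoid_mult}, 'h::{ring,monoid_mult}, 'y) para_hopf_data_scheme \<Rightarrow>
     ('k, 'r, 'h, 'c::ab_group_add, 'z) module_coring_data_scheme \<Rightarrow> nat \<Rightarrow>
     ('c \<times> ('r + ('c list \<Rightarrow>\<^sub>0 'k) set) \<Rightarrow>\<^sub>0 'k) \<Rightarrow> ('k, 'r, 'c) cochain" where
  "cochain_cls A C n f =
     f +o htens_rel (bscale C) (right_act A C) (Cpow A C n) (Cpow_act A C n)"

text \<open>\<open>tensor0 A C c r\<close> is \<open>c \<otimes>\<^sub>H r\<close>.  For \<open>n \<ge> 1\<close>, \<open>tensor A C n\<close> is linear, and sends the word
  \<open>[c\<^sub>0, c\<^sub>1, \<dots>, c\<^sub>n]\<close> to \<open>c\<^sub>0 \<otimes>\<^sub>H (c\<^sub>1 \<otimes>\<^sub>R \<dots> \<otimes>\<^sub>R c\<^sub>n)\<close>.\<close>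

definition tensor0 ::
    "('k::field, 'r::{ring,monoid_mult}, 'h::{ring,monoid_mult}, 'y) para_hopf_data_scheme \<Rightarrow>
     ('k, 'r, 'h, 'c::ab_group_add, 'z) module_coring_data_scheme \<Rightarrow> 'c \<Rightarrow> 'r \<Rightarrow>
     ('k, 'r, 'c) cochain" where
  "tensor0 A C c r = cochain_cls A C 0 (gen (c, Inl r))"

definition tensor ::
    "('k::field, 'r::{ring,monoid_mult}, 'h::{ring,monoid_mult}, 'y) para_hopf_data_scheme \<Rightarrow>
     ('k, 'r, 'h, 'c::ab_group_add, 'z) module_coring_data_scheme \<Rightarrow> nat \<Rightarrow>
     ('c list \<Rightarrow>\<^sub>0 'k) \<Rightarrow> ('k, 'r, 'c) cochain" where
  "tensor A C n f =
     cochain_cls A C n (lin_ext fscale (\<lambda>w. gen (hd w, Inr (tcls C n (gen (tl w))))) f)"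


section \<open>Cocyclic modules\<close>

text \<open>
  The first index of each operator is the degree of its source:
  \<open>\<delta> n i : D\<^sup>n \<rightarrow> D\<^sup>n\<^sup>+\<^sup>1\<close> for \<open>i \<le> n + 1\<close>, \<open>\<sigma> (n + 1) j : D\<^sup>n\<^sup>+\<^sup>1 \<rightarrow> D\<^sup>n\<close> for \<open>j \<le> n\<close>, and
  \<open>\<tau> n : D\<^sup>n \<rightarrow> D\<^sup>n\<close>.  Other values of the index functions are irrelevant.
\<close>

locale cosimplicial_module =
  fixes D :: "nat \<Rightarrow> ('k::field, 'x) module"
    and \<delta> :: "nat \<Rightarrow> nat \<Rightarrow> 'x \<Rightarrow> 'x"
    and \<sigma> :: "nat \<Rightarrow> nat \<Rightarrow> 'x \<Rightarrow> 'x"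
  assumes is_module: "Module.module (ring_of_type_algebra :: 'k ring) (D n)"
    and coface_linear: "i \<le> n + 1 \<Longrightarrow> klinear (D n) (D (n + 1)) (\<delta> n i)"
    and codegeneracy_linear: "j \<le> n \<Longrightarrow> klinear (D (n + 1)) (D n) (\<sigma> (n + 1) j)"
    and coface_coface: "\<lbrakk>x \<in> carrier (D n); i < j; j \<le> n + 2\<rbrakk> \<Longrightarrow>
      \<delta> (n + 1) j (\<delta> n i x) = \<delta> (n + 1) i (\<delta> n (j - 1) x)"
    and codegeneracy_codegeneracy: "\<lbrakk>x \<in> carrier (D (n + 2)); i \<le> j; j \<le> n\<rbrakk> \<Longrightarrow>
      \<sigma> (n + 1) j (\<sigma> (n + 2) i x) = \<sigma> (n + 1) i (\<sigma> (n + 2) (j + 1) x)"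
    and codegeneracy_coface_less: "\<lbrakk>x \<in> carrier (D n); i < j; j \<le> n\<rbrakk> \<Longrightarrow>
      \<sigma> (n + 1) j (\<delta> n i x) = \<delta> (n - 1) i (\<sigma> n (j - 1) x)"
    and codegeneracy_coface_id: "\<lbrakk>x \<in> carrier (D n); j \<le> n; i = j \<or> i = j + 1\<rbrakk> \<Longrightarrow>
      \<sigma> (n + 1) j (\<delta> n i x) = x"
    and codegeneracy_coface_greater: "\<lbrakk>x \<in> carrier (D n); j + 1 < i; i \<le> n + 1\<rbrakk> \<Longrightarrow>
      \<sigma> (n + 1) j (\<delta> n i x) = \<delta> (n - 1) (i - 1) (\<sigma> n j x)"

locale cocyclic_module = cosimplicial_module D \<delta> \<sigma>
  for D :: "nat \<Rightarrow> ('k::field, 'x) module" and \<delta> \<sigma> +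
  fixes \<tau> :: "nat \<Rightarrow> 'x \<Rightarrow> 'x"
  assumes cyclic_linear: "klinear (D n) (D n) (\<tau> n)"
    and cyclic_coface: "\<lbrakk>x \<in> carrier (D n); 1 \<le> i; i \<le> n + 1\<rbrakk> \<Longrightarrow>
      \<tau> (n + 1) (\<delta> n i x) = \<delta> n (i - 1) (\<tau> n x)"
    and cyclic_coface_0: "x \<in> carrier (D n) \<Longrightarrow> \<tau> (n + 1) (\<delta> n 0 x) = \<delta> n (n + 1) x"
    and cyclic_codegeneracy: "\<lbrakk>x \<in> carrier (D (n + 1)); 1 \<le> j; j \<le> n\<rbrakk> \<Longrightarrow>
      \<tau> n (\<sigma> (n + 1) j x) = \<sigma> (n + 1) (j - 1) (\<tau> (n + 1) x)"
    and cyclic_codegeneracy_0: "x \<in> carrier (D (n + 1)) \<Longrightarrow>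
      \<tau> n (\<sigma> (n + 1) 0 x) = \<sigma> (n + 1) n (\<tau> (n + 1) (\<tau> (n + 1) x))"
    and cyclic_order: "x \<in> carrier (D n) \<Longrightarrow> (\<tau> n ^^ (n + 1)) x = x"

end

theory Submission
  imports Defs
begin

text \<open>
  On words \<open>[c\<^sub>0, \<dots>, c\<^sub>n]\<close> the operators are the obvious ones: \<open>\<tau>\<close> rotates,
  \<open>\<delta>\<^sub>i\<close> comultiplies the \<open>i\<close>-th letter, \<open>\<sigma>\<^sub>j\<close> multiplies the \<open>j\<close>-th letter by the
  counit of the next one, and the last coface is \<open>\<tau> \<delta>\<^sub>0\<close>.  For such operators the cocyclic
  identities are coassociativity, counitality, the interchange of two Sweedler sums, and
  bookkeeping with lists.  What has to be proved is that the operators are well defined on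
  \<open>C \<otimes>\<^sub>H C \<otimes>\<^sub>R \<dots> \<otimes>\<^sub>R C\<close>.

  The linear maps out of the \<open>n\<close>-th cochain module correspond to the \<^emph>\<open>admissible\<close> functions
  on words: the functions \<open>F\<close> that are \<open>k\<close>-multilinear, balanced over \<open>R\<close> in neighbouring
  letters, and satisfy \<open>F (T(h)c\<^sub>0, c\<^sub>1, \<dots>, c\<^sub>n) = F (c\<^sub>0, h\<^sup>1c\<^sub>1, \<dots>, h\<^sup>nc\<^sub>n)\<close>
  (lemmas \<open>adm_wcls\<close> and \<open>ex_induced\<close>).  Since \<open>c \<otimes>\<^sub>H r = cr \<otimes>\<^sub>H 1\<close>, degree \<open>0\<close> fits the
  pattern with one-letter words and the relation \<open>F (T(h)c) = F (c\<epsilon>(h))\<close>.  So an operator on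
  words is well defined as soon as composition with it preserves admissibility.  Three
  computations suffice:

  \<^item> Rotation (\<open>adm_rot\<close>).  Since \<open>T\<^sup>2 = id\<close>, an \<open>h\<^sup>1\<close> acting on the first letter can be moved to
    the other letters as \<open>T(h\<^sup>1)\<close>, where it meets \<open>h\<^sup>2\<close>; the axiom
    \<open>T(h\<^sup>1)\<^sup>1h\<^sup>2 \<otimes> T(h\<^sup>1)\<^sup>2 = 1 \<otimes> T(h)\<close> leaves only \<open>T(h)\<close>, acting on the last letter.

  \<^item> The coface \<open>\<delta>\<^sub>0\<close> (\<open>adm_face_0\<close>).  The same axiom is applied to \<open>T(h)\<close>; in degree \<open>0\<close> the axiom
    \<open>T(h\<^sup>1)h\<^sup>2 = \<beta>(\<epsilon>(T(h)))\<close> takes its place.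

  \<^item> The codegeneracy \<open>\<sigma>\<^sub>0\<close> (\<open>adm_degen_0\<close>).  Here \<open>\<Delta>(h\<alpha>(s)) = h\<^sup>1\<alpha>(s) \<otimes> h\<^sup>2\<close> reduces the
    claim to the counit law of \<open>H\<close>.

  The other cofaces and codegeneracies are conjugates of these by rotations.

  To compute with equalities instead of congruences, every quotient by a subspace \<open>N\<close> is
  replaced by a linear projection with kernel \<open>N\<close>, which exists because \<open>k\<close> is a field.  A
  Sweedler expression then denotes an honest element of a free vector space, and it is
  independent of representatives because the summand is balanced.
\<close>

section \<open>Linear algebra of free vector spaces\<close>

lemma linear_plus: "Vector_Spaces.linear s1 s2 g \<Longrightarrow> g (x + y) = g x + g y"
  and linear_times: "Vector_Spaces.linear s1 s2 g \<Longrightarrow> g (s1 t x) = s2 t (g x)"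
  by (simp_all add: Vector_Spaces.linear_iff)

lemma linear_comp:
  "Vector_Spaces.linear s2 s3 g \<Longrightarrow> Vector_Spaces.linear s1 s2 f \<Longrightarrow>
    Vector_Spaces.linear s1 s3 (\<lambda>x. g (f x))"
  by (simp add: Vector_Spaces.linear_iff)

lemma lookup_fscale [simp]: "Poly_Mapping.lookup (fscale a f) x = a * Poly_Mapping.lookup f x"
  by (simp add: fscale_def Poly_Mapping.map.rep_eq when_def)

interpretation free: vector_space "fscale :: 'k::field \<Rightarrow> ('x \<Rightarrow>\<^sub>0 'k) \<Rightarrow> ('x \<Rightarrow>\<^sub>0 'k)"
  by unfold_locales (auto intro!: poly_mapping_eqI simp: lookup_add algebra_simps)

lemma keys_fscale: "Poly_Mapping.keys (fscale a f) \<subseteq> Poly_Mapping.keys f"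
  by (auto simp: in_keys_iff)

context vector_space
begin

lemma lin_ext_eq_sum:
  assumes "finite S" "Poly_Mapping.keys f \<subseteq> S"
  shows "lin_ext scale \<phi> f = (\<Sum>x\<in>S. scale (Poly_Mapping.lookup f x) (\<phi> x))"
  unfolding lin_ext_def using assms
  by (intro sum.mono_neutral_left) (auto simp: in_keys_iff)

lemma lin_ext_zero [simp]: "lin_ext scale \<phi> 0 = 0"
  by (simp add: lin_ext_def)

lemma lin_ext_gen [simp]: "lin_ext scale \<phi> (gen x) = \<phi> x"
  by (simp add: lin_ext_def)

lemma lin_ext_add: "lin_ext scale \<phi> (f + g) = lin_ext scale \<phi> f + lin_ext scale \<phi> g"
proof -
  let ?S = "Poly_Mapping.keys f \<union> Poly_Mapping.keys g"
  have "Poly_Mapping.keys (f + g) \<subseteq> ?S" by (rule Poly_Mapping.keys_add)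
  then show ?thesis
    by (simp add: lin_ext_eq_sum[of ?S] lookup_add scale_left_distrib sum.distrib)
qed

lemma lin_ext_fscale: "lin_ext scale \<phi> (fscale a f) = scale a (lin_ext scale \<phi> f)"
  using keys_fscale[of a f]
  by (simp add: lin_ext_eq_sum[of "Poly_Mapping.keys f"] scale_sum_right)

lemma linear_lin_ext: "Vector_Spaces.linear fscale scale (lin_ext scale \<phi>)"
  by (simp add: Vector_Spaces.linear_iff lin_ext_add lin_ext_fscale free.vector_space_axioms
      vector_space_axioms)

lemma lin_ext_diff: "lin_ext scale \<phi> (f - g) = lin_ext scale \<phi> f - lin_ext scale \<phi> g"
  by (metis add_diff_cancel_right' diff_add_cancel lin_ext_add)

lemma lin_ext_fun_add: "lin_ext scale (\<lambda>x. \<phi> x + \<psi> x) f = lin_ext scale \<phi> f + lin_ext scale \<psi> f"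
  by (simp add: lin_ext_def scale_right_distrib sum.distrib)

lemma lin_ext_fun_scale: "lin_ext scale (\<lambda>x. scale a (\<phi> x)) f = scale a (lin_ext scale \<phi> f)"
  by (simp add: lin_ext_def scale_sum_right mult.commute)

lemma lin_ext_cong:
  "(\<And>x. x \<in> Poly_Mapping.keys f \<Longrightarrow> \<phi> x = \<psi> x) \<Longrightarrow> lin_ext scale \<phi> f = lin_ext scale \<psi> f"
  by (simp add: lin_ext_def)

lemma lin_ext_commute:
  "lin_ext scale (\<lambda>x. lin_ext scale (\<phi> x) g) f = lin_ext scale (\<lambda>y. lin_ext scale (\<lambda>x. \<phi> x y) f) g"
  unfolding lin_ext_def scale_sum_right
  by (subst sum.swap) (simp add: mult.commute)

lemma lin_ext_in_subspace:
  assumes "subspace S" "\<And>x. x \<in> Poly_Mapping.keys f \<Longrightarrow> \<phi> x \<in> S"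
  shows "lin_ext scale \<phi> f \<in> S"
  unfolding lin_ext_def using assms by (intro subspace_sum subspace_scale) auto

end

lemma linear_lin_ext_commute:
  assumes "Vector_Spaces.linear s1 s2 L"
  shows "L (lin_ext s1 \<phi> f) = lin_ext s2 (\<lambda>x. L (\<phi> x)) f"
proof -
  interpret L: Vector_Spaces.linear s1 s2 L by fact
  show ?thesis by (simp add: lin_ext_def L.sum L.scale)
qed

lemma lin_ext_lin_ext:
  assumes "vector_space sc"
  shows "lin_ext sc \<phi> (lin_ext fscale \<psi> f) = lin_ext sc (\<lambda>x. lin_ext sc \<phi> (\<psi> x)) f"
  using linear_lin_ext_commute[OF vector_space.linear_lin_ext[OF assms]] .

lemma lin_ext_single [simp]: "lin_ext fscale gen f = f"
proof (rule poly_mapping_eqI)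
  fix x
  have "Poly_Mapping.lookup (lin_ext fscale gen f) x =
      (\<Sum>y\<in>Poly_Mapping.keys f. Poly_Mapping.lookup f y * Poly_Mapping.lookup (gen y) x)"
    unfolding lin_ext_def by (induction "Poly_Mapping.keys f" rule: infinite_finite_induct)
      (simp_all add: Poly_Mapping.lookup_sum)
  also have "\<dots> = (\<Sum>y\<in>Poly_Mapping.keys f. if y = x then Poly_Mapping.lookup f y else 0)"
    by (intro sum.cong) (auto simp: lookup_single when_def)
  also have "\<dots> = Poly_Mapping.lookup f x"
    by (simp add: in_keys_iff)
  finally show "Poly_Mapping.lookup (lin_ext fscale gen f) x = Poly_Mapping.lookup f x" .
qed

lemma subspace_keys: "free.subspace {f. \<forall>x\<in>Poly_Mapping.keys f. P x}"
proof (rule free.subspaceI, goal_cases)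
  case (2 f g)
  then show ?case using Poly_Mapping.keys_add[of f g] by blast
next
  case (3 a f)
  then show ?case using keys_fscale[of a f] by blast
qed simp

text \<open>Extend a basis of \<open>N\<close> to a basis of the whole space and send the basis vectors in \<open>N\<close> to
\<open>0\<close>.\<close>

lemma ex_linear_projection:
  fixes N :: "('x \<Rightarrow>\<^sub>0 'k::field) set"
  assumes N: "free.subspace N"
  shows "\<exists>q. Vector_Spaces.linear fscale fscale q \<and> (\<forall>f. q (q f) = q f) \<and>
    (\<forall>f. q f = 0 \<longleftrightarrow> f \<in> N)"
proof -
  interpret vector_space_pair "fscale :: 'k \<Rightarrow> ('x \<Rightarrow>\<^sub>0 'k) \<Rightarrow> _" "fscale :: 'k \<Rightarrow> ('x \<Rightarrow>\<^sub>0 'k) \<Rightarrow> _" ..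
  obtain B where B: "B \<subseteq> N" "free.independent B" "N \<subseteq> free.span B"
    using free.maximal_independent_subset by metis
  define D where "D = free.extend_basis B"
  have D: "free.independent D" "free.span D = UNIV" "B \<subseteq> D"
    using B(2) by (simp_all add: D_def free.independent_extend_basis free.extend_basis_superset)
  define q where "q = construct D (\<lambda>b. if b \<in> B then 0 else b)"
  have q: "Vector_Spaces.linear fscale fscale q"
    unfolding q_def by (rule linear_construct[OF D(1)])
  then interpret q: Vector_Spaces.linear fscale fscale q .
  have qD: "q b = (if b \<in> B then 0 else b)" if "b \<in> D" for b
    unfolding q_def using construct_basis[OF D(1) that] .
  have diff: "v - q v \<in> N" for v
  proof -
    have "v \<in> free.span D" using D(2) by simp
    then show ?thesis
    proof (induction rule: free.span_induct_alt)
      case base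
      then show ?case using N by (simp add: free.subspace_0)
    next
      case (step c x y)
      have "x - q x \<in> N" using qD[OF step(1)] B(1) N by (auto simp: free.subspace_0)
      moreover have "fscale c x + y - q (fscale c x + y) = fscale c (x - q x) + (y - q y)"
        by (simp add: q.add q.scale free.scale_right_diff_distrib)
      ultimately show ?case
        using step(2) free.subspace_add[OF N] free.subspace_scale[OF N] by metis
    qed
  qed
  have zero: "q v = 0" if "v \<in> N" for v
    by (rule q.eq_0_on_span[of B]) (use that B(3) qD D(3) in auto)
  have "q (q v) = q v" for v
    using zero[OF diff[of v]] by (simp add: q.diff)
  moreover have "q v = 0 \<longleftrightarrow> v \<in> N" for v
    using zero[of v] diff[of v] by auto
  ultimately show ?thesis using q by blast
qed

text \<open>Equality of values of \<open>proj_along N\<close> is congruence modulo \<open>N\<close> (\<open>proj_along_eq_iff\<close>), but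
unlike the choice of coset representatives it is linear.\<close>

definition proj_along :: "('x \<Rightarrow>\<^sub>0 'k::field) set \<Rightarrow> ('x \<Rightarrow>\<^sub>0 'k) \<Rightarrow> ('x \<Rightarrow>\<^sub>0 'k)" where
  "proj_along N = (SOME q. Vector_Spaces.linear fscale fscale q \<and> (\<forall>f. q (q f) = q f) \<and>
    (\<forall>f. q f = 0 \<longleftrightarrow> f \<in> N))"

context
  fixes N :: "('x \<Rightarrow>\<^sub>0 'k::field) set"
  assumes N: "free.subspace N"
begin

lemma linear_proj_along: "Vector_Spaces.linear fscale fscale (proj_along N)"
  and proj_along_idem: "proj_along N (proj_along N f) = proj_along N f"
  and proj_along_eq_0_iff: "proj_along N f = 0 \<longleftrightarrow> f \<in> N"
  using someI_ex[OF ex_linear_projection[OF N]] unfolding proj_along_def[symmetric] by blast+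

lemma proj_along_eq_iff: "proj_along N f = proj_along N g \<longleftrightarrow> f - g \<in> N"
proof -
  interpret q: Vector_Spaces.linear fscale fscale "proj_along N" by (rule linear_proj_along)
  show ?thesis by (simp add: proj_along_eq_0_iff[symmetric] q.diff)
qed

lemma coset_eq_iff: "f +o N = g +o N \<longleftrightarrow> f - g \<in> N"
proof
  assume "f +o N = g +o N"
  moreover have "f \<in> f +o N" using free.subspace_0[OF N] by (force simp: elt_set_plus_def)
  ultimately show "f - g \<in> N" using set_plus_imp_minus by blast
next
  assume *: "f - g \<in> N"
  have "f +o N = (g + (f - g)) +o N" by simp
  also have "\<dots> = g +o ((f - g) +o N)" by (simp add: set_plus_rearrange2)
  also have "(f - g) +o N = N"
  proof (intro equalityI subsetI)
    fix x assume "x \<in> (f - g) +o N"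
    then show "x \<in> N" using * free.subspace_add[OF N] by (auto simp: elt_set_plus_def)
  next
    fix x assume "x \<in> N"
    then have "x - (f - g) \<in> N" using * free.subspace_diff[OF N] by blast
    then show "x \<in> (f - g) +o N" by (rule set_minus_imp_plus)
  qed
  finally show "f +o N = g +o N" .
qed

lemma coset_eq_proj_iff: "f +o N = g +o N \<longleftrightarrow> proj_along N f = proj_along N g"
  by (simp add: coset_eq_iff proj_along_eq_iff)

lemma mem_coset_iff: "g \<in> f +o N \<longleftrightarrow> proj_along N g = proj_along N f"
  by (simp add: proj_along_eq_iff set_minus_plus)

lemma coset_self: "f \<in> f +o N"
  by (simp add: mem_coset_iff)

lemma proj_along_some_coset [simp]: "proj_along N (SOME g. g \<in> f +o N) = proj_along N f"
  using someI[of "\<lambda>g. g \<in> f +o N", OF coset_self] by (simp add: mem_coset_iff)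

lemma subspace_plus_self: "N + N = N"
  by (rule Set.set_eqI)
      (force simp: set_plus_def intro: free.subspace_add[OF N] free.subspace_0[OF N])

lemma coset_add: "(f +o N) + (g +o N) = (f + g) +o N"
  by (simp add: set_plus_rearrange subspace_plus_self)

lemma coset_scale: "fscale a ` (f +o N) + N = fscale a f +o N"
proof (rule Set.set_eqI)
  fix x
  show "x \<in> fscale a ` (f +o N) + N \<longleftrightarrow> x \<in> fscale a f +o N"
  proof
    assume "x \<in> fscale a ` (f +o N) + N"
    then obtain m n where "m \<in> N" "n \<in> N" "x = fscale a (f + m) + n"
      by (auto simp: set_plus_def elt_set_plus_def)
    then have "x = fscale a f + (fscale a m + n)" "fscale a m + n \<in> N"
      using free.subspace_add[OF N] free.subspace_scale[OF N]
      by (auto simp: free.scale_right_distrib add.assoc)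
    then show "x \<in> fscale a f +o N" by (auto simp: elt_set_plus_def)
  next
    assume "x \<in> fscale a f +o N"
    then obtain n where "n \<in> N" "x = fscale a f + n" by (auto simp: elt_set_plus_def)
    then show "x \<in> fscale a ` (f +o N) + N"
      using coset_self by (auto intro!: set_plus_intro)
  qed
qed

end

lemma quot_simps [simp]:
  "carrier (quot F N) = {f +o N |f. f \<in> F}"
  "\<zero>\<^bsub>quot F N\<^esub> = N"
  "U \<oplus>\<^bsub>quot F N\<^esub> V = U + V"
  "a \<odot>\<^bsub>quot F N\<^esub> U = fscale a ` U + N"
  by (simp_all add: quot_def)

lemma quot_is_module:
  fixes F :: "('x \<Rightarrow>\<^sub>0 'k::field) set"
  assumes F: "free.subspace F" and N: "free.subspace N"
  shows "Module.module (ring_of_type_algebra :: 'k ring) (quot F N)"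
proof (rule moduleI)
  show "cring (ring_of_type_algebra :: 'k ring)" by (rule cring_from_type_algebra)
next
  show "abelian_group (quot F N)"
  proof (rule abelian_groupI; (elim CollectE exE conjE | simp del: quot_simps)?)
    show "\<zero>\<^bsub>quot F N\<^esub> \<in> carrier (quot F N)"
      using free.subspace_0[OF F] by (auto intro!: exI[of _ 0] simp: set_zero_plus)
  next
    fix x y assume "x \<in> carrier (quot F N)" "y \<in> carrier (quot F N)"
    then show "x \<oplus>\<^bsub>quot F N\<^esub> y \<in> carrier (quot F N)"
      by (auto simp: coset_add[OF N] intro: free.subspace_add[OF F])
  next
    fix x y z
    show "(x \<oplus>\<^bsub>quot F N\<^esub> y) \<oplus>\<^bsub>quot F N\<^esub> z = x \<oplus>\<^bsub>quot F N\<^esub> (y \<oplus>\<^bsub>quot F N\<^esub> z)"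
      by (simp add: add.assoc)
  next
    fix x y
    show "x \<oplus>\<^bsub>quot F N\<^esub> y = y \<oplus>\<^bsub>quot F N\<^esub> x" by (simp add: add.commute)
  next
    fix x assume "x \<in> carrier (quot F N)"
    then obtain f where f: "f \<in> F" "x = f +o N" by auto
    show "\<zero>\<^bsub>quot F N\<^esub> \<oplus>\<^bsub>quot F N\<^esub> x = x"
      using coset_add[OF N, of 0 f] by (simp add: f)
    have "- f \<in> F" using free.subspace_neg[OF F] f by blast
    moreover have "(- f +o N) + (f +o N) = N"
      using coset_add[OF N, of "- f" f] by simp
    ultimately show "\<exists>y\<in>carrier (quot F N). y \<oplus>\<^bsub>quot F N\<^esub> x = \<zero>\<^bsub>quot F N\<^esub>"
      using f by auto
  qed
next
  fix a b :: 'k and x y assume "x \<in> carrier (quot F N)" "y \<in> carrier (quot F N)"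
  then obtain f g where f: "f \<in> F" "x = f +o N" and g: "g \<in> F" "y = g +o N" by auto
  show "a \<odot>\<^bsub>quot F N\<^esub> x \<in> carrier (quot F N)"
    using f by (auto simp: coset_scale[OF N] intro: free.subspace_scale[OF F])
  show "a \<odot>\<^bsub>quot F N\<^esub> (x \<oplus>\<^bsub>quot F N\<^esub> y) = a \<odot>\<^bsub>quot F N\<^esub> x \<oplus>\<^bsub>quot F N\<^esub> a \<odot>\<^bsub>quot F N\<^esub> y"
    using f g by (simp add: coset_scale[OF N] coset_add[OF N] free.scale_right_distrib)
next
  fix a b :: 'k and x assume "x \<in> carrier (quot F N)"
  then obtain f where f: "f \<in> F" "x = f +o N" by auto
  show "(a \<oplus>\<^bsub>ring_of_type_algebra\<^esub> b) \<odot>\<^bsub>quot F N\<^esub> x = a \<odot>\<^bsub>quot F N\<^esub> x \<oplus>\<^bsub>quot F N\<^esub> b \<odot>\<^bsub>quot F N\<^esub> x"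
    using f by (simp add: ring_of_type_algebra_def coset_scale[OF N] coset_add[OF N]
        flip: free.scale_left_distrib)
  show "(a \<otimes>\<^bsub>ring_of_type_algebra\<^esub> b) \<odot>\<^bsub>quot F N\<^esub> x = a \<odot>\<^bsub>quot F N\<^esub> (b \<odot>\<^bsub>quot F N\<^esub> x)"
    using f by (simp add: ring_of_type_algebra_def coset_scale[OF N])
  show "\<one>\<^bsub>ring_of_type_algebra\<^esub> \<odot>\<^bsub>quot F N\<^esub> x = x"
    using f coset_scale[OF N, of 1 f] by (simp add: ring_of_type_algebra_def)
qed

lemma klinear_quotI:
  assumes N: "free.subspace N" and N': "free.subspace N'" and
      L: "Vector_Spaces.linear fscale fscale L"
    and \<phi>: "\<And>f. f \<in> F \<Longrightarrow> \<phi> (f +o N) = L f +o N'"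
    and closed: "\<And>x. x \<in> carrier (quot F N) \<Longrightarrow> \<phi> x \<in> carrier (quot F' N')"
    and F: "free.subspace F"
  shows "klinear (quot F N) (quot F' N') \<phi>"
  unfolding klinear_def
proof (intro conjI ballI allI)
  fix x y assume "x \<in> carrier (quot F N)" "y \<in> carrier (quot F N)"
  then obtain f g where f: "f \<in> F" "x = f +o N" and g: "g \<in> F" "y = g +o N" by auto
  show "\<phi> (x \<oplus>\<^bsub>quot F N\<^esub> y) = \<phi> x \<oplus>\<^bsub>quot F' N'\<^esub> \<phi> y"
    using f g free.subspace_add[OF F f(1) g(1)]
    by (simp add: coset_add[OF N] \<phi> linear_plus[OF L] coset_add[OF N'])
next
  fix a x assume "x \<in> carrier (quot F N)"
  then obtain f where f: "f \<in> F" "x = f +o N" by auto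
  show "\<phi> (a \<odot>\<^bsub>quot F N\<^esub> x) = a \<odot>\<^bsub>quot F' N'\<^esub> \<phi> x"
    using f free.subspace_scale[OF F f(1)]
    by (simp add: coset_scale[OF N] \<phi> linear_times[OF L] coset_scale[OF N'])
qed (rule closed)

section \<open>Balanced multilinear maps and the Sweedler calculus\<close>

text \<open>These are the functions on words of length \<open>n\<close> that factor through the \<open>n\<close>-fold tensor power
over \<open>R\<close>.  Values in free vector spaces suffice, since \<open>proj_along\<close> represents the elements of
quotients in them.\<close>

definition multilin ::
    "('k::field, 'r, 'm::ab_group_add, 'z) bimodule_data_scheme \<Rightarrow> nat \<Rightarrow>
      ('m list \<Rightarrow> ('y \<Rightarrow>\<^sub>0 'k)) \<Rightarrow> bool" where
  "multilin B n \<phi> \<longleftrightarrow>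
     (\<forall>u v. length u + length v + 1 = n \<longrightarrow>
        Vector_Spaces.linear (bscale B) fscale (\<lambda>x. \<phi> (u @ x # v))) \<and>
     (\<forall>u v x a y. length u + length v + 2 = n \<longrightarrow>
        \<phi> (u @ ract B x a # y # v) = \<phi> (u @ x # lact B a y # v))"

definition balanced2 ::
    "('k::field, 'r, 'm::ab_group_add, 'z) bimodule_data_scheme \<Rightarrow>
      ('m \<Rightarrow> 'm \<Rightarrow> ('y \<Rightarrow>\<^sub>0 'k)) \<Rightarrow> bool" where
  "balanced2 B \<phi> \<longleftrightarrow>
     (\<forall>y. Vector_Spaces.linear (bscale B) fscale (\<lambda>x. \<phi> x y)) \<and>
     (\<forall>x. Vector_Spaces.linear (bscale B) fscale (\<phi> x)) \<and>
     (\<forall>x a y. \<phi> (ract B x a) y = \<phi> x (lact B a y))"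

definition balanced3 ::
    "('k::field, 'r, 'm::ab_group_add, 'z) bimodule_data_scheme \<Rightarrow>
      ('m \<Rightarrow> 'm \<Rightarrow> 'm \<Rightarrow> ('y \<Rightarrow>\<^sub>0 'k)) \<Rightarrow> bool" where
  "balanced3 B \<phi> \<longleftrightarrow> (\<forall>z. balanced2 B (\<lambda>x y. \<phi> x y z)) \<and> (\<forall>x. balanced2 B (\<phi> x))"

lemma linear_lin_ext_fun:
  fixes \<phi> :: "'m::ab_group_add \<Rightarrow> 'x \<Rightarrow> ('y \<Rightarrow>\<^sub>0 'k::field)"
  assumes "vector_space s1"
    and "\<And>x. x \<in> Poly_Mapping.keys f \<Longrightarrow> Vector_Spaces.linear s1 fscale (\<lambda>m. \<phi> m x)"
  shows "Vector_Spaces.linear s1 fscale (\<lambda>m. lin_ext fscale (\<phi> m) f)"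
proof -
  have "lin_ext fscale (\<phi> (a + b)) f = lin_ext fscale (\<phi> a) f + lin_ext fscale (\<phi> b) f" for a b
    unfolding free.lin_ext_fun_add[symmetric]
    by (rule free.lin_ext_cong) (rule linear_plus[OF assms(2)])
  moreover have "lin_ext fscale (\<phi> (s1 t a)) f = fscale t (lin_ext fscale (\<phi> a) f)" for t a
    unfolding free.lin_ext_fun_scale[symmetric]
    by (rule free.lin_ext_cong) (rule linear_times[OF assms(2)])
  ultimately show ?thesis
    using assms(1) free.vector_space_axioms by (simp add: Vector_Spaces.linear_iff)
qed

lemma multilin_linear:
  "multilin B n \<phi> \<Longrightarrow> length u + length v + 1 = n \<Longrightarrow>
    Vector_Spaces.linear (bscale B) fscale (\<lambda>x. \<phi> (u @ x # v))"
  by (simp add: multilin_def)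

lemma multilin_balanced:
  "multilin B n \<phi> \<Longrightarrow> length u + length v + 2 = n \<Longrightarrow>
    \<phi> (u @ ract B x a # y # v) = \<phi> (u @ x # lact B a y # v)"
  by (simp add: multilin_def)

lemma multilin_Cons:
  fixes B :: "('k::field, 'r, 'm::ab_group_add, 'z) bimodule_data_scheme"
  assumes "multilin B (Suc n) \<phi>"
  shows "multilin B n (\<lambda>w. \<phi> (x # w))"
  unfolding multilin_def
proof (intro conjI allI impI)
  fix u v :: "'m list" assume "length u + length v + 1 = n"
  then show "Vector_Spaces.linear (bscale B) fscale (\<lambda>y. \<phi> (x # u @ y # v))"
    using multilin_linear[OF assms, of "x # u" v] by simp
next
  fix u v :: "'m list" and y a z assume "length u + length v + 2 = n"
  then show "\<phi> (x # u @ ract B y a # z # v) = \<phi> (x # u @ y # lact B a z # v)"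
    using multilin_balanced[OF assms, of "x # u" v] by simp
qed

lemma multilin_snoc:
  fixes B :: "('k::field, 'r, 'm::ab_group_add, 'z) bimodule_data_scheme"
  assumes "multilin B (Suc n) \<phi>"
  shows "multilin B n (\<lambda>w. \<phi> (w @ [x]))"
  unfolding multilin_def
proof (intro conjI allI impI)
  fix u v :: "'m list" assume "length u + length v + 1 = n"
  then show "Vector_Spaces.linear (bscale B) fscale (\<lambda>y. \<phi> ((u @ y # v) @ [x]))"
    using multilin_linear[OF assms, of u "v @ [x]"] by simp
next
  fix u v :: "'m list" and y a z assume "length u + length v + 2 = n"
  then show "\<phi> ((u @ ract B y a # z # v) @ [x]) = \<phi> ((u @ y # lact B a z # v) @ [x])"
    using multilin_balanced[OF assms, of u "v @ [x]"] by simp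
qed

lemma multilin_Cons_linear:
  "multilin B (Suc n) \<phi> \<Longrightarrow> length v = n \<Longrightarrow>
    Vector_Spaces.linear (bscale B) fscale (\<lambda>x. \<phi> (x # v))"
  using multilin_linear[of B "Suc n" \<phi> "[]" v] by simp

lemma multilin_Cons_balanced:
  "multilin B (Suc n) \<phi> \<Longrightarrow> length w = n \<Longrightarrow> w \<noteq> [] \<Longrightarrow>
    \<phi> (ract B x a # w) = \<phi> (x # lact B a (hd w) # tl w)"
  using multilin_balanced[of B "Suc n" \<phi> "[]" "tl w" x a "hd w"] by (cases w) auto

lemma subspace_tens_rel: "free.subspace (tens_rel B n)"
  by (simp add: tens_rel_def free.subspace_span)

lemma multilin_tens_rel:
  fixes B :: "('k::field, 'r, 'm::ab_group_add, 'z) bimodule_data_scheme"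
    and \<phi> :: "'m list \<Rightarrow> ('y \<Rightarrow>\<^sub>0 'k)"
  assumes \<phi>: "multilin B n \<phi>" and f: "f \<in> tens_rel B n"
  shows "lin_ext fscale \<phi> f = 0"
proof -
  interpret vector_space_pair "fscale :: 'k \<Rightarrow> ('m list \<Rightarrow>\<^sub>0 'k) \<Rightarrow> _" "fscale :: 'k \<Rightarrow> ('y \<Rightarrow>\<^sub>0 'k) \<Rightarrow> _"
      ..
  have l: "Vector_Spaces.linear fscale fscale (lin_ext fscale \<phi>)"
    by (rule free.linear_lin_ext)
  show ?thesis
  proof (rule linear_eq_0_on_span[OF l _ f[unfolded tens_rel_def]])
    fix g :: "'m list \<Rightarrow>\<^sub>0 'k"
    assume "g \<in> {gen (u @ (x + y) # v) - gen (u @ x # v) - gen (u @ y # v) |u v x y.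
         length u + length v + 1 = n} \<union>
      {gen (u @ bscale B t x # v) - fscale t (gen (u @ x # v)) |u v t x.
         length u + length v + 1 = n} \<union>
      {gen (u @ ract B x a # y # v) - gen (u @ x # lact B a y # v) |u v x a y.
         length u + length v + 2 = n}"
    then show "lin_ext fscale \<phi> g = 0"
      using \<phi>
      by (auto simp: free.lin_ext_diff free.lin_ext_fscale multilin_balanced
          linear_plus[OF multilin_linear] linear_times[OF multilin_linear])
  qed
qed

lemma keys_tens_rel:
  fixes B :: "('k::field, 'r, 'm::ab_group_add, 'z) bimodule_data_scheme"
  assumes "f \<in> tens_rel B n" "w \<in> Poly_Mapping.keys f"
  shows "length w = n"
proof -
  define S :: "('m list \<Rightarrow>\<^sub>0 'k) set" where "S = {f. \<forall>w\<in>Poly_Mapping.keys f. length w = n}"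
  have S: "free.subspace S" unfolding S_def by (rule subspace_keys)
  have gen: "gen w \<in> S" if "length w = n" for w using that by (simp add: S_def)
  have "tens_rel B n \<subseteq> S"
    unfolding tens_rel_def
    by (intro free.span_minimal S)
      (auto intro!: free.subspace_diff[OF S] free.subspace_scale[OF S] gen)
  then show ?thesis using assms by (auto simp: S_def)
qed

lemma lin_ext_multilin_tcls:
  assumes "multilin B n \<phi>" "tcls B n f = tcls B n g"
  shows "lin_ext fscale \<phi> f = lin_ext fscale \<phi> g"
  using multilin_tens_rel[OF assms(1), of "f - g"] assms(2)
  by (simp add: free.lin_ext_diff tcls_def coset_eq_iff[OF subspace_tens_rel])

context bimodule
begin

lemma linear_bscaleI:
  assumes "\<And>x y. g (x + y) = g x + g y" "\<And>t x. g (bscale B t x) = fscale t (g x)"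
  shows "Vector_Spaces.linear (bscale B) fscale g"
  using assms by (simp add: Vector_Spaces.linear_iff M.vector_space_axioms free.vector_space_axioms)

text \<open>The universal balanced multilinear function.  It turns equality of tensors into equality of
vectors.\<close>

lemma multilin_proj_gen: "multilin B n (\<lambda>w. proj_along (tens_rel B n) (gen w))"
proof -
  note [simp] = proj_along_eq_0_iff[OF subspace_tens_rel]
  interpret q: Vector_Spaces.linear fscale fscale "proj_along (tens_rel B n)"
    by (rule linear_proj_along[OF subspace_tens_rel])
  have *: "proj_along (tens_rel B n) f = 0" if "f \<in> S" "S \<subseteq> tens_rel B n" for f S
    using that by auto
  have sub: "S \<subseteq> tens_rel B n" if "S =
      {gen (u @ (x + y) # v) - gen (u @ x # v) - gen (u @ y # v) |u v x y.
         length u + length v + 1 = n} \<or> S =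
      {gen (u @ bscale B t x # v) - fscale t (gen (u @ x # v)) |u v t x.
         length u + length v + 1 = n} \<or> S =
      {gen (u @ ract B x a # y # v) - gen (u @ x # lact B a y # v) |u v x a y.
         length u + length v + 2 = n}" for S
    unfolding tens_rel_def using that by (auto intro!: free.span_base)
  show ?thesis
    unfolding multilin_def
  proof (intro conjI allI impI linear_bscaleI)
    fix u v :: "'m list" and x y assume "length u + length v + 1 = n"
    then
        have "proj_along (tens_rel B n) (gen (u @ (x + y) # v) - gen (u @ x # v) - gen
              (u @ y # v)) = 0"
      by (intro *[OF _ sub[OF disjI1[OF refl]]]) auto
    then show "proj_along (tens_rel B n) (gen (u @ (x + y) # v)) =
       proj_along (tens_rel B n) (gen (u @ x # v)) + proj_along (tens_rel B n) (gen (u @ y # v))"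
      by (simp only: q.diff q.add diff_diff_eq right_minus_eq)
  next
    fix u v :: "'m list" and x t assume "length u + length v + 1 = n"
    then have "proj_along (tens_rel B n) (gen (u @ bscale B t x # v) - fscale t (gen (u @ x # v))) =
        0"
      by (intro *[OF _ sub[OF disjI2[OF disjI1[OF refl]]]]) auto
    then show "proj_along (tens_rel B n) (gen (u @ bscale B t x # v)) =
       fscale t (proj_along (tens_rel B n) (gen (u @ x # v)))"
      by (simp add: q.diff q.scale)
  next
    fix u v :: "'m list" and x a y assume "length u + length v + 2 = n"
    then
        have "proj_along (tens_rel B n) (gen (u @ ract B x a # y # v) - gen
              (u @ x # lact B a y # v)) = 0"
      by (intro *[OF _ sub[OF disjI2[OF disjI2[OF refl]]]]) blast
    then show "proj_along (tens_rel B n) (gen (u @ ract B x a # y # v)) =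
       proj_along (tens_rel B n) (gen (u @ x # lact B a y # v))"
      by (simp add: q.diff)
  qed
qed

lemma multilin_of_balanced2:
  assumes "balanced2 B \<phi>"
  shows "multilin B 2 (\<lambda>w. \<phi> (w ! 0) (w ! 1))"
  unfolding multilin_def
proof (intro conjI allI impI)
  fix u v :: "'m list" assume "length u + length v + 1 = 2"
  then have "(\<exists>y. u = [] \<and> v = [y]) \<or> (\<exists>y. u = [y] \<and> v = [])"
    by (cases u; cases v) auto
  then show "Vector_Spaces.linear (bscale B) fscale (\<lambda>x. \<phi> ((u @ x # v) ! 0) ((u @ x # v) ! 1))"
    using assms unfolding balanced2_def by auto
next
  fix u v :: "'m list" and x a y assume "length u + length v + 2 = 2"
  then show "\<phi> ((u @ ract B x a # y # v) ! 0) ((u @ ract B x a # y # v) ! 1) =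
      \<phi> ((u @ x # lact B a y # v) ! 0) ((u @ x # lact B a y # v) ! 1)"
    using assms unfolding balanced2_def by auto
qed

lemma multilin_of_balanced3:
  assumes "balanced3 B \<phi>"
  shows "multilin B 3 (\<lambda>w. \<phi> (w ! 0) (w ! 1) (w ! 2))"
  unfolding multilin_def
proof (intro conjI allI impI)
  fix u v :: "'m list" assume "length u + length v + 1 = 3"
  then have "(\<exists>y z. u = [] \<and> v = [y, z]) \<or> (\<exists>y z. u = [y] \<and> v = [z]) \<or> (\<exists>y z. u = [y, z] \<and> v = [])"
    by (cases u; cases v; cases "tl u"; cases "tl v") auto
  then show "Vector_Spaces.linear (bscale B) fscale
      (\<lambda>x. \<phi> ((u @ x # v) ! 0) ((u @ x # v) ! 1) ((u @ x # v) ! 2))"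
    using assms unfolding balanced3_def balanced2_def by auto
next
  fix u v :: "'m list" and x a y assume "length u + length v + 2 = 3"
  then have "(\<exists>z. u = [] \<and> v = [z]) \<or> (\<exists>z. u = [z] \<and> v = [])"
    by (cases u; cases v) auto
  then
      show "\<phi> ((u @ ract B x a # y # v) ! 0) ((u @ ract B x a # y # v) ! 1)
            ((u @ ract B x a # y # v) ! 2) =
      \<phi> ((u @ x # lact B a y # v) ! 0) ((u @ x # lact B a y # v) ! 1) ((u @ x # lact B a y # v) !
          2)"
    using assms unfolding balanced3_def balanced2_def by auto
qed

end

lemma sweedler_linear:
  assumes "Vector_Spaces.linear s1 s2 L"
  shows "L (sweedler s1 B c \<phi>) = sweedler s2 B c (\<lambda>x y. L (\<phi> x y))"
  by (simp add: sweedler_def swsum_def linear_lin_ext_commute[OF assms])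

lemma sweedler_commute:
  "sweedler fscale B c (\<lambda>x y. sweedler fscale B' d (\<phi> x y)) =
    sweedler fscale B' d (\<lambda>u v. sweedler fscale B c (\<lambda>x y. \<phi> x y u v))"
  unfolding sweedler_def swsum_def by (rule free.lin_ext_commute)

lemma lin_ext_sweedler_commute:
  "lin_ext fscale (\<lambda>w. sweedler fscale B c (\<phi> w)) f =
    sweedler fscale B c (\<lambda>x y. lin_ext fscale (\<lambda>w. \<phi> w x y) f)"
  unfolding sweedler_def swsum_def by (rule free.lin_ext_commute)

lemma lin_ext_of_sweedler:
  "lin_ext fscale \<psi> (sweedler fscale B c \<phi>) = sweedler fscale B c (\<lambda>x y. lin_ext fscale \<psi> (\<phi> x y))"
  by (rule sweedler_linear[OF free.linear_lin_ext])

lemma linear_sweedler_fun: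
  assumes "vector_space s1" "\<And>x y. Vector_Spaces.linear s1 fscale (\<lambda>m. \<phi> m x y)"
  shows "Vector_Spaces.linear s1 fscale (\<lambda>m. sweedler fscale B c (\<phi> m))"
  unfolding sweedler_def swsum_def using assms by (intro linear_lin_ext_fun)

lemma lin_ext_of_swsum:
  "lin_ext fscale \<psi> (swsum fscale f \<phi>) = swsum fscale f (\<lambda>x y. lin_ext fscale \<psi> (\<phi> x y))"
  by (simp add: swsum_def lin_ext_lin_ext[OF free.vector_space_axioms])

context coring
begin

lemma comult_eq_tcls: "f \<in> comult B c \<Longrightarrow> comult B c = tcls B 2 f"
  using comult_closed[of c] by (auto simp: tens_def tcls_def mem_coset_iff[OF subspace_tens_rel]
      coset_eq_proj_iff[OF subspace_tens_rel])

lemma comult_nonempty: "\<exists>f. f \<in> comult B c"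
  using comult_closed[of c] by (auto simp: tens_def intro: coset_self[OF subspace_tens_rel])

lemma comult_some: "comult B c = tcls B 2 (SOME f. f \<in> comult B c)"
  using comult_eq_tcls[OF someI_ex[OF comult_nonempty]] .

lemma swsum_eq_of_tcls_eq:
  assumes "balanced2 B \<phi>" "tcls B 2 f = tcls B 2 g"
  shows "swsum fscale f \<phi> = swsum fscale g \<phi>"
  unfolding swsum_def
  using lin_ext_multilin_tcls[OF multilin_of_balanced2[OF assms(1)] assms(2)] .

text \<open>A balanced summand sends the relations of the tensor product to \<open>0\<close>, so the choice of a
representative in \<open>sweedler\<close> does not matter.\<close>

lemma swsum_eq_sweedler:
  assumes "balanced2 B \<phi>" "f \<in> comult B c"
  shows "swsum fscale f \<phi> = sweedler fscale B c \<phi>"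
  unfolding sweedler_def
  by (rule swsum_eq_of_tcls_eq[OF assms(1)])
    (rule trans[OF comult_eq_tcls[OF assms(2), symmetric] comult_some])

lemma swsum_eq_of_comult:
  assumes "balanced2 B \<phi>" "comult B c = tcls B 2 f"
  shows "sweedler fscale B c \<phi> = swsum fscale f \<phi>"
  using swsum_eq_sweedler[OF assms(1), of f c] assms(2)
  by (simp add: tcls_def coset_self[OF subspace_tens_rel])

lemma sweedler_add:
  assumes "balanced2 B \<phi>"
  shows "sweedler fscale B (c + d) \<phi> = sweedler fscale B c \<phi> + sweedler fscale B d \<phi>"
proof -
  have "comult B (c + d) = tcls B 2 ((SOME f. f \<in> comult B c) + (SOME f. f \<in> comult B d))"
    unfolding comult_add tens_def tcls_def quot_simps coset_add[OF subspace_tens_rel, symmetric]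
    using comult_some[of c] comult_some[of d] by (metis tcls_def)
  from swsum_eq_of_comult[OF assms this] show ?thesis
    by (simp add: sweedler_def swsum_def free.lin_ext_add)
qed

lemma sweedler_lact:
  assumes "balanced2 B \<phi>"
  shows "sweedler fscale B (lact B a c) \<phi> = sweedler fscale B c (\<lambda>x y. \<phi> (lact B a x) y)"
  using swsum_eq_of_comult[OF assms comult_lact]
  by (simp add: swsum_def lin_ext_of_sweedler)

lemma sweedler_ract:
  assumes "balanced2 B \<phi>"
  shows "sweedler fscale B (ract B c a) \<phi> = sweedler fscale B c (\<lambda>x y. \<phi> x (ract B y a))"
  using swsum_eq_of_comult[OF assms comult_ract]
  by (simp add: swsum_def lin_ext_of_sweedler)

lemma bscale_eq_lact: "bscale B t x = lact B (sR t 1) x"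
  by (simp add: lact_scale lact_one)

text \<open>Homogeneity comes from \<open>R\<close>-linearity of the coproduct, since \<open>k\<close> acts through \<open>R\<close>.\<close>

lemma linear_sweedler:
  assumes "balanced2 B \<phi>"
  shows "Vector_Spaces.linear (bscale B) fscale (\<lambda>c. sweedler fscale B c \<phi>)"
proof (rule linear_bscaleI)
  fix t x
  have "\<phi> (bscale B t c) d = fscale t (\<phi> c d)" for c d
    using assms unfolding balanced2_def by (blast dest: linear_times)
  then have "\<phi> (lact B (sR t 1) c) d = fscale t (\<phi> c d)" for c d
    by (simp only: bscale_eq_lact)
  then have "sweedler fscale B (bscale B t x) \<phi> = sweedler fscale B x (\<lambda>x y. fscale t (\<phi> x y))"
    by (simp only: bscale_eq_lact[of t x] sweedler_lact[OF assms])
  also have "\<dots> = fscale t (sweedler fscale B x \<phi>)"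
    unfolding sweedler_def swsum_def by (rule free.lin_ext_fun_scale)
  finally show "sweedler fscale B (bscale B t x) \<phi> = fscale t (sweedler fscale B x \<phi>)" .
qed (rule sweedler_add[OF assms])

lemma sweedler_coassoc:
  assumes "balanced3 B \<phi>"
  shows "sweedler fscale B c (\<lambda>x y. sweedler fscale B x (\<lambda>x1 x2. \<phi> x1 x2 y)) =
    sweedler fscale B c (\<lambda>x y. sweedler fscale B y (\<phi> x))"
  using lin_ext_multilin_tcls[OF multilin_of_balanced3[OF assms] coassoc[of c]]
  by (simp add: lin_ext_of_sweedler)

lemma sweedler_counit_left:
  assumes "Vector_Spaces.linear (bscale B) fscale \<psi>"
  shows "sweedler fscale B c (\<lambda>x y. \<psi> (lact B (counit B x) y)) = \<psi> c"
  using sweedler_linear[OF assms, of B c] counit_left[of c] by metis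

lemma sweedler_counit_right:
  assumes "Vector_Spaces.linear (bscale B) fscale \<psi>"
  shows "sweedler fscale B c (\<lambda>x y. \<psi> (ract B x (counit B y))) = \<psi> c"
  using sweedler_linear[OF assms, of B c] counit_right[of c] by metis

lemma counit_bscale: "counit B (bscale B t c) = sR t (counit B c)"
  by (metis bscale_eq_lact counit_lact R.scale_mult_left mult_1_left)

lemma ract_bscale: "ract B (bscale B t x) a = bscale B t (ract B x a)"
  by (metis bscale_eq_lact lact_ract)

end

section \<open>Bialgebroids\<close>

lemma H_coring_simps [simp]:
  "bscale (H_coring A) = scale_H A" "lact (H_coring A) a x = src A a * x"
  "ract (H_coring A) x a = tgt A a * x" "comult (H_coring A) = comult_H A"
  "counit (H_coring A) = counit_H A"
  by (simp_all add: H_coring_def)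

context bialgebroid
begin

abbreviation "swH \<equiv> sweedler fscale (H_coring A)"
abbreviation "linH \<equiv> Vector_Spaces.linear (scale_H A) fscale"

lemma linH_mult_right: "linH g \<Longrightarrow> linH (\<lambda>x. g (x * p))"
  and linH_mult_left: "linH g \<Longrightarrow> linH (\<lambda>x. g (p * x))"
  by (simp_all add: Vector_Spaces.linear_iff distrib_right distrib_left
      flip: H.scale_mult_left H.scale_mult_right)

lemma linH_sweedler: "balanced2 (H_coring A) \<phi> \<Longrightarrow> linH (\<lambda>h. swH h \<phi>)"
  using linear_sweedler[of \<phi>] by simp

lemma balanced2_HI:
  assumes "\<And>y. linH (\<lambda>x. \<phi> x y)" "\<And>x. linH (\<phi> x)"
    "\<And>x a y. \<phi> (tgt A a * x) y = \<phi> x (src A a * y)"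
  shows "balanced2 (H_coring A) \<phi>"
  using assms by (simp add: balanced2_def)

lemma balanced2_HD:
  assumes "balanced2 (H_coring A) \<phi>"
  shows "linH (\<lambda>x. \<phi> x y)" "linH (\<phi> x)" "\<phi> (tgt A a * x) y = \<phi> x (src A a * y)"
  using assms by (simp_all add: balanced2_def)

lemma balanced2_src_left:
  assumes "balanced2 (H_coring A) \<phi>"
  shows "balanced2 (H_coring A) (\<lambda>x y. \<phi> (src A a * x) y)"
    and "balanced2 (H_coring A) (\<lambda>x y. \<phi> x (tgt A a * y))"
  by (intro balanced2_HI linH_mult_left balanced2_HD(1,2)[OF assms],
    metis mult.assoc src_tgt balanced2_HD(3)[OF assms])+

lemma balanced2_H_mult_right:
  assumes "balanced2 (H_coring A) \<phi>"
  shows "balanced2 (H_coring A) (\<lambda>x y. \<phi> (x * p) (y * q))"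
  by (intro balanced2_HI linH_mult_right balanced2_HD(1,2)[OF assms])
    (simp add: mult.assoc balanced2_HD(3)[OF assms])

lemma sweedler_tgt_src:
  assumes "balanced2 (H_coring A) \<phi>"
  shows "swH h (\<lambda>x y. \<phi> (x * tgt A a) y) = swH h (\<lambda>x y. \<phi> x (y * src A a))"
proof -
  have "lin_ext fscale (\<lambda>w. \<phi> (w ! 0) (w ! 1))
      (swH h (\<lambda>x y. gen [x * tgt A a, y] - gen [x, y * src A a])) = 0"
    by (rule multilin_tens_rel[OF multilin_of_balanced2[OF assms] comult_tgt_src])
  then have "swH h (\<lambda>x y. \<phi> (x * tgt A a) y - \<phi> x (y * src A a)) = 0"
    by (simp add: lin_ext_of_sweedler free.lin_ext_diff)
  moreover have "swH h (\<lambda>x y. \<phi> (x * tgt A a) y) =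
      swH h (\<lambda>x y. \<phi> (x * tgt A a) y - \<phi> x (y * src A a)) + swH h (\<lambda>x y. \<phi> x (y * src A a))"
    unfolding sweedler_def swsum_def by (simp flip: free.lin_ext_fun_add)
  ultimately show ?thesis by simp
qed

text \<open>Left multiplication by \<open>\<Delta>(h)\<close> is well defined on \<open>H \<otimes>\<^sub>R H\<close>, which is what the condition
\<open>\<Delta>(h)(\<beta>(a) \<otimes> 1 - 1 \<otimes> \<alpha>(a)) = 0\<close> is for.\<close>

lemma balanced2_sweedler_mult:
  assumes \<phi>: "balanced2 (H_coring A) \<phi>"
  shows "balanced2 (H_coring A) (\<lambda>p q. swH h (\<lambda>x y. \<phi> (x * p) (y * q)))"
proof (intro balanced2_HI linear_sweedler_fun)
  fix p a q
  have "swH h (\<lambda>x y. \<phi> (x * tgt A a * p) (y * q)) = swH h (\<lambda>x y. \<phi> (x * p) (y * src A a * q))"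
    by (rule sweedler_tgt_src[OF balanced2_H_mult_right[OF \<phi>]])
  then show "swH h (\<lambda>x y. \<phi> (x * (tgt A a * p)) (y * q)) =
      swH h (\<lambda>x y. \<phi> (x * p) (y * (src A a * q)))"
    by (simp add: mult.assoc)
qed (use \<phi> in \<open>auto intro: H.vector_space_axioms linH_mult_left balanced2_HD\<close>)

lemma sweedler_mult:
  assumes "balanced2 (H_coring A) \<phi>"
  shows "swH (g * h) \<phi> = swH g (\<lambda>g1 g2. swH h (\<lambda>h1 h2. \<phi> (g1 * h1) (g2 * h2)))"
  using swsum_eq_of_comult[OF assms, of "g * h"] comult_mult[of g h]
  by (simp add: swsum_def lin_ext_of_sweedler)

lemma counit_src_mult: "counit_H A (src A a * h) = a * counit_H A h"
  using counit_lact[of a h] by simp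

lemma counit_tgt_mult: "counit_H A (tgt A a * h) = counit_H A h * a"
  using counit_ract[of h a] by simp

lemma counit_src: "counit_H A (src A a) = a"
  using counit_src_mult[of a 1] by (simp add: counit_one)

lemma counit_tgt: "counit_H A (tgt A a) = a"
  using counit_tgt_mult[of a 1] by (simp add: counit_one)

end

context para_hopf_algebroid
begin

lemma antipode_src: "antipode A (src A a) = tgt A a"
  using antipode_antipode[of "tgt A a"] by (simp add: antipode_tgt)

lemma sweedler_antipode:
  assumes "balanced2 (H_coring A) \<phi>"
  shows "swH h (\<lambda>h1 h2. swH (antipode A h1) (\<lambda>x y. \<phi> (x * h2) y)) = \<phi> 1 (antipode A h)"
  using lin_ext_multilin_tcls[OF multilin_of_balanced2[OF assms] antipode_comult[of h]]
  by (simp add: lin_ext_of_sweedler)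

lemma sweedler_convolution:
  assumes "linH \<psi>"
  shows "swH h (\<lambda>x y. \<psi> (antipode A x * y)) = \<psi> (tgt A (counit_H A (antipode A h)))"
  using sweedler_linear[OF assms, of "H_coring A" h] antipode_convolution[of h] by metis

text \<open>\<open>\<Delta>(1) = 1 \<otimes> 1\<close>.  With \<open>e = \<Delta>(1)\<close>, the axiom \<open>antipode_comult\<close> at \<open>1\<close> gives
\<open>T(e\<^sup>1)\<^sup>1e\<^sup>2 \<otimes> T(e\<^sup>1)\<^sup>2 = 1 \<otimes> 1\<close>.  Multiplication by \<open>\<Delta>(1)\<close> from the left fixes the left side,
by multiplicativity of \<open>\<Delta>\<close>, and turns the right side into \<open>\<Delta>(1)\<close>.\<close>

lemma sweedler_one:
  assumes \<phi>: "balanced2 (H_coring A) \<phi>"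
  shows "swH 1 \<phi> = \<phi> 1 1"
proof -
  note \<psi> = balanced2_sweedler_mult[OF \<phi>, of 1]
  \<comment> \<open>The axiom for the functional that first multiplies by \<open>\<Delta>(1)\<close> from the left.\<close>
  have "swH 1 \<phi> = swH 1 (\<lambda>e1 e2. swH (antipode A e1) (\<lambda>x y.
      swH 1 (\<lambda>f1 f2. \<phi> (f1 * (x * e2)) (f2 * y))))"
    using sweedler_antipode[OF \<psi>, of 1] by (simp add: antipode_one)
  also have "\<dots> = swH 1 (\<lambda>e1 e2. swH (1 * antipode A e1) (\<lambda>x y. \<phi> (x * e2) y))"
    using balanced2_H_mult_right[OF \<phi>, where q = 1]
    by (subst sweedler_mult) (simp_all add: mult.assoc sweedler_commute[where c = 1])
  also have "\<dots> = \<phi> 1 1"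
    using sweedler_antipode[OF \<phi>, of 1] by (simp add: antipode_one)
  finally show ?thesis .
qed

text \<open>\<open>\<Delta>(\<alpha>(a)) = \<alpha>(a) \<otimes> 1\<close>, by left \<open>R\<close>-linearity of \<open>\<Delta>\<close> and \<open>\<Delta>(1) = 1 \<otimes> 1\<close>.\<close>

lemma sweedler_mult_src:
  assumes "balanced2 (H_coring A) \<phi>"
  shows "swH (h * src A a) \<phi> = swH h (\<lambda>x y. \<phi> (x * src A a) y)"
proof -
  note \<psi> = balanced2_sweedler_mult[OF assms, of h]
  have "swH (h * src A a) \<phi> = swH (src A a * 1) (\<lambda>p q. swH h (\<lambda>x y. \<phi> (x * p) (y * q)))"
    by (simp add: sweedler_mult[OF assms] sweedler_commute[where c = h])
  also have "\<dots> = swH h (\<lambda>x y. \<phi> (x * src A a) y)"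
    using sweedler_lact[OF \<psi>, of a 1] sweedler_one[OF balanced2_src_left(1)[OF \<psi>]]
    by simp
  finally show ?thesis .
qed

end

section \<open>Module corings and the diagonal action\<close>

context module_coring
begin

abbreviation "swC \<equiv> sweedler fscale C"
abbreviation "linC \<equiv> Vector_Spaces.linear (bscale C) fscale"

lemma hact_bscale: "hact C h (bscale C t c) = bscale C t (hact C h c)"
proof -
  have "bscale C t c = hact C (scale_H A t 1) c" by (simp add: hact_scale hact_one)
  then have "hact C h (bscale C t c) = hact C (scale_H A t (h * 1)) c"
    by (simp only: hact_mult[symmetric] H.scale_mult_right)
  then show ?thesis by (simp add: hact_scale)
qed

lemma linC_hact: "linC g \<Longrightarrow> linC (\<lambda>c. g (hact C h c))"
  by (simp add: Vector_Spaces.linear_iff hact_add_right hact_bscale)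

lemma linH_hact: "linC g \<Longrightarrow> linH (\<lambda>h. g (hact C h c))"
  by (simp add: Vector_Spaces.linear_iff hact_add_left hact_scale H.vector_space_axioms)

lemma linC_ract: "linC g \<Longrightarrow> linC (\<lambda>c. g (ract C c a))"
  by (simp add: hact_tgt[symmetric] linC_hact)

lemma lact_hact: "lact C a (hact C h c) = hact C (src A a * h) c"
  by (simp add: hact_mult hact_src)

lemma ract_hact: "ract C (hact C h c) a = hact C (tgt A a * h) c"
  by (simp add: hact_mult hact_tgt)

lemma hact_lact: "hact C h (lact C a c) = hact C (h * src A a) c"
  by (simp add: hact_mult hact_src)

lemma hact_ract: "hact C h (ract C c a) = hact C (h * tgt A a) c"
  by (simp add: hact_mult hact_tgt)

lemma sweedler_hact:
  assumes "balanced2 C \<phi>"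
  shows "swC (hact C h c) \<phi> =
    swH h (\<lambda>h1 h2. swC c (\<lambda>c1 c2. \<phi> (hact C h1 c1) (hact C h2 c2)))"
  using C.swsum_eq_of_comult[OF assms, of "hact C h c"] comult_hact[of h c]
  by (simp add: swsum_def lin_ext_of_sweedler)

lemma counit_hact_src: "counit C (hact C h c) = counit_H A (h * src A (counit C c))"
  by (simp add: counit_hact act_R_def)

text \<open>\<open>dact h [c\<^sub>1, \<dots>, c\<^sub>n] \<phi>\<close> is the sum \<open>\<phi> [h\<^sup>1c\<^sub>1, \<dots>, h\<^sup>nc\<^sub>n]\<close>: the diagonal action, seen through
a function \<open>\<phi>\<close> on words.  At the empty word the value is \<open>\<phi> []\<close>, which has nothing to do with
the action of \<open>H\<close> on \<open>R\<close>.\<close>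

definition dact :: "'h \<Rightarrow> 'c list \<Rightarrow> ('c list \<Rightarrow> ('x \<Rightarrow>\<^sub>0 'k)) \<Rightarrow> ('x \<Rightarrow>\<^sub>0 'k)" where
  "dact h v \<phi> =
      lin_ext fscale (\<lambda>u. \<phi> (map2 (hact C) u v)) (iter_comult (H_coring A) (length v - 1) h)"

lemma dact_single [simp]: "dact h [c] \<phi> = \<phi> [hact C h c]"
  by (simp add: dact_def)

lemma dact_Cons:
  "v \<noteq> [] \<Longrightarrow> dact h (c # v) \<phi> = swH h (\<lambda>x y. dact y v (\<lambda>w. \<phi> (hact C x c # w)))"
  by (cases v)
      (simp_all add: dact_def lin_ext_of_sweedler lin_ext_lin_ext[OF free.vector_space_axioms])

lemma dact_cong:
  "v \<noteq> [] \<Longrightarrow> (\<And>w. length w = length v \<Longrightarrow> \<phi> w = \<psi> w) \<Longrightarrow> dact h v \<phi> = dact h v \<psi>"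
proof (induction v arbitrary: h \<phi> \<psi>)
  case (Cons c v)
  show ?case
  proof (cases "v = []")
    case False
    have "dact y v (\<lambda>w. \<phi> (hact C x c # w)) = dact y v (\<lambda>w. \<psi> (hact C x c # w))" for x y
      by (rule Cons.IH[OF False]) (simp add: Cons.prems)
    then show ?thesis by (simp add: dact_Cons False)
  qed (simp add: Cons.prems)
qed simp

lemma dact_sweedler_commute:
  "dact h v (\<lambda>w. sweedler fscale B d (\<lambda>x y. \<phi> x y w)) =
      sweedler fscale B d (\<lambda>x y. dact h v (\<phi> x y))"
  unfolding dact_def by (rule lin_ext_sweedler_commute)

lemma linear_dact_fun:
  "vector_space s1 \<Longrightarrow> (\<And>w. Vector_Spaces.linear s1 fscale (\<lambda>m. \<phi> m w)) \<Longrightarrow>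
    Vector_Spaces.linear s1 fscale (\<lambda>m. dact h v (\<phi> m))"
  unfolding dact_def by (rule linear_lin_ext_fun)

lemma linear_dact_fun_length:
  assumes "vector_space s1" "v \<noteq> []"
    "\<And>w. length w = length v \<Longrightarrow> Vector_Spaces.linear s1 fscale (\<lambda>m. \<phi> m w)"
  shows "Vector_Spaces.linear s1 fscale (\<lambda>m. dact h v (\<phi> m))"
proof -
  have "Vector_Spaces.linear s1 fscale (\<lambda>m. dact h v (\<lambda>w. if length w =
        length v then \<phi> m w else 0))"
    by (rule linear_dact_fun[OF assms(1)])
      (use assms in \<open>auto simp: Vector_Spaces.linear_iff free.vector_space_axioms\<close>)
  then show ?thesis
    by (simp add: dact_cong[OF assms(2), of "\<lambda>w. if length w = length v then \<phi> _ w else 0" "\<phi> _"])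
qed

text \<open>Moving \<open>a \<in> R\<close> from \<open>x\<close> to \<open>y\<close> amounts to moving it from the letter \<open>xc\<close> to the first letter
of the rest of the word.  The two facts about the shorter word are assumptions because
the lemma serves in the induction that proves them.\<close>

lemma balanced2_dactI:
  assumes \<phi>: "multilin C (Suc (length v)) \<phi>" and v: "v \<noteq> []"
    and lin: "\<And>x. linH (\<lambda>y. dact y v (\<lambda>w. \<phi> (hact C x c # w)))"
    and src: "\<And>x a y. dact (src A a * y) v (\<lambda>w. \<phi> (hact C x c # w)) =
      dact y v (\<lambda>w. \<phi> (hact C x c # lact C a (hd w) # tl w))"
  shows "balanced2 (H_coring A) (\<lambda>x y. dact y v (\<lambda>w. \<phi> (hact C x c # w)))"
proof (rule balanced2_HI)
  fix y show "linH (\<lambda>x. dact y v (\<lambda>w. \<phi> (hact C x c # w)))"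
    using v by (intro linear_dact_fun_length linH_hact multilin_Cons_linear[OF \<phi>])
      (auto intro: H.vector_space_axioms)
next
  fix x a y
  have "dact y v (\<lambda>w. \<phi> (hact C (tgt A a * x) c # w)) =
      dact y v (\<lambda>w. \<phi> (hact C x c # lact C a (hd w) # tl w))"
    using v by (intro dact_cong)
      (auto simp: ract_hact[symmetric] intro!: multilin_Cons_balanced[OF \<phi>])
  then show "dact y v (\<lambda>w. \<phi> (hact C (tgt A a * x) c # w)) =
      dact (src A a * y) v (\<lambda>w. \<phi> (hact C x c # w))"
    by (simp only: src)
qed (rule lin)

text \<open>The two claims need a joint induction: for a longer word each of them rests on the Sweedler
sum being balanced, which uses both of them for the shorter word.\<close>

lemma linH_dact_and_src_mult:
  assumes "multilin C (length v) \<phi>" "v \<noteq> []"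
  shows "linH (\<lambda>h. dact h v \<phi>) \<and>
    (\<forall>a h. dact (src A a * h) v \<phi> = dact h v (\<lambda>w. \<phi> (lact C a (hd w) # tl w)))"
  using assms
proof (induction v arbitrary: \<phi>)
  case (Cons c v)
  show ?case
  proof (cases "v = []")
    case True
    \<comment> \<open>A one-letter word carries no Sweedler sum.\<close>
    have "linC (\<lambda>x. \<phi> [x])" using multilin_Cons_linear[of C 0 \<phi> "[]"] Cons.prems True by simp
    then show ?thesis
      using True linH_hact[of "\<lambda>x. \<phi> [x]" c] by (simp add: lact_hact)
  next
    case False
    have \<phi>: "multilin C (Suc (length v)) \<phi>" using Cons.prems by simp
    note IH = Cons.IH[OF multilin_Cons[OF \<phi>] False]
    have \<Psi>: "balanced2 (H_coring A) (\<lambda>x y. dact y v (\<lambda>w. \<phi> (hact C x c # w)))"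
      by (rule balanced2_dactI[OF \<phi> False]) (use IH in blast)+
    have "dact (src A a * h) (c # v) \<phi> = dact h (c # v) (\<lambda>w. \<phi> (lact C a (hd w) # tl w))" for a h
      using sweedler_lact[OF \<Psi>, of a h] by (simp add: dact_Cons False lact_hact)
    then show ?thesis using linH_sweedler[OF \<Psi>] by (simp add: dact_Cons False)
  qed
qed simp

lemma linH_dact: "multilin C (length v) \<phi> \<Longrightarrow> v \<noteq> [] \<Longrightarrow> linH (\<lambda>h. dact h v \<phi>)"
  using linH_dact_and_src_mult by blast

lemma dact_src_mult: "multilin C (length v) \<phi> \<Longrightarrow> v \<noteq> [] \<Longrightarrow>
    dact (src A a * h) v \<phi> = dact h v (\<lambda>w. \<phi> (lact C a (hd w) # tl w))"
  using linH_dact_and_src_mult by blast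

lemma balanced2_dact:
  assumes "multilin C (Suc (length v)) \<phi>" and "v \<noteq> []"
  shows "balanced2 (H_coring A) (\<lambda>x y. dact y v (\<lambda>w. \<phi> (hact C x c # w)))"
  by (rule balanced2_dactI[OF assms])
    (simp_all add: linH_dact dact_src_mult multilin_Cons[OF assms(1)] assms(2))

lemma dact_tgt_mult:
  assumes "multilin C (length v) \<phi>" "v \<noteq> []"
  shows "dact (tgt A a * h) v \<phi> = dact h v (\<lambda>w. \<phi> (butlast w @ [ract C (last w) a]))"
  using assms
proof (induction v arbitrary: \<phi> h)
  case (Cons c v)
  show ?case
  proof (cases "v = []")
    case False
    have \<phi>: "multilin C (Suc (length v)) \<phi>" using Cons.prems by simp
    note \<Psi> = balanced2_dact[OF \<phi> False, of c]
    have "dact (tgt A a * h) (c # v) \<phi> =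
        swH h (\<lambda>x y. dact (tgt A a * y) v (\<lambda>w. \<phi> (hact C x c # w)))"
      using sweedler_ract[OF \<Psi>, of h a] by (simp add: dact_Cons False)
    also have "\<dots> = swH h (\<lambda>x y. dact y v (\<lambda>w. \<phi> (hact C x c # butlast w @ [ract C (last w) a])))"
      using Cons.IH[OF multilin_Cons[OF \<phi>] False] by simp
    also have "\<dots> =
        swH h (\<lambda>x y. dact y v (\<lambda>w. \<phi> (butlast (hact C x c # w) @ [ract C (last (hact C x c # w))
            a])))"
    proof -
      have "dact y v (\<lambda>w. \<phi> (hact C x c # butlast w @ [ract C (last w) a])) =
        dact y v (\<lambda>w. \<phi> (butlast (hact C x c # w) @ [ract C (last (hact C x c # w)) a]))" for x y
        using False by (intro dact_cong) auto
      then show ?thesis by simp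
    qed
    finally show ?thesis by (simp add: dact_Cons False)
  qed (simp add: ract_hact)
qed simp

text \<open>\<open>C \<otimes>\<^sub>R \<dots> \<otimes>\<^sub>R C\<close> is an \<open>H\<close>-module: the iterated coproducts are multiplicative.\<close>

lemma dact_mult:
  assumes "multilin C (length v) \<phi>" "v \<noteq> []"
  shows "dact (g * h) v \<phi> = dact h v (\<lambda>w. dact g w \<phi>)"
  using assms
proof (induction v arbitrary: \<phi> g h)
  case (Cons c v)
  show ?case
  proof (cases "v = []")
    case False
    have \<phi>: "multilin C (Suc (length v)) \<phi>" using Cons.prems by simp
    have "dact (g * h) (c # v) \<phi> = swH g (\<lambda>g1 g2. swH h (\<lambda>h1 h2.
        dact (g2 * h2) v (\<lambda>w. \<phi> (hact C g1 (hact C h1 c) # w))))"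
      by (simp add: dact_Cons False sweedler_mult[OF balanced2_dact[OF \<phi> False]] hact_mult)
    also have "\<dots> = swH h (\<lambda>h1 h2. swH g (\<lambda>g1 g2. dact h2 v (\<lambda>w'.
        dact g2 w' (\<lambda>w. \<phi> (hact C g1 (hact C h1 c) # w)))))"
      by (simp add: Cons.IH[OF multilin_Cons[OF \<phi>] False] sweedler_commute[where c = g])
    also have "\<dots> = swH h (\<lambda>h1 h2. dact h2 v (\<lambda>w'.
        swH g (\<lambda>g1 g2. dact g2 w' (\<lambda>w. \<phi> (hact C g1 (hact C h1 c) # w)))))"
      by (simp add: dact_sweedler_commute)
    also have "\<dots> = swH h (\<lambda>h1 h2. dact h2 v (\<lambda>w'. dact g (hact C h1 c # w') \<phi>))"
    proof -
      have "dact h2 v (\<lambda>w'. swH g (\<lambda>g1 g2. dact g2 w' (\<lambda>w. \<phi> (hact C g1 (hact C h1 c) # w)))) =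
        dact h2 v (\<lambda>w'. dact g (hact C h1 c # w') \<phi>)" for h1 h2
        using False by (intro dact_cong dact_Cons[symmetric]) auto
      then show ?thesis by simp
    qed
    finally show ?thesis by (simp add: dact_Cons False)
  qed (simp add: hact_mult)
qed simp

lemma balanced2_dact_snoc:
  assumes \<phi>: "multilin C (Suc (length v)) \<phi>" and v: "v \<noteq> []"
  shows "balanced2 (H_coring A) (\<lambda>p q. dact p v (\<lambda>w. \<phi> (w @ [hact C q c])))"
proof (rule balanced2_HI)
  fix q show "linH (\<lambda>p. dact p v (\<lambda>w. \<phi> (w @ [hact C q c])))"
    by (rule linH_dact[OF multilin_snoc[OF \<phi>] v])
next
  fix p
  have "linC (\<lambda>x. \<phi> (w @ [x]))" if "length w = length v" for w
    using multilin_linear[OF \<phi>, of w "[]"] that by simp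
  then show "linH (\<lambda>q. dact p v (\<lambda>w. \<phi> (w @ [hact C q c])))"
    using v by (intro linear_dact_fun_length linH_hact) (auto intro: H.vector_space_axioms)
next
  fix p a q
  have "dact (tgt A a * p) v (\<lambda>w. \<phi> (w @ [hact C q c])) =
      dact p v (\<lambda>w. \<phi> (butlast w @ [ract C (last w) a, hact C q c]))"
    using dact_tgt_mult[OF multilin_snoc[OF \<phi>] v] by simp
  also have "\<dots> = dact p v (\<lambda>w. \<phi> (w @ [hact C (src A a * q) c]))"
  proof (rule dact_cong[OF v])
    fix w :: "'c list" assume "length w = length v"
    then obtain w' d where w: "w = w' @ [d]" "length w' + 1 = length v"
      using v by (cases w rule: rev_cases) auto
    show "\<phi> (butlast w @ [ract C (last w) a, hact C q c]) = \<phi> (w @ [hact C (src A a * q) c])"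
      using multilin_balanced[OF \<phi>, of w' "[]" d a "hact C q c"] w by (simp add: lact_hact)
  qed
  finally show "dact (tgt A a * p) v (\<lambda>w. \<phi> (w @ [hact C q c])) =
      dact p v (\<lambda>w. \<phi> (w @ [hact C (src A a * q) c]))" .
qed

text \<open>By coassociativity the last tensor factor of the iterated coproduct can be split off instead
of the first.\<close>

lemma dact_snoc:
  assumes "multilin C (Suc (length v)) \<phi>" "v \<noteq> []"
  shows "dact h (v @ [c]) \<phi> = swH h (\<lambda>p q. dact p v (\<lambda>w. \<phi> (w @ [hact C q c])))"
  using assms
proof (induction v arbitrary: \<phi> h)
  case (Cons d v)
  show ?case
  proof (cases "v = []")
    case False
    have \<phi>: "multilin C (Suc (Suc (length v))) \<phi>" using Cons.prems by simp
    note \<phi>' = multilin_Cons[OF \<phi>]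
    have b3: "balanced3 (H_coring A) (\<lambda>x p q. dact p v (\<lambda>w. \<phi> (hact C x d # w @ [hact C q c])))"
      unfolding balanced3_def
    proof (intro conjI allI)
      fix q
      have "multilin C (Suc (length v)) (\<lambda>w. \<phi> (w @ [hact C q c]))"
        by (rule multilin_snoc[OF \<phi>])
      from balanced2_dact[OF this False, of d]
      show "balanced2 (H_coring A) (\<lambda>x p. dact p v (\<lambda>w. \<phi> (hact C x d # w @ [hact C q c])))"
        by simp
    next
      fix x
      show "balanced2 (H_coring A) (\<lambda>p q. dact p v (\<lambda>w. \<phi> (hact C x d # w @ [hact C q c])))"
        using balanced2_dact_snoc[OF \<phi>' False] .
    qed
    have "dact h ((d # v) @ [c]) \<phi> =
        swH h (\<lambda>x y. swH y (\<lambda>p q. dact p v (\<lambda>w. \<phi> (hact C x d # w @ [hact C q c]))))"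
      by (simp add: dact_Cons Cons.IH[OF \<phi>' False])
    also have "\<dots> = swH h (\<lambda>x q. swH x (\<lambda>x1 p. dact p v (\<lambda>w. \<phi> (hact C x1 d # w @ [hact C q c]))))"
      using sweedler_coassoc[OF b3, of h] by simp
    finally show ?thesis by (simp add: dact_Cons False)
  qed (simp add: dact_Cons)
qed simp

end

section \<open>Admissible functions on words\<close>

locale para_module_coring = para_hopf_algebroid A + module_coring A C
  for A :: "('k::field, 'r::{ring,monoid_mult}, 'h::{ring,monoid_mult}, 'y) para_hopf_data_scheme"
    and C :: "('k, 'r, 'h, 'c::ab_group_add, 'z) module_coring_data_scheme"
begin

lemma dact_one: "multilin C (length v) \<phi> \<Longrightarrow> v \<noteq> [] \<Longrightarrow> dact 1 v \<phi> = \<phi> v"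
proof (induction v arbitrary: \<phi>)
  case (Cons c v)
  show ?case
  proof (cases "v = []")
    case False
    have \<phi>: "multilin C (Suc (length v)) \<phi>" using Cons.prems by simp
    show ?thesis
      by (simp add: dact_Cons False sweedler_one[OF balanced2_dact[OF \<phi> False]]
          Cons.IH[OF multilin_Cons[OF \<phi>] False] hact_one)
  qed (simp add: hact_one)
qed simp

text \<open>\<open>\<alpha>(a)\<close> on the right of \<open>h\<close> ends up in the first tensor factor, where it acts on \<open>c\<close>.\<close>

lemma dact_mult_src:
  assumes "multilin C (Suc (length v)) \<phi>"
  shows "dact (h * src A a) (c # v) \<phi> = dact h (lact C a c # v) \<phi>"
proof (cases "v = []")
  case False
  show ?thesis
    by (simp add: dact_Cons False sweedler_mult_src[OF balanced2_dact[OF assms False]] hact_lact)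
qed (simp add: hact_lact)

lemma linC_dact:
  assumes "multilin C (Suc (length u + length v)) \<phi>"
  shows "linC (\<lambda>x. dact h (u @ x # v) \<phi>)"
  using assms
proof (induction u arbitrary: \<phi> h)
  case Nil
  then have \<phi>: "multilin C (Suc (length v)) \<phi>" by simp
  show ?case
  proof (cases "v = []")
    case True
    have "linC (\<lambda>x. \<phi> [x])" using multilin_Cons_linear[OF \<phi>, of "[]"] True by simp
    from linC_hact[OF this] show ?thesis using True by simp
  next
    case False
    have "linC (\<lambda>x. dact q v (\<lambda>w. \<phi> (hact C p x # w)))" for p q
      by (rule linear_dact_fun_length[OF C.M.vector_space_axioms False])
        (rule linC_hact, rule multilin_Cons_linear[OF \<phi>], simp)
    then show ?thesis
      by (simp add: dact_Cons False linear_sweedler_fun[OF C.M.vector_space_axioms])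
  qed
next
  case (Cons d u)
  have "multilin C (Suc (Suc (length u + length v))) \<phi>" using Cons.prems by simp
  from Cons.IH[OF multilin_Cons[OF this]] show ?case
    by (simp add: dact_Cons linear_sweedler_fun[OF C.M.vector_space_axioms])
qed

text \<open>If the balanced position is at the front, the two sides are related by
\<open>\<Delta>(h)(\<beta>(a) \<otimes> 1) = \<Delta>(h)(1 \<otimes> \<alpha>(a))\<close>; otherwise the first letter is peeled off.\<close>

lemma dact_balanced:
  assumes "multilin C (Suc (Suc (length u + length v))) \<phi>"
  shows "dact h (u @ ract C x a # y # v) \<phi> = dact h (u @ x # lact C a y # v) \<phi>"
  using assms
proof (induction u arbitrary: \<phi> h)
  case Nil
  then have \<phi>: "multilin C (Suc (length (y # v))) \<phi>" by simp
  note \<Psi> = balanced2_dact[OF \<phi>, of x, simplified]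
  have "dact h (ract C x a # y # v) \<phi> =
      swH h (\<lambda>p q. dact (q * src A a) (y # v) (\<lambda>w. \<phi> (hact C p x # w)))"
    using sweedler_tgt_src[OF \<Psi>, of h a] by (simp add: dact_Cons hact_ract)
  also have "\<dots> = dact h (x # lact C a y # v) \<phi>"
    using multilin_Cons[OF \<phi>] by (simp add: dact_mult_src dact_Cons)
  finally show ?case by simp
next
  case (Cons d u)
  have "multilin C (Suc (Suc (Suc (length u + length v)))) \<phi>" using Cons.prems by simp
  from Cons.IH[OF multilin_Cons[OF this]] show ?case by (simp add: dact_Cons)
qed

lemma multilin_dact: "multilin C n \<phi> \<Longrightarrow> multilin C n (\<lambda>v. dact h v \<phi>)"
  unfolding multilin_def[of C n "\<lambda>v. dact h v \<phi>"]
  by (auto intro!: linC_dact dact_balanced)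

text \<open>The functions on words \<open>[c\<^sub>0, \<dots>, c\<^sub>n]\<close> that factor through \<open>C \<otimes>\<^sub>H C \<otimes>\<^sub>R \<dots> \<otimes>\<^sub>R C\<close>.  In degree
\<open>0\<close> the letter \<open>c\<close> stands for \<open>c \<otimes>\<^sub>H 1\<close>, and the relation is
\<open>T(h)c \<otimes>\<^sub>H 1 = c \<otimes>\<^sub>H \<epsilon>(h) = c\<epsilon>(h) \<otimes>\<^sub>H 1\<close>.\<close>

definition adm :: "nat \<Rightarrow> ('c list \<Rightarrow> ('x \<Rightarrow>\<^sub>0 'k)) \<Rightarrow> bool" where
  "adm n F \<longleftrightarrow> multilin C (Suc n) F \<and>
     (\<forall>h c v. length v = n \<longrightarrow> F (hact C (antipode A h) c # v) =
        (if v = [] then F [ract C c (counit_H A h)] else dact h v (\<lambda>w. F (c # w))))"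

lemma adm_multilin: "adm n F \<Longrightarrow> multilin C (Suc n) F"
  by (simp add: adm_def)

lemma adm_antipode:
  "adm n F \<Longrightarrow> length v = n \<Longrightarrow> v \<noteq> [] \<Longrightarrow>
    F (hact C (antipode A h) c # v) = dact h v (\<lambda>w. F (c # w))"
  by (simp add: adm_def)

lemma adm_hact:
  "adm n F \<Longrightarrow> length v = n \<Longrightarrow> v \<noteq> [] \<Longrightarrow>
    F (hact C h c # v) = dact (antipode A h) v (\<lambda>w. F (c # w))"
  using adm_antipode[of n F v "antipode A h" c] by (simp add: antipode_antipode)

lemma adm_antipode_Nil:
  "adm 0 F \<Longrightarrow> F [hact C (antipode A h) c] = F [ract C c (counit_H A h)]"
  by (simp add: adm_def)

lemma adm_cong:
  assumes "adm n F" "\<And>w. length w = Suc n \<Longrightarrow> F w = G w"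
  shows "adm n G"
proof -
  have "multilin C (Suc n) G"
    using adm_multilin[OF assms(1)] assms(2) unfolding multilin_def by simp
  moreover have "dact h v (\<lambda>w. F (c # w)) = dact h v (\<lambda>w. G (c # w))"
    if "length v = n" "v \<noteq> []" for h c v
    using that assms(2) by (intro dact_cong) auto
  ultimately show ?thesis using assms unfolding adm_def by auto
qed

text \<open>Taking \<open>h = \<beta>(a)\<close>, with \<open>T(\<beta>(a)) = \<alpha>(a)\<close>, makes admissible functions balanced between the
last and the first letter; here these coincide.\<close>

lemma adm_cyclic_single:
  assumes "adm 0 F"
  shows "F [lact C a x] = F [ract C x a]"
  using adm_antipode_Nil[OF assms, of "tgt A a" x] by (simp add: antipode_tgt hact_src counit_tgt)

lemma multilin_ract_last:
  assumes "multilin C n \<phi>" "n > 0"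
  shows "multilin C n (\<lambda>w. \<phi> (butlast w @ [ract C (last w) a]))"
  unfolding multilin_def
proof (intro conjI allI impI)
  fix u v :: "'c list" assume *: "length u + length v + 1 = n"
  show "linC (\<lambda>x. \<phi> (butlast (u @ x # v) @ [ract C (last (u @ x # v)) a]))"
  proof (cases v rule: rev_cases)
    case Nil
    then show ?thesis
      using linC_ract[OF multilin_linear[OF assms(1), of u "[]"]] * by (simp add: butlast_append)
  next
    case (snoc v' d)
    then show ?thesis
      using multilin_linear[OF assms(1), of u "v' @ [ract C d a]"] * by (simp add: butlast_append)
  qed
next
  fix u v :: "'c list" and x b y assume *: "length u + length v + 2 = n"
  show "\<phi> (butlast (u @ ract C x b # y # v) @ [ract C (last (u @ ract C x b # y # v)) a]) =
    \<phi> (butlast (u @ x # lact C b y # v) @ [ract C (last (u @ x # lact C b y # v)) a])"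
  proof (cases v rule: rev_cases)
    case Nil
    then show ?thesis
      using multilin_balanced[OF assms(1), of u "[]" x b "ract C y a"] *
      by (simp add: butlast_append C.lact_ract)
  next
    case (snoc v' d)
    then show ?thesis
      using multilin_balanced[OF assms(1), of u "v' @ [ract C d a]" x b y] *
      by (simp add: butlast_append)
  qed
qed

lemma adm_cyclic:
  assumes "adm n F" "length v + 1 = n"
  shows "F (lact C a x # v @ [y]) = F (x # v @ [ract C y a])"
proof -
  have \<phi>: "multilin C (length (v @ [y])) (\<lambda>w. F (x # w))"
    using multilin_Cons[OF adm_multilin[OF assms(1)]] assms(2) by simp
  have "F (lact C a x # v @ [y]) = dact (tgt A a * 1) (v @ [y]) (\<lambda>w. F (x # w))"
    using adm_antipode[OF assms(1), of "v @ [y]" "tgt A a" x] assms(2)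
    by (simp add: antipode_tgt hact_src)
  also have "\<dots> = F (x # v @ [ract C y a])"
    using dact_tgt_mult[OF \<phi>, of a 1]
        dact_one[of "v @ [y]" "\<lambda>w. F (x # butlast w @ [ract C (last w) a])"]
      multilin_ract_last[OF \<phi>] by simp
  finally show ?thesis .
qed

abbreviation rot :: "('c list \<Rightarrow> ('x \<Rightarrow>\<^sub>0 'k)) \<Rightarrow> 'c list \<Rightarrow> ('x \<Rightarrow>\<^sub>0 'k)" where
  "rot F \<equiv> (\<lambda>w. F (rotate1 w))"

lemma multilin_rot:
  assumes F: "adm n F"
  shows "multilin C (Suc n) (rot F)"
  unfolding multilin_def
proof (intro conjI allI impI)
  fix u v :: "'c list" assume *: "length u + length v + 1 = Suc n"
  show "linC (\<lambda>x. rot F (u @ x # v))"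
    using multilin_linear[OF adm_multilin[OF F], of v "[]"]
      multilin_linear[OF adm_multilin[OF F], of "tl u" "v @ [hd u]"] *
    by (cases u) auto
next
  fix u v :: "'c list" and x a y assume *: "length u + length v + 2 = Suc n"
  show "rot F (u @ ract C x a # y # v) = rot F (u @ x # lact C a y # v)"
    using adm_cyclic[OF F, of v a y x]
      multilin_balanced[OF adm_multilin[OF F], of "tl u" "v @ [hd u]" x a y] *
    by (cases u) auto
qed

text \<open>The relation for \<open>F\<close> is used with \<open>c\<^sub>1\<close> in front: \<open>h\<^sup>1c\<^sub>1 = T(T(h\<^sup>1))c\<^sub>1\<close> is exchanged for the
diagonal action of \<open>T(h\<^sup>1)\<close> on the remaining letters and \<open>c\<^sub>0\<close>.  The part that meets
\<open>c\<^sub>2, \<dots>, c\<^sub>n\<close> multiplies \<open>h\<^sup>2\<close>, so that the antipode axiom applies.\<close>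

lemma adm_rot:
  assumes F: "adm n F"
  shows "adm n (rot F)"
  unfolding adm_def
proof (intro conjI allI impI multilin_rot[OF F])
  fix h c0 and v :: "'c list" assume n: "length v = n"
  show "rot F (hact C (antipode A h) c0 # v) =
    (if v = [] then rot F [ract C c0 (counit_H A h)] else dact h v (\<lambda>w. rot F (c0 # w)))"
  proof (cases v)
    case Nil
    then show ?thesis using adm_antipode_Nil[of F h c0] F n by simp
  next
    case (Cons c1 v')
    show ?thesis
    proof (cases "v' = []")
      case True
      then show ?thesis
        using adm_hact[OF F, of "[c0]" h c1] n Cons by simp
    next
      case False
      have Fc: "multilin C (Suc (length v')) (\<lambda>w. F (c1 # w))"
        using multilin_Cons[OF adm_multilin[OF F]] n Cons by simp
      \<comment> \<open>\<open>T(h\<^sup>1)\<^sup>1h\<^sup>2\<close> will act on \<open>c\<^sub>2, \<dots>, c\<^sub>n\<close> through \<open>p\<close>, and \<open>T(h\<^sup>1)\<^sup>2\<close> on \<open>c\<^sub>0\<close> through \<open>q\<close>.\<close>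
      define \<phi> where "\<phi> = (\<lambda>p q. dact p v' (\<lambda>w. F (c1 # w @ [hact C q c0])))"
      have \<phi>: "balanced2 (H_coring A) \<phi>"
        unfolding \<phi>_def using balanced2_dact_snoc[OF Fc False] by simp
      have Fl: "multilin C (length v') (\<lambda>w. F (c1 # w @ [z]))" for z
        using multilin_snoc[OF Fc] by simp
      have "F (hact C x c1 # w @ [c0]) =
          swH (antipode A x) (\<lambda>p q. dact p w (\<lambda>u. F (c1 # u @ [hact C q c0])))"
        if "length w = length v'" for x w
      proof -
        have "F (hact C x c1 # w @ [c0]) = dact (antipode A x) (w @ [c0]) (\<lambda>w. F (c1 # w))"
          using adm_hact[OF F, of "w @ [c0]" x c1] n Cons that by simp
        also have "\<dots> = swH (antipode A x) (\<lambda>p q. dact p w (\<lambda>u. F (c1 # u @ [hact C q c0])))"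
          using Fc that False by (intro dact_snoc) auto
        finally show ?thesis .
      qed
      then have "dact y v' (\<lambda>w. F (hact C x c1 # w @ [c0])) =
          dact y v' (\<lambda>w. swH (antipode A x) (\<lambda>p q. dact p w (\<lambda>u. F (c1 # u @ [hact C q
              c0]))))" for x y
        by (intro dact_cong[OF False])
      then have "dact y v' (\<lambda>w. F (hact C x c1 # w @ [c0])) =
          swH (antipode A x) (\<lambda>p q. \<phi> (p * y) q)" for x y
        by (simp add: \<phi>_def dact_sweedler_commute dact_mult[OF Fl False])
      then have "dact h v (\<lambda>w. rot F (c0 # w)) =
          swH h (\<lambda>x y. swH (antipode A x) (\<lambda>p q. \<phi> (p * y) q))"
        using Cons False by (simp add: dact_Cons)
      also have "\<dots> = \<phi> 1 (antipode A h)" by (rule sweedler_antipode[OF \<phi>])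
      also have "\<dots> = rot F (hact C (antipode A h) c0 # v)"
        by (simp add: \<phi>_def dact_one[OF Fl False] Cons)
      finally show ?thesis using Cons by simp
    qed
  qed
qed

text \<open>\<open>face i F\<close> and \<open>degen j F\<close> are \<open>F\<close> composed with the \<open>i\<close>-th coface and the \<open>j\<close>-th
codegeneracy on words, just as \<open>rot F\<close> is \<open>F\<close> composed with the cyclic operator.  Hence the
order of composition is reversed in the identities below.\<close>

definition face :: "nat \<Rightarrow> ('c list \<Rightarrow> ('x \<Rightarrow>\<^sub>0 'k)) \<Rightarrow> 'c list \<Rightarrow> ('x \<Rightarrow>\<^sub>0 'k)" where
  "face i F w = swC (w ! i) (\<lambda>x y. F (take i w @ x # y # drop (Suc i) w))"

definition degen :: "nat \<Rightarrow> ('c list \<Rightarrow> ('x \<Rightarrow>\<^sub>0 'k)) \<Rightarrow> 'c list \<Rightarrow> ('x \<Rightarrow>\<^sub>0 'k)" where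
  "degen j F w = F (take j w @ ract C (w ! j) (counit C (w ! Suc j)) # drop (Suc (Suc j)) w)"

lemma face_at: "i = length u \<Longrightarrow> face i F (u @ c # v) = swC c (\<lambda>x y. F (u @ x # y # v))"
  by (simp add: face_def)

lemma degen_at: "j = length u \<Longrightarrow> degen j F (u @ c # d # v) = F (u @ ract C c (counit C d) # v)"
  by (simp add: degen_def nth_append)

lemma face_0_Cons [simp]: "face 0 F (c # v) = swC c (\<lambda>x y. F (x # y # v))"
  by (simp add: face_def)

lemma degen_0_Cons [simp]: "degen 0 F (c # d # v) = F (ract C c (counit C d) # v)"
  by (simp add: degen_def)

lemma balanced2_words:
  assumes F: "multilin C (Suc (Suc (length u + length v))) F"
  shows "balanced2 C (\<lambda>x y. F (u @ x # y # v))"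
  unfolding balanced2_def
  using multilin_linear[OF F, of u "_ # v"] multilin_linear[OF F, of "u @ [_]" v]
    multilin_balanced[OF F, of u v] by simp

lemma balanced3_words:
  assumes F: "multilin C (Suc (Suc (Suc (length u + length v)))) F"
  shows "balanced3 C (\<lambda>x y z. F (u @ x # y # z # v))"
  unfolding balanced3_def
  using balanced2_words[of u "_ # v" F] balanced2_words[of "u @ [_]" v F] F by simp

lemma multilin_face_0:
  assumes F: "multilin C (Suc (Suc n)) F"
  shows "multilin C (Suc n) (face 0 F)"
  unfolding multilin_def
proof (intro conjI allI impI)
  fix u v :: "'c list" assume *: "length u + length v + 1 = Suc n"
  show "linC (\<lambda>x. face 0 F (u @ x # v))"
  proof (cases u)
    case Nil
    then show ?thesis
      using C.linear_sweedler[OF balanced2_words[of "[]" v F]] F * by simp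
  next
    case (Cons d u')
    then show ?thesis
      using multilin_linear[OF F, of "_ # _ # u'" v] *
      by (auto intro!: linear_sweedler_fun C.M.vector_space_axioms)
  qed
next
  fix u v :: "'c list" and x a y assume *: "length u + length v + 2 = Suc n"
  show "face 0 F (u @ ract C x a # y # v) = face 0 F (u @ x # lact C a y # v)"
  proof (cases u)
    case Nil
    have "F (p # ract C q a # y # v) = F (p # q # lact C a y # v)" for p q
      using multilin_balanced[OF F, of "[p]" v] * Nil by simp
    then show ?thesis
      using C.sweedler_ract[OF balanced2_words[of "[]" "y # v" F], of x a] F * Nil by simp
  next
    case (Cons d u')
    have "F (p # q # u' @ ract C x a # y # v) = F (p # q # u' @ x # lact C a y # v)" for p q
      using multilin_balanced[OF F, of "p # q # u'" v] * Cons by simp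
    then show ?thesis using Cons by simp
  qed
qed

text \<open>\<open>T(h)\<^sup>1\<close> acts on the first of the two new letters and is exchanged for \<open>T(T(h)\<^sup>1)\<close> acting on
the others; with \<open>T(h)\<^sup>2\<close> acting on the second letter, this is the left side of the antipode
axiom at \<open>T(h)\<close>.\<close>

lemma adm_face_0:
  assumes F: "adm (Suc n) F"
  shows "adm n (face 0 F)"
  unfolding adm_def
proof (intro conjI allI impI multilin_face_0 adm_multilin[OF F])
  fix h c and v :: "'c list" assume n: "length v = n"
  have b2: "balanced2 C (\<lambda>x y. F (x # y # v))"
    using balanced2_words[of "[]" v F] adm_multilin[OF F] n by simp
  have "face 0 F (hact C (antipode A h) c # v) =
      swC c (\<lambda>x y. swH (antipode A h) (\<lambda>g1 g2. F (hact C g1 x # hact C g2 y # v)))"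
    by (simp add: sweedler_hact[OF b2] sweedler_commute[where B' = C])
  also have "\<dots> = swC c (\<lambda>x y. swH (antipode A h) (\<lambda>g1 g2.
      dact (antipode A g1) (hact C g2 y # v) (\<lambda>w. F (x # w))))"
    using n by (simp add: adm_hact[OF F])
  also have "\<dots> = (if v = [] then face 0 F [ract C c (counit_H A h)]
      else dact h v (\<lambda>w. face 0 F (c # w)))"
  proof (cases "v = []")
    case True
    have l: "linH (\<lambda>g. F [x, hact C g y])" for x y
      using multilin_linear[OF adm_multilin[OF F], of "[x]" "[]"] n True
      by (intro linH_hact[of "\<lambda>y. F [x, y]"]) simp
    have "swH (antipode A h) (\<lambda>g1 g2. F [x, hact C (antipode A g1) (hact C g2 y)]) =
        F [x, ract C y (counit_H A h)]" for x y
      using sweedler_convolution[OF l, of "antipode A h" x y]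
      by (simp add: hact_mult antipode_antipode hact_tgt)
    then show ?thesis
      using True C.sweedler_ract[OF b2, of c "counit_H A h"] by simp
  next
    case False
    have Fx: "multilin C (Suc (length v)) (\<lambda>w. F (x # w))" for x
      using multilin_Cons[OF adm_multilin[OF F]] n by simp
    define \<phi> where "\<phi> = (\<lambda>x y p q. dact q v (\<lambda>w. F (x # hact C p y # w)))"
    have "balanced2 (H_coring A) (\<phi> x y)" for x y
      unfolding \<phi>_def by (rule balanced2_dact[OF Fx False])
    then have "swH (antipode A h) (\<lambda>g1 g2. swH (antipode A g1) (\<lambda>p q. \<phi> x y (p * g2) q)) =
        \<phi> x y 1 h" for x y
      by (simp add: sweedler_antipode antipode_antipode)
    then show ?thesis
      using False by (simp add: dact_Cons dact_sweedler_commute \<phi>_def hact_mult hact_one)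
  qed
  finally show "face 0 F (hact C (antipode A h) c # v) =
      (if v = [] then face 0 F [ract C c (counit_H A h)] else dact h v (\<lambda>w. face 0 F (c # w)))" .
qed

lemma linC_counit:
  assumes "linC (\<lambda>x. G x)"
  shows "linC (\<lambda>d. G (ract C c (counit C d)))"
  using assms
  by (simp add: Vector_Spaces.linear_iff C.counit_add C.ract_add_right C.counit_bscale C.ract_scale)

lemma multilin_degen_0:
  assumes F: "multilin C (Suc n) F"
  shows "multilin C (Suc (Suc n)) (degen 0 F)"
  unfolding multilin_def
proof (intro conjI allI impI)
  fix u v :: "'c list" assume *: "length u + length v + 1 = Suc (Suc n)"
  consider d v' where "u = []" "v = d # v'" | d where "u = [d]" | d e u' where "u = d # e # u'"
    using * by (cases u; cases "tl u"; cases v) auto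
  then show "linC (\<lambda>x. degen 0 F (u @ x # v))"
  proof cases
    case 1
    then show ?thesis using linC_ract[OF multilin_Cons_linear[OF F, of v']] * by simp
  next
    case 2
    then show ?thesis using linC_counit[OF multilin_Cons_linear[OF F, of v]] * by simp
  next
    case 3
    then show ?thesis using multilin_linear[OF F, of "ract C d (counit C e) # u'" v] * by simp
  qed
next
  fix u v :: "'c list" and x a y assume *: "length u + length v + 2 = Suc (Suc n)"
  consider "u = []" | d where "u = [d]" | d e u' where "u = d # e # u'"
    by (cases u; cases "tl u") auto
  then show "degen 0 F (u @ ract C x a # y # v) = degen 0 F (u @ x # lact C a y # v)"
  proof cases
    case 1
    then show ?thesis by (simp add: C.counit_lact C.ract_mult)
  next
    case 2
    then show ?thesis
      using multilin_balanced[OF F, of "[]" v] * by (simp add: C.counit_ract C.ract_mult)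
  next
    case 3
    then show ?thesis
      using multilin_balanced[OF F, of "ract C d (counit C e) # u'" v] * by simp
  qed
qed

text \<open>Write \<open>s = \<epsilon>(c\<^sub>1)\<close>.  Both sides equal \<open>T(h\<alpha>(s))c\<^sub>0 \<otimes> c\<^sub>2 \<otimes> \<dots>\<close>: on the left because
\<open>T(h\<alpha>(s)) = \<beta>(s)T(h)\<close>, and on the right because \<open>\<epsilon>(h\<^sup>1c\<^sub>1) = \<epsilon>(h\<^sup>1\<alpha>(s))\<close> can be moved to
the remaining letters, where the counit law for \<open>h\<alpha>(s)\<close> collects it.\<close>

lemma adm_degen_0:
  assumes F: "adm n F"
  shows "adm (Suc n) (degen 0 F)"
  unfolding adm_def
proof (intro conjI allI impI multilin_degen_0 adm_multilin[OF F])
  fix h c0 and v :: "'c list" assume n: "length v = Suc n"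
  then obtain c1 v' where v: "v = c1 # v'" "length v' = n" by (cases v) auto
  define s where "s = counit C c1"
  have LHS: "degen 0 F (hact C (antipode A h) c0 # v) =
      F (hact C (antipode A (h * src A s)) c0 # v')"
    by (simp add: v ract_hact antipode_mult antipode_src s_def)
  show "degen 0 F (hact C (antipode A h) c0 # v) =
      (if v = [] then degen 0 F [ract C c0 (counit_H A h)] else dact h v (\<lambda>w. degen 0 F (c0 # w)))"
  proof (cases "v' = []")
    case True
    then show ?thesis
      using F v LHS by (simp add: adm_antipode_Nil counit_hact_src s_def)
  next
    case False
    define \<psi> where "\<psi> = (\<lambda>g. dact g v' (\<lambda>w. F (c0 # w)))"
    have Fc: "multilin C (length v') (\<lambda>w. F (c0 # w))"
      using multilin_Cons[OF adm_multilin[OF F]] v by simp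
    have \<psi>: "linH \<psi>" unfolding \<psi>_def by (rule linH_dact[OF Fc False])
    have b2: "balanced2 (H_coring A) (\<lambda>x y. \<psi> (src A (counit_H A x) * y))"
    proof (rule balanced2_HI)
      fix y show "linH (\<lambda>x. \<psi> (src A (counit_H A x) * y))"
        using linH_mult_right[OF \<psi>, of y]
        by (simp add: Vector_Spaces.linear_iff counit_add[simplified] counit_bscale[simplified]
            src_add src_scale distrib_right H.scale_mult_left)
    next
      fix x a y
      show "\<psi> (src A (counit_H A (tgt A a * x)) * y) = \<psi> (src A (counit_H A x) * (src A a * y))"
        by (simp add: counit_tgt_mult src_mult mult.assoc)
    qed (intro linH_mult_left \<psi>)
    have eq: "F (ract C c0 r # w) = dact (src A r) w (\<lambda>w. F (c0 # w))" if "length w =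
        length v'" for r w
    proof -
      have "w \<noteq> []" using that False by auto
      then show ?thesis
        using adm_antipode[OF F, of w "src A r" c0] that v by (simp add: antipode_src hact_tgt)
    qed
    have "dact y v' (\<lambda>w. F (ract C c0 r # w)) = \<psi> (src A r * y)" for y r
      unfolding \<psi>_def dact_mult[OF Fc False] by (rule dact_cong[OF False eq])
    then have "dact h v (\<lambda>w. degen 0 F (c0 # w)) =
        swH h (\<lambda>x y. \<psi> (src A (counit_H A (x * src A s)) * y))"
      using False by (simp add: v dact_Cons counit_hact_src s_def)
    also have "\<dots> = swH (h * src A s) (\<lambda>x y. \<psi> (src A (counit_H A x) * y))"
      by (rule sweedler_mult_src[OF b2, symmetric])
    also have "\<dots> = \<psi> (h * src A s)"
      using sweedler_counit_left[of \<psi> "h * src A s"] \<psi> by simp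
    also have "\<dots> = degen 0 F (hact C (antipode A h) c0 # v)"
      using LHS adm_antipode[OF F, of v'] v False by (simp add: \<psi>_def)
    finally show ?thesis using v by simp
  qed
qed

lemma adm_rotate: "adm n F \<Longrightarrow> adm n (\<lambda>w. F (rotate k w))"
proof (induction k arbitrary: F)
  case (Suc k)
  from Suc.IH[OF adm_rot[OF Suc.prems]] show ?case by (simp add: rotate_def)
qed (simp add: rotate_def)

lemma rotate_rotate1_id: "length w = Suc n \<Longrightarrow> rotate n (rotate1 w) = w"
  using rotate_id[of "Suc n" w] by (simp add: rotate1_rotate_swap)

lemma split_at_index:
  assumes "i < length w"
  obtains u c v where "w = u @ c # v" "length u = i"
  using id_take_nth_drop[OF assms] assms by (metis length_take min.absorb4)

text \<open>Conjugation by the rotation raises the index of a coface or codegeneracy by one, as long as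
the operation stays away from the first letter.  This both gives the identities with \<open>\<tau>\<close>
and transfers admissibility from index \<open>0\<close> to all indices.\<close>

lemma face_rot:
  assumes "Suc i < length w"
  shows "face (Suc i) (rot F) w = rot (face i F) w"
proof -
  obtain c v where w: "w = c # v" using assms by (cases w) auto
  obtain u d z where v: "v = u @ d # z" "length u = i"
    using assms w split_at_index[of i v] by auto
  show ?thesis
    using face_at[of "Suc i" "c # u" "rot F" d z] face_at[of i u F d "z @ [c]"] v w by simp
qed

lemma degen_rot:
  assumes "Suc (Suc j) < length w"
  shows "degen (Suc j) (rot F) w = rot (degen j F) w"
proof -
  obtain c v where w: "w = c # v" using assms by (cases w) auto
  obtain u d z where v: "v = u @ d # z" "length u = j"
    using assms w split_at_index[of j v] by auto
  obtain e z' where z: "z = e # z'" using assms v w by (cases z) auto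
  show ?thesis
    using degen_at[of "Suc j" "c # u" "rot F" d e z'] degen_at[of j u F d e "z' @ [c]"] v w z
    by simp
qed

lemma face_cong:
  "i < length w \<Longrightarrow> (\<And>w'. length w' = Suc (length w) \<Longrightarrow> F w' = G w') \<Longrightarrow> face i F w = face i G w"
  by (simp add: face_def)

lemma degen_cong:
  "Suc j < length w \<Longrightarrow> (\<And>w'. Suc (length w') = length w \<Longrightarrow> F w' = G w') \<Longrightarrow>
    degen j F w = degen j G w"
  by (simp add: degen_def)

lemma adm_face: "adm (Suc n) F \<Longrightarrow> i \<le> n \<Longrightarrow> adm n (face i F)"
proof (induction i arbitrary: F)
  case 0
  then show ?case by (simp add: adm_face_0)
next
  case (Suc i)
  \<comment> \<open>\<open>?F'\<close> is \<open>F\<close> composed with the inverse rotation on words of length \<open>n + 2\<close>.\<close>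
  let ?F' = "\<lambda>w. F (rotate (Suc n) w)"
  have "adm n (rot (face i ?F'))"
    using Suc by (intro adm_rot Suc.IH adm_rotate) simp_all
  then show ?case
  proof (rule adm_cong)
    fix w :: "'c list" assume w: "length w = Suc n"
    then have "rot (face i ?F') w = face (Suc i) (rot ?F') w"
      using Suc.prems by (subst face_rot) simp_all
    also have "\<dots> = face (Suc i) F w"
      using w Suc.prems by (intro face_cong) (simp_all add: rotate_rotate1_id del: rotate_Suc)
    finally show "rot (face i ?F') w = face (Suc i) F w" .
  qed
qed

lemma adm_degen: "adm n F \<Longrightarrow> j \<le> n \<Longrightarrow> adm (Suc n) (degen j F)"
proof (induction j arbitrary: F)
  case 0
  then show ?case by (simp add: adm_degen_0)
next
  case (Suc j)
  \<comment> \<open>\<open>?F'\<close> is \<open>F\<close> composed with the inverse rotation on words of length \<open>n + 1\<close>.\<close>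
  let ?F' = "\<lambda>w. F (rotate n w)"
  have "adm (Suc n) (rot (degen j ?F'))"
    using Suc by (intro adm_rot Suc.IH adm_rotate) simp_all
  then show ?case
  proof (rule adm_cong)
    fix w :: "'c list" assume w: "length w = Suc (Suc n)"
    then have "rot (degen j ?F') w = degen (Suc j) (rot ?F') w"
      using Suc.prems by (subst degen_rot) simp_all
    also have "\<dots> = degen (Suc j) F w"
      using w Suc.prems by (intro degen_cong) (simp_all add: rotate_rotate1_id)
    finally show "rot (degen j ?F') w = degen (Suc j) F w" .
  qed
qed

section \<open>The cosimplicial identities on words\<close>

lemma face_face:
  assumes F: "multilin C (Suc (Suc n)) F" and w: "length w = n" and ij: "i \<le> j" "j < n"
  shows "face i (face (Suc j) F) w = face j (face i F) w"
proof (cases "i = j")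
  case True
  obtain u c v where u: "w = u @ c # v" "length u = i" using split_at_index[of i w] ij w by auto
  have b3: "balanced3 C (\<lambda>x y z. F (u @ x # y # z # v))"
    using F u w by (intro balanced3_words) simp
  have "face i (face (Suc j) F) w = swC c (\<lambda>x y. swC y (\<lambda>y1 y2. F (u @ x # y1 # y2 # v)))"
    using u True face_at[of "Suc j" "u @ [_]" F _ v] by (simp add: face_at)
  also have "\<dots> = swC c (\<lambda>x y. swC x (\<lambda>x1 x2. F (u @ x1 # x2 # y # v)))"
    using C.sweedler_coassoc[OF b3] by simp
  also have "\<dots> = face j (face i F) w" using u True by (simp add: face_at)
  finally show ?thesis .
next
  case False
  then have "i < j" using ij by simp
  obtain u c v' where u: "w = u @ c # v'" "length u = i" using split_at_index[of i w] ij w by auto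
  have "j - Suc i < length v'" using u ij w \<open>i < j\<close> by simp
  then obtain v d z where v: "v' = v @ d # z" "length v = j - Suc i"
    by (rule split_at_index)
  have "face i (face (Suc j) F) w = swC c (\<lambda>x y. swC d (\<lambda>p q. F (u @ x # y # v @ p # q # z)))"
    using u v \<open>i < j\<close> face_at[of "Suc j" "u @ _ # _ # v" F d z] by (simp add: face_at)
  also have "\<dots> = swC d (\<lambda>p q. swC c (\<lambda>x y. F (u @ x # y # v @ p # q # z)))"
    by (rule sweedler_commute)
  also have "\<dots> = face j (face i F) w"
    using u v \<open>i < j\<close> face_at[of j "u @ c # v" "face i F" d z] by (simp add: face_at)
  finally show ?thesis .
qed

lemma degen_degen:
  assumes w: "Suc (Suc j) < length w" and ij: "i \<le> j"
  shows "degen i (degen j F) w = degen (Suc j) (degen i F) w"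
proof -
  obtain u a v where u: "w = u @ a # v" "length u = i" using split_at_index[of i w] ij w by auto
  obtain b z where v: "v = b # z" using u ij w by (cases v) auto
  show ?thesis
  proof (cases "i = j")
    case True
    obtain c z' where "z = c # z'" using u v True w by (cases z) auto
    then show ?thesis
      using u v True degen_at[of "Suc j" "u @ [a]" "degen i F" b c z']
      by (simp add: degen_at C.counit_ract C.ract_mult)
  next
    case False
    then have "i < j" using ij by simp
    have "j - Suc i < length z" using u v \<open>i < j\<close> w by simp
  then obtain y d z' where z: "z = y @ d # z'" "length y = j - Suc i"
    by (rule split_at_index)
    obtain e z'' where z': "z' = e # z''" using u v z w \<open>i < j\<close> by (cases z') auto
    show ?thesis
      using u v z z' \<open>i < j\<close> degen_at[of "Suc j" "u @ a # b # y" "degen i F" d e z'']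
        degen_at[of j "u @ _ # y" F d e z'']
      by (simp add: degen_at)
  qed
qed

lemma face_degen_less:
  assumes F: "multilin C (Suc n) F" and w: "length w = Suc n" and ij: "i \<le> j" "j < n"
  shows "face i (degen (Suc j) F) w = degen j (face i F) w"
proof -
  obtain u c v where u: "w = u @ c # v" "length u = i" using split_at_index[of i w] ij w by auto
  obtain d z where v: "v = d # z" using u ij w by (cases v) auto
  show ?thesis
  proof (cases "i = j")
    case True
    have b2: "balanced2 C (\<lambda>x y. F (u @ x # y # z))"
      using F u v w by (intro balanced2_words) simp
    show ?thesis
      using u v True degen_at[of "Suc j" "u @ [_]" F _ d z] C.sweedler_ract[OF b2, of
          c "counit C d"]
      by (simp add: face_at degen_at)
  next
    case False
    then have "i < j" using ij by simp
    have "j - Suc i < length v" using u v \<open>i < j\<close> ij w by simp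
  then obtain y e z' where z: "v = y @ e # z'" "length y = j - Suc i"
    by (rule split_at_index)
    obtain f z'' where z': "z' = f # z''" using u z w \<open>i < j\<close> ij by (cases z') auto
    show ?thesis
      using u z z' \<open>i < j\<close> degen_at[of "Suc j" "u @ _ # _ # y" F e f z'']
        degen_at[of j "u @ c # y" "face i F" e f z'']
      by (simp add: face_at)
  qed
qed

lemma face_degen_same:
  assumes F: "multilin C n F" and w: "length w = n" "j < n"
  shows "face j (degen j F) w = F w"
proof -
  obtain u c v where u: "w = u @ c # v" "length u = j" using split_at_index[of j w] w by auto
  have "linC (\<lambda>x. F (u @ x # v))" using multilin_linear[OF F] u w by simp
  from C.sweedler_counit_right[OF this, of c] show ?thesis
    using u by (simp add: face_at degen_at)
qed

lemma face_degen_Suc: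
  assumes F: "multilin C n F" and w: "length w = n" "Suc j < n"
  shows "face (Suc j) (degen j F) w = F w"
proof -
  obtain u d v' where u: "w = u @ d # v'" "length u = j" using split_at_index[of j w] w by auto
  obtain c v where v: "v' = c # v" using u w by (cases v') auto
  have "linC (\<lambda>x. F (u @ d # x # v))" using multilin_linear[OF F, of "u @ [d]" v] u v w by simp
  from C.sweedler_counit_left[OF this, of c]
  have "swC c (\<lambda>x y. F (u @ d # lact C (counit C x) y # v)) = F w" using u v by simp
  moreover have "F (u @ d # lact C (counit C x) y # v) =
      F (u @ ract C d (counit C x) # y # v)" for x y
    using multilin_balanced[OF F] u v w by simp
  ultimately show ?thesis
    using u v face_at[of "Suc j" "u @ [d]" "degen j F" c v] by (simp add: degen_at)
qed

lemma face_degen_greater: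
  assumes w: "i < length w" and ij: "Suc j < i"
  shows "face i (degen j F) w = degen j (face (i - 1) F) w"
proof -
  obtain u d v' where u: "w = u @ d # v'" "length u = j" using split_at_index[of j w] ij w by auto
  obtain e v where v: "v' = e # v" using u ij w by (cases v') auto
  have "i - Suc (Suc j) < length v" using u v ij w by simp
  then obtain y c z where z: "v = y @ c # z" "length y = i - Suc (Suc j)"
    by (rule split_at_index)
  have i: "i = Suc (Suc (length u + length y))" using u z ij by simp
  show ?thesis
    using u v z(1) i face_at[of i "u @ d # e # y" "degen j F" c z] face_at[of "i - 1" "u @ _ # y"
        F c z]
    by (simp add: degen_at)
qed

text \<open>The last coface followed by the last codegeneracy: the counit lands at the end of the word
and is carried to its front by cyclic balancing, where the left counit law applies.\<close>

lemma last_face_degen: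
  assumes F: "adm n F" and w: "length w = Suc n"
  shows "face 0 (rot (degen n F)) w = F w"
proof -
  obtain c v where c: "w = c # v" "length v = n" using w by (cases w) auto
  have l: "linC (\<lambda>x. F (x # v))"
    using multilin_Cons_linear[OF adm_multilin[OF F]] c by simp
  have "degen n F (y # v @ [x]) = F (lact C (counit C x) y # v)" for x y
  proof (cases v rule: rev_cases)
    case Nil
    then show ?thesis using F c by (simp add: adm_cyclic_single)
  next
    case (snoc v' d)
    then show ?thesis
      using adm_cyclic[OF F, of v' "counit C x" y d] c degen_at[of n "y # v'" F d x "[]"] by simp
  qed
  then show ?thesis using C.sweedler_counit_left[OF l, of c] c by simp
qed

end

section \<open>The cochain modules as quotients of words\<close>

lemma htens_rel_kernel:
  fixes G :: "'c::ab_group_add \<times> 'm \<Rightarrow> ('x \<Rightarrow>\<^sub>0 'k::field)" and M :: "('k, 'm) module"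
  assumes f: "f \<in> htens_rel sc rho M lam"
    and "\<And>x y m. m \<in> carrier M \<Longrightarrow> G (x + y, m) = G (x, m) + G (y, m)"
    and "\<And>x m m'. m \<in> carrier M \<Longrightarrow> m' \<in> carrier M \<Longrightarrow> G (x, m \<oplus>\<^bsub>M\<^esub> m') = G (x, m) + G (x, m')"
    and "\<And>t x m. m \<in> carrier M \<Longrightarrow> G (sc t x, m) = fscale t (G (x, m))"
    and "\<And>t x m. m \<in> carrier M \<Longrightarrow> G (x, t \<odot>\<^bsub>M\<^esub> m) = fscale t (G (x, m))"
    and "\<And>x h m. m \<in> carrier M \<Longrightarrow> G (rho x h, m) = G (x, lam h m)"
  shows "lin_ext fscale G f = 0"
proof -
  interpret vector_space_pair
    "fscale :: 'k \<Rightarrow> ('c \<times> 'm \<Rightarrow>\<^sub>0 'k) \<Rightarrow> _" "fscale :: 'k \<Rightarrow> ('x \<Rightarrow>\<^sub>0 'k) \<Rightarrow> _" ..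
  have l: "Vector_Spaces.linear fscale fscale (lin_ext fscale G)"
    by (rule free.linear_lin_ext)
  show ?thesis
    by (rule linear_eq_0_on_span[OF l _ f[unfolded htens_rel_def]])
      (auto simp: free.lin_ext_diff free.lin_ext_fscale assms(2-))
qed

context para_module_coring
begin

abbreviation hrel :: "nat \<Rightarrow> ('c \<times> ('r + ('c list \<Rightarrow>\<^sub>0 'k) set) \<Rightarrow>\<^sub>0 'k) set" where
  "hrel n \<equiv> htens_rel (bscale C) (right_act A C) (Cpow A C n) (Cpow_act A C n)"

abbreviation hdom :: "nat \<Rightarrow> ('c \<times> ('r + ('c list \<Rightarrow>\<^sub>0 'k) set) \<Rightarrow>\<^sub>0 'k) set" where
  "hdom n \<equiv> {f. \<forall>p\<in>Poly_Mapping.keys f. snd p \<in> carrier (Cpow A C n)}"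

abbreviation words :: "nat \<Rightarrow> ('c list \<Rightarrow>\<^sub>0 'k) set" where
  "words n \<equiv> {f. \<forall>w\<in>Poly_Mapping.keys f. length w = n}"

text \<open>\<open>pair_cls n x m\<close> represents \<open>x \<otimes>\<^sub>H m\<close> by a vector, and \<open>wcls n [c\<^sub>0, \<dots>, c\<^sub>n]\<close> represents
\<open>c\<^sub>0 \<otimes>\<^sub>H (c\<^sub>1 \<otimes>\<^sub>R \<dots> \<otimes>\<^sub>R c\<^sub>n)\<close>, which for \<open>n = 0\<close> is \<open>c\<^sub>0 \<otimes>\<^sub>H 1\<close>.\<close>

definition pair_cls :: "nat \<Rightarrow> 'c \<Rightarrow> 'r + ('c list \<Rightarrow>\<^sub>0 'k) set \<Rightarrow>
    ('c \<times> ('r + ('c list \<Rightarrow>\<^sub>0 'k) set) \<Rightarrow>\<^sub>0 'k)" where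
  "pair_cls n x m = proj_along (hrel n) (gen (x, m))"

definition word_pair :: "nat \<Rightarrow> 'c list \<Rightarrow> 'c \<times> ('r + ('c list \<Rightarrow>\<^sub>0 'k) set)" where
  "word_pair n w = (hd w, if n = 0 then Inl 1 else Inr (tcls C n (gen (tl w))))"

definition wcls :: "nat \<Rightarrow> 'c list \<Rightarrow> ('c \<times> ('r + ('c list \<Rightarrow>\<^sub>0 'k) set) \<Rightarrow>\<^sub>0 'k)" where
  "wcls n w = proj_along (hrel n) (gen (word_pair n w))"

lemma subspace_hrel: "free.subspace (hrel n)"
  unfolding htens_rel_def by (rule free.subspace_span)

lemma subspace_hdom: "free.subspace (hdom n)"
  by (rule subspace_keys)

lemma subspace_words: "free.subspace (words n)"
  by (rule subspace_keys)

lemmas linear_proj_hrel = linear_proj_along[OF subspace_hrel]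

lemma hrel_generators:
  assumes m: "m \<in> carrier (Cpow A C n)"
  shows "gen (x + y, m) - gen (x, m) - gen (y, m) \<in> hrel n"
    and "m' \<in> carrier (Cpow A C n) \<Longrightarrow>
        gen (x, m \<oplus>\<^bsub>Cpow A C n\<^esub> m') - gen (x, m) - gen (x, m') \<in> hrel n"
    and "gen (bscale C t x, m) - fscale t (gen (x, m)) \<in> hrel n"
    and "gen (x, t \<odot>\<^bsub>Cpow A C n\<^esub> m) - fscale t (gen (x, m)) \<in> hrel n"
    and "gen (right_act A C x h, m) - gen (x, Cpow_act A C n h m) \<in> hrel n"
  unfolding htens_rel_def using m by (blast intro: free.span_base)+

lemma pair_cls_rules:
  assumes m: "m \<in> carrier (Cpow A C n)"
  shows "pair_cls n (x + y) m = pair_cls n x m + pair_cls n y m"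
    and "m' \<in> carrier (Cpow A C n) \<Longrightarrow> pair_cls n x (m \<oplus>\<^bsub>Cpow A C n\<^esub> m') =
        pair_cls n x m + pair_cls n x m'"
    and "pair_cls n (bscale C t x) m = fscale t (pair_cls n x m)"
    and "pair_cls n x (t \<odot>\<^bsub>Cpow A C n\<^esub> m) = fscale t (pair_cls n x m)"
    and "pair_cls n (hact C (antipode A h) x) m = pair_cls n x (Cpow_act A C n h m)"
  using hrel_generators[OF m]
  by (simp_all add: pair_cls_def diff_diff_eq right_act_def
      flip: proj_along_eq_iff[OF subspace_hrel] linear_plus[OF linear_proj_hrel] linear_times[OF
          linear_proj_hrel])

lemma wcls_0: "wcls 0 w = pair_cls 0 (hd w) (Inl 1)"
  and wcls_Suc: "wcls (Suc n) w = pair_cls (Suc n) (hd w) (Inr (tcls C (Suc n) (gen (tl w))))"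
  unfolding wcls_def word_pair_def pair_cls_def by simp_all

text \<open>\<open>c \<otimes>\<^sub>H r = c \<otimes>\<^sub>H \<alpha>(r)\<cdot>1 = T(\<alpha>(r))c \<otimes>\<^sub>H 1\<close>, and \<open>T(\<alpha>(r)) = \<beta>(r)\<close>.\<close>

lemma pair_cls_0_Inl: "pair_cls 0 c (Inl r) = wcls 0 [ract C c r]"
  using pair_cls_rules(5)[of "Inl 1" 0 "src A r" c]
  by (simp add: antipode_src hact_tgt act_R_def src_one counit_src wcls_0)

lemma adm_wcls_0: "adm 0 (wcls 0)"
  unfolding adm_def multilin_def
proof (intro conjI allI impI)
  fix u v :: "'c list" assume "length u + length v + 1 = Suc 0"
  then show "linC (\<lambda>x. wcls 0 (u @ x # v))"
    by (auto intro!: C.linear_bscaleI simp: wcls_0 pair_cls_rules)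
next
  fix h c and v :: "'c list" assume v: "length v = 0"
  have "wcls 0 [hact C (antipode A h) c] = pair_cls 0 c (Inl (counit_H A h))"
    using pair_cls_rules(5)[of "Inl 1" 0 h c]
    by (simp add: wcls_0 act_R_def src_one)
  then show "wcls 0 (hact C (antipode A h) c # v) = (if v = [] then wcls 0 [ract C c (counit_H A h)]
      else dact h v (\<lambda>w. wcls 0 (c # w)))"
    using v by (simp add: pair_cls_0_Inl)
qed simp

lemma carrier_Cpow_Suc: "carrier (Cpow A C (Suc n)) =
    {Inr (tcls C (Suc n) g) |g. g \<in> words (Suc n)}"
  by (auto simp: tens_def tcls_def)

lemma Cpow_Suc_ops:
  "Inr (tcls C (Suc n) f) \<oplus>\<^bsub>Cpow A C (Suc n)\<^esub> Inr (tcls C (Suc n) g) = Inr (tcls C (Suc n) (f + g))"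
  "t \<odot>\<^bsub>Cpow A C (Suc n)\<^esub> Inr (tcls C (Suc n) f) = Inr (tcls C (Suc n) (fscale t f))"
  by (simp_all add: tens_def tcls_def coset_add[OF subspace_tens_rel] coset_scale[OF
      subspace_tens_rel])

text \<open>The relations of \<open>\<otimes>\<^sub>H\<close> state linearity of \<open>x \<otimes>\<^sub>H m\<close> in \<open>m\<close> for two summands and for scalar
multiples, so the expansion of \<open>m\<close> into words is an induction over the words that occur.\<close>

lemma pair_cls_tcls:
  assumes g: "g \<in> words (Suc n)"
  shows "pair_cls (Suc n) x (Inr (tcls C (Suc n) g)) = lin_ext fscale (\<lambda>w. wcls (Suc n) (x # w)) g"
proof -
  let ?t = "\<lambda>g. Inr (tcls C (Suc n) g)"
  let ?g = "\<lambda>S. \<Sum>w\<in>S. fscale (Poly_Mapping.lookup g w) (gen w)"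
  have mem: "?t h \<in> carrier (Cpow A C (Suc n))" if "h \<in> words (Suc n)" for h
    unfolding carrier_Cpow_Suc using that by blast
  have *: "?g S \<in> words (Suc n) \<and> pair_cls (Suc n) x (?t (?g S)) =
    (\<Sum>w\<in>S. fscale (Poly_Mapping.lookup g w) (wcls (Suc n) (x # w)))"
    if "finite S" "S \<subseteq> {w. length w = Suc n}" for S
    using that
  proof (induction S rule: finite_induct)
    case empty
    have "pair_cls (Suc n) x (?t (fscale 0 0)) = fscale 0 (pair_cls (Suc n) x (?t 0))"
      using pair_cls_rules(4)[OF mem[of 0], of x 0] by (simp only: Cpow_Suc_ops) simp
    then show ?case by simp
  next
    case (insert w S)
    have w: "gen w \<in> words (Suc n)" using insert.prems by simp
    have IH: "?g S \<in> words (Suc n)" "pair_cls (Suc n) x (?t (?g S)) =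
      (\<Sum>w\<in>S. fscale (Poly_Mapping.lookup g w) (wcls (Suc n) (x # w)))"
      using insert.IH insert.prems by auto
    have fw: "fscale (Poly_Mapping.lookup g w) (gen w) \<in> words (Suc n)"
      using free.subspace_scale[OF subspace_words w] .
    have "pair_cls (Suc n) x (?t (fscale (Poly_Mapping.lookup g w) (gen w) + ?g S)) =
        fscale (Poly_Mapping.lookup g w) (pair_cls (Suc n) x (?t (gen w))) + pair_cls (Suc n) x
            (?t (?g S))"
      using pair_cls_rules(2)[OF mem[OF fw] mem[OF IH(1)], of x] pair_cls_rules(4)[OF mem[OF w]]
      by (simp only: Cpow_Suc_ops)
    moreover have "pair_cls (Suc n) x (?t (gen w)) = wcls (Suc n) (x # w)"
      by (simp add: wcls_Suc)
    ultimately show ?case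
      using insert.hyps IH free.subspace_add[OF subspace_words fw IH(1)] by simp
  qed
  have "?g (Poly_Mapping.keys g) = g"
    using lin_ext_single[of g] by (simp add: lin_ext_def)
  then show ?thesis
    using *[of "Poly_Mapping.keys g"] g by (auto simp: lin_ext_def)
qed

lemma multilin_wcls_tail: "multilin C (Suc n) (\<lambda>w. wcls (Suc n) (x # w))"
proof -
  let ?p = "proj_along (tens_rel C (Suc n))"
  have eq: "lin_ext fscale (\<lambda>w. wcls (Suc n) (x # w)) f =
      lin_ext fscale (\<lambda>w. wcls (Suc n) (x # w)) g"
    if "f \<in> words (Suc n)" "g \<in> words (Suc n)" "?p f = ?p g" for f g
  proof -
    have "tcls C (Suc n) f = tcls C (Suc n) g"
      using that(3) by (simp add: tcls_def coset_eq_proj_iff[OF subspace_tens_rel])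
    then show ?thesis using pair_cls_tcls[OF that(1), of x] pair_cls_tcls[OF that(2), of x] by simp
  qed
  note lp = linear_proj_along[OF subspace_tens_rel[of C "Suc n"]]
  note mp = C.multilin_proj_gen[of "Suc n"]
  show ?thesis
    unfolding multilin_def
  proof (intro conjI allI impI C.linear_bscaleI)
    fix u v :: "'c list" and y z assume l: "length u + length v + 1 = Suc n"
    have "?p (gen (u @ (y + z) # v)) = ?p (gen (u @ y # v) + gen (u @ z # v))"
      using linear_plus[OF multilin_linear[OF mp l], of y z] by (simp add: linear_plus[OF lp])
    from eq[OF _ _ this] show "wcls (Suc n) (x # u @ (y + z) # v) =
        wcls (Suc n) (x # u @ y # v) + wcls (Suc n) (x # u @ z # v)"
      using l free.subspace_add[OF subspace_words, of "gen (u @ y # v)" "Suc n" "gen (u @ z # v)"]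
      by (simp add: free.lin_ext_add)
  next
    fix u v :: "'c list" and t y assume l: "length u + length v + 1 = Suc n"
    have "?p (gen (u @ bscale C t y # v)) = ?p (fscale t (gen (u @ y # v)))"
      using linear_times[OF multilin_linear[OF mp l], of t y] by (simp add: linear_times[OF lp])
    from eq[OF _ _ this] show "wcls (Suc n) (x # u @ bscale C t y # v) =
        fscale t (wcls (Suc n) (x # u @ y # v))"
      using l free.subspace_scale[OF subspace_words, of "gen (u @ y # v)" "Suc n" t]
      by (simp add: free.lin_ext_fscale)
  next
    fix u v :: "'c list" and y a z assume l: "length u + length v + 2 = Suc n"
    have "?p (gen (u @ ract C y a # z # v)) = ?p (gen (u @ y # lact C a z # v))"
      by (rule multilin_balanced[OF mp l])
    from eq[OF _ _ this] show "wcls (Suc n) (x # u @ ract C y a # z # v) =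
        wcls (Suc n) (x # u @ y # lact C a z # v)"
      using l by simp
  qed
qed

definition diag_rep :: "nat \<Rightarrow> 'h \<Rightarrow> ('c list \<Rightarrow>\<^sub>0 'k) set \<Rightarrow> ('c list \<Rightarrow>\<^sub>0 'k)" where
  "diag_rep n h U = lin_ext fscale
     (\<lambda>u. lin_ext fscale (\<lambda>v. gen (map2 (hact C) u v)) (SOME f. f \<in> U))
     (iter_comult (H_coring A) (n - 1) h)"

lemma diag_act_eq: "diag_act A C n h U = tcls C n (diag_rep n h U)"
  by (simp add: diag_act_def diag_rep_def)

lemma keys_iter_comult: "w \<in> Poly_Mapping.keys (iter_comult B n c) \<Longrightarrow> length w = Suc n"
proof -
  have "iter_comult B n c \<in> {f. \<forall>w\<in>Poly_Mapping.keys f. length w = Suc n}"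
  proof (induction n arbitrary: c)
    case (Suc n)
    show ?case
      unfolding iter_comult.simps sweedler_def swsum_def
    proof (intro free.lin_ext_in_subspace subspace_keys)
      fix x y w assume "w \<in> Poly_Mapping.keys (iter_comult B n y)"
      then show "gen (x # w) \<in> {f. \<forall>w\<in>Poly_Mapping.keys f. length w = Suc (Suc n)}"
        using Suc.IH[of y] by auto
    qed
  qed simp
  then show "w \<in> Poly_Mapping.keys (iter_comult B n c) \<Longrightarrow> length w = Suc n" by blast
qed

lemma some_tcls:
  assumes "f \<in> words n"
  shows "(SOME g. g \<in> tcls C n f) \<in> words n"
    and "tcls C n (SOME g. g \<in> tcls C n f) = tcls C n f"
proof -
  have *: "(SOME g. g \<in> tcls C n f) \<in> tcls C n f"
    using coset_self[OF subspace_tens_rel, of f C n] unfolding tcls_def by (rule someI)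
  then show "tcls C n (SOME g. g \<in> tcls C n f) = tcls C n f"
    by (simp add: tcls_def mem_coset_iff[OF subspace_tens_rel] coset_eq_proj_iff[OF
        subspace_tens_rel])
  from * obtain r where "r \<in> tens_rel C n" "(SOME g. g \<in> tcls C n f) = f + r"
    unfolding tcls_def elt_set_plus_def by blast
  moreover from this(1) have "r \<in> words n" using keys_tens_rel by blast
  ultimately show "(SOME g. g \<in> tcls C n f) \<in> words n"
    using free.subspace_add[OF subspace_words assms] by simp
qed

lemma diag_rep_words:
  assumes "f \<in> words (Suc n)"
  shows "diag_rep (Suc n) h (tcls C (Suc n) f) \<in> words (Suc n)"
  unfolding diag_rep_def using some_tcls(1)[OF assms] keys_iter_comult
  by (intro free.lin_ext_in_subspace subspace_keys) fastforce

text \<open>The diagonal action on cosets is defined through an arbitrary representative.  It agrees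
with \<open>dact\<close> because \<open>dact h v \<phi>\<close> is balanced and multilinear in \<open>v\<close>.\<close>

lemma lin_ext_diag_rep:
  assumes \<phi>: "multilin C (Suc n) \<phi>" and f: "f \<in> words (Suc n)"
  shows "lin_ext fscale \<phi> (diag_rep (Suc n) h (tcls C (Suc n) f)) =
      lin_ext fscale (\<lambda>v. dact h v \<phi>) f"
proof -
  let ?g = "SOME g. g \<in> tcls C (Suc n) f"
  have "lin_ext fscale \<phi> (diag_rep (Suc n) h (tcls C (Suc n) f)) =
      lin_ext fscale (\<lambda>v. lin_ext fscale (\<lambda>u. \<phi> (map2 (hact C) u v)) (iter_comult (H_coring A) n
          h)) ?g"
    unfolding diag_rep_def
    by (simp add: lin_ext_lin_ext[OF free.vector_space_axioms] free.lin_ext_commute[where f = ?g])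
  also have "\<dots> = lin_ext fscale (\<lambda>v. dact h v \<phi>) ?g"
    using some_tcls(1)[OF f] by (intro free.lin_ext_cong) (simp add: dact_def)
  also have "\<dots> = lin_ext fscale (\<lambda>v. dact h v \<phi>) f"
    by (rule lin_ext_multilin_tcls[OF multilin_dact[OF \<phi>] some_tcls(2)[OF f]])
  finally show ?thesis .
qed

lemma wcls_Suc_antipode:
  assumes "length v = Suc n"
  shows "wcls (Suc n) (hact C (antipode A h) x # v) = dact h v (\<lambda>w. wcls (Suc n) (x # w))"
proof -
  have v: "gen v \<in> words (Suc n)" using assms by simp
  have "wcls (Suc n) (hact C (antipode A h) x # v) =
      pair_cls (Suc n) (hact C (antipode A h) x) (Inr (tcls C (Suc n) (gen v)))"
    by (simp add: wcls_Suc)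
  also have "\<dots> =
      pair_cls (Suc n) x (Inr (tcls C (Suc n) (diag_rep (Suc n) h (tcls C (Suc n) (gen v)))))"
    using v by (subst pair_cls_rules(5))
        (auto simp: carrier_Cpow_Suc diag_act_eq simp del: Cpow.simps)
  also have "\<dots> = dact h v (\<lambda>w. wcls (Suc n) (x # w))"
    by (simp add: pair_cls_tcls[OF diag_rep_words[OF v]] lin_ext_diag_rep[OF multilin_wcls_tail v])
  finally show ?thesis .
qed

lemma adm_wcls_Suc: "adm (Suc n) (wcls (Suc n))"
proof -
  have "linC (\<lambda>x. wcls (Suc n) (u @ x # v))" if l: "length u + length v + 1 = Suc (Suc n)" for u v
  proof (cases u)
    case Nil
    have "Inr (tcls C (Suc n) (gen v)) \<in> carrier (Cpow A C (Suc n))"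
      unfolding carrier_Cpow_Suc using l Nil by auto
    from pair_cls_rules[OF this] show ?thesis
      using Nil by (auto intro!: C.linear_bscaleI simp: wcls_Suc simp del: Cpow.simps)
  next
    case (Cons d u')
    then show ?thesis using multilin_linear[OF multilin_wcls_tail, of u' v n d] l by simp
  qed
  moreover have "wcls (Suc n) (u @ ract C x a # y # v) = wcls (Suc n) (u @ x # lact C a y # v)"
    if l: "length u + length v + 2 = Suc (Suc n)" for u v x a y
  proof (cases u)
    case Nil
    then have \<phi>: "multilin C (length (y # v)) (\<lambda>w. wcls (Suc n) (x # w))"
      "multilin C (length (lact C a y # v)) (\<lambda>w. wcls (Suc n) (x # w))"
      using multilin_wcls_tail[of n x] l by simp_all
    have "wcls (Suc n) (ract C x a # y # v) = dact (1 * src A a) (y # v) (\<lambda>w. wcls (Suc n) (x # w))"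
      using wcls_Suc_antipode[of "y # v" n "src A a" x] l Nil by (simp add: antipode_src hact_tgt)
    also have "\<dots> = wcls (Suc n) (x # lact C a y # v)"
      using \<phi> dact_mult_src[of v "\<lambda>w. wcls (Suc n) (x # w)" 1 a y] by (simp add: dact_one)
    finally show ?thesis using Nil by simp
  next
    case (Cons d u')
    then show ?thesis using multilin_balanced[OF multilin_wcls_tail, of u' v n d] l by simp
  qed
  ultimately show ?thesis
    unfolding adm_def multilin_def by (auto simp: wcls_Suc_antipode)
qed

lemma adm_wcls: "adm n (wcls n)"
  by (cases n) (simp_all add: adm_wcls_0 adm_wcls_Suc)

section \<open>The universal property of the cochain modules\<close>

text \<open>For a chosen representative of the second factor, \<open>c \<otimes>\<^sub>H m\<close> is sent to the value of \<open>F\<close> on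
\<open>c\<close> followed by the words of \<open>m\<close>.  The five kinds of relations of \<open>\<otimes>\<^sub>H\<close> are respected since
\<open>F\<close> is admissible.\<close>

lemma word_functional_extends:
  assumes F: "adm n F"
  shows "\<exists>G. (\<forall>w. length w = Suc n \<longrightarrow> G (word_pair n w) = F w) \<and>
    (\<forall>f\<in>hrel n. lin_ext fscale G f = 0)"
proof (cases n)
  case 0
  let ?G = "\<lambda>(c, m :: 'r + ('c list \<Rightarrow>\<^sub>0 'k) set). F [ract C c (projl m)]"
  have l: "linC (\<lambda>x. F [x])" using multilin_Cons_linear[OF adm_multilin[OF F], of "[]"] 0 by simp
  have h: "F [ract C (hact C (antipode A h) x) r] = F [ract C x (act_R A h r)]" for x h r
    using adm_antipode_Nil[of F "h * src A r" x] F 0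
    by (simp add: ract_hact antipode_mult antipode_src act_R_def)
  have "lin_ext fscale ?G f = 0" if "f \<in> hrel n" for f
    by (rule htens_rel_kernel[OF that])
      (use 0 h in \<open>auto simp: C.ract_add_left C.ract_add_right C.ract_bscale C.ract_scale
        linear_plus[OF l] linear_times[OF l] right_act_def\<close>)
  moreover have "?G (word_pair n w) = F w" if "length w = Suc n" for w
    using that 0 by (cases w) (auto simp: word_pair_def C.ract_one)
  ultimately show ?thesis by blast
next
  case (Suc n')
  let
      ?G = "\<lambda>(c, m :: 'r + ('c list \<Rightarrow>\<^sub>0 'k) set). lin_ext fscale (\<lambda>w. F (c # w))
            (SOME f. f \<in> projr m)"
  have Fc: "multilin C (Suc n') (\<lambda>w. F (c # w))" for c
    using multilin_Cons[OF adm_multilin[OF F]] Suc by simp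
  have G: "?G (c, Inr (tcls C n f)) = lin_ext fscale (\<lambda>w. F (c # w)) f" if "f \<in> words n" for c f
    using lin_ext_multilin_tcls[OF Fc some_tcls(2)] that Suc by simp
  have Flin: "linC (\<lambda>x. F (x # w))" if "length w = n" for w
    using multilin_Cons_linear[OF adm_multilin[OF F] that] .
  have "lin_ext fscale ?G f = 0" if "f \<in> hrel n" for f
  proof (rule htens_rel_kernel[OF that])
    fix m assume "m \<in> carrier (Cpow A C n)"
    then obtain g where g: "m = Inr (tcls C n g)" "g \<in> words n"
      unfolding Suc carrier_Cpow_Suc by blast
    show "?G (x + y, m) = ?G (x, m) + ?G (y, m)" for x y
      unfolding g(1) G[OF g(2)] free.lin_ext_fun_add[symmetric]
      using g(2) by (intro free.lin_ext_cong linear_plus[OF Flin]) auto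
    show "?G (bscale C t x, m) = fscale t (?G (x, m))" for t x
      unfolding g(1) G[OF g(2)] free.lin_ext_fun_scale[symmetric]
      using g(2) by (intro free.lin_ext_cong linear_times[OF Flin]) auto
    show "?G (x, t \<odot>\<^bsub>Cpow A C n\<^esub> m) = fscale t (?G (x, m))" for t x
      unfolding g(1) Suc Cpow_Suc_ops
      using G[OF g(2)] G[OF free.subspace_scale[OF subspace_words g(2)]]
      by (simp only: Suc free.lin_ext_fscale)
    show "?G (right_act A C x h, m) = ?G (x, Cpow_act A C n h m)" for x h
    proof -
      have "?G (right_act A C x h, m) = lin_ext fscale (\<lambda>w. dact h w (\<lambda>w. F (x # w))) g"
        unfolding g(1) G[OF g(2)] right_act_def
        using g(2) Suc by (intro free.lin_ext_cong adm_antipode[OF F]) auto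
      also have "\<dots> = ?G (x, Inr (tcls C n (diag_rep n h (tcls C n g))))"
        using lin_ext_diag_rep[OF Fc, of g x h] g(2) G[OF diag_rep_words[of g n' h, folded Suc]] Suc
        by simp
      finally show ?thesis by (simp add: g Suc diag_act_eq)
    qed
    fix m' assume "m' \<in> carrier (Cpow A C n)"
    then obtain g' where g': "m' = Inr (tcls C n g')" "g' \<in> words n"
      unfolding Suc carrier_Cpow_Suc by blast
    show "?G (x, m \<oplus>\<^bsub>Cpow A C n\<^esub> m') = ?G (x, m) + ?G (x, m')" for x
      unfolding g(1) g'(1) Suc Cpow_Suc_ops
      using G[OF g(2)] G[OF g'(2)] G[OF free.subspace_add[OF subspace_words g(2) g'(2)]]
      by (simp only: Suc free.lin_ext_add)
  qed
  moreover have "?G (word_pair n w) = F w" if "length w = Suc n" for w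
    using G[of "gen (tl w)" "hd w"] that Suc by (cases w) (simp_all add: word_pair_def)
  ultimately show ?thesis by blast
qed

lemma proj_along_diff: "f - proj_along (hrel n) f \<in> hrel n"
  by (simp add: proj_along_eq_iff[OF subspace_hrel, symmetric] proj_along_idem[OF subspace_hrel])

lemma ex_induced:
  assumes "adm n F"
  shows "\<exists>L. Vector_Spaces.linear fscale fscale L \<and> (\<forall>w. length w = Suc n \<longrightarrow> L (wcls n w) = F w)"
proof -
  obtain G where G: "\<And>w. length w = Suc n \<Longrightarrow> G (word_pair n w) = F w"
    "\<And>f. f \<in> hrel n \<Longrightarrow> lin_ext fscale G f = 0"
    using word_functional_extends[OF assms] by blast
  have "lin_ext fscale G (wcls n w) = F w" if "length w = Suc n" for w
    using G(2)[OF proj_along_diff[of "gen (word_pair n w)"]] G(1)[OF that]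
    by (simp add: free.lin_ext_diff wcls_def)
  then show ?thesis using free.linear_lin_ext by blast
qed

definition induced where
  "induced n F =
      (SOME L. Vector_Spaces.linear fscale fscale L \<and> (\<forall>w. length w = Suc n \<longrightarrow> L (wcls n w) = F w))"

lemma linear_induced: "adm n F \<Longrightarrow> Vector_Spaces.linear fscale fscale (induced n F)"
  and induced_wcls: "adm n F \<Longrightarrow> length w = Suc n \<Longrightarrow> induced n F (wcls n w) = F w"
  using someI_ex[OF ex_induced[of n F]] unfolding induced_def by blast+

text \<open>The image of the cochain module under the projection along its relations; the words
span it because they generate the tensor product.\<close>

definition word_space :: "nat \<Rightarrow> ('c \<times> ('r + ('c list \<Rightarrow>\<^sub>0 'k) set) \<Rightarrow>\<^sub>0 'k) set" where
  "word_space n = free.span (wcls n ` {w. length w = Suc n})"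

lemma subspace_word_space: "free.subspace (word_space n)"
  by (simp add: word_space_def free.subspace_span)

lemma wcls_in_space: "length w = Suc n \<Longrightarrow> wcls n w \<in> word_space n"
  by (auto simp: word_space_def intro!: free.span_base)

lemma word_space_eqI:
  assumes "Vector_Spaces.linear fscale fscale L" "Vector_Spaces.linear fscale fscale L'"
    and "\<And>w. length w = Suc n \<Longrightarrow> L (wcls n w) = L' (wcls n w)" and "y \<in> word_space n"
  shows "L y = (L' y :: 'x \<Rightarrow>\<^sub>0 'k)"
proof -
  interpret vector_space_pair
    "fscale :: 'k \<Rightarrow> ('c \<times> ('r + ('c list \<Rightarrow>\<^sub>0 'k) set) \<Rightarrow>\<^sub>0 'k) \<Rightarrow> _" "fscale :: 'k \<Rightarrow> ('x \<Rightarrow>\<^sub>0 'k) \<Rightarrow> _" ..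
  show ?thesis
    by (rule linear_eq_on[OF assms(1,2) assms(4)[unfolded word_space_def]]) (use assms(3) in auto)
qed

lemma word_space_mapI:
  assumes "Vector_Spaces.linear fscale fscale L" "free.subspace S"
    and "\<And>w. length w = Suc n \<Longrightarrow> L (wcls n w) \<in> S" and "y \<in> word_space n"
  shows "L y \<in> (S :: ('x \<Rightarrow>\<^sub>0 'k) set)"
  using assms(4)[unfolded word_space_def]
proof (induction rule: free.span_induct_alt)
  case base
  then show ?case
    using linear_times[OF assms(1), of 0 0] free.subspace_0[OF assms(2)] by simp
next
  case (step c x y)
  then show ?case
    using assms(3) free.subspace_add[OF assms(2)] free.subspace_scale[OF assms(2)]
    by (auto simp: linear_plus[OF assms(1)] linear_times[OF assms(1)])
qed

lemma proj_in_word_space: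
  assumes "f \<in> hdom n"
  shows "proj_along (hrel n) f \<in> word_space n"
proof -
  have "proj_along (hrel n) f = proj_along (hrel n) (lin_ext fscale gen f)" by simp
  also have "\<dots> = lin_ext fscale (\<lambda>p. proj_along (hrel n) (gen p)) f"
    by (rule linear_lin_ext_commute[OF linear_proj_hrel])
  also have "\<dots> \<in> word_space n"
  proof (rule free.lin_ext_in_subspace[OF subspace_word_space])
    fix p assume p: "p \<in> Poly_Mapping.keys f"
    obtain x m where xm: "p = (x, m)" by (cases p)
    have "pair_cls n x m \<in> word_space n"
    proof (cases n)
      case 0
      then obtain r where "m = Inl r" using assms p xm by auto
      then show ?thesis using 0 wcls_in_space[of "[ract C x r]" 0] by (simp add: pair_cls_0_Inl)
    next
      case (Suc n')
      then obtain g where "m = Inr (tcls C n g)" "g \<in> words n"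
        using assms p xm carrier_Cpow_Suc[of n'] by (auto simp del: Cpow.simps)
      then show ?thesis
        using Suc pair_cls_tcls[of g n' x]
        by (auto intro!: free.lin_ext_in_subspace[OF subspace_word_space] wcls_in_space)
    qed
    then show "proj_along (hrel n) (gen p) \<in> word_space n" by (simp add: pair_cls_def xm)
  qed
  finally show ?thesis .
qed

lemma word_space_proj: "y \<in> word_space n \<Longrightarrow> proj_along (hrel n) y = y"
  using word_space_eqI[OF linear_proj_hrel free.linear_id[unfolded id_def], of n n y]
  by (simp add: wcls_def proj_along_idem[OF subspace_hrel])

lemma word_space_hdom:
  assumes "y \<in> word_space n"
  obtains f where "f \<in> hdom n" "proj_along (hrel n) f = y"
proof -
  interpret q: Vector_Spaces.linear fscale fscale "proj_along (hrel n)" by (rule linear_proj_hrel)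
  have "gen (word_pair n w) \<in> hdom n" if "length w = Suc n" for w
    using that by (cases n) (auto simp: word_pair_def carrier_Cpow_Suc simp del: Cpow.simps(2))
  then have "wcls n w \<in> proj_along (hrel n) ` hdom n" if "length w = Suc n" for w
    using that unfolding wcls_def by blast
  then have "word_space n \<subseteq> proj_along (hrel n) ` hdom n"
    unfolding word_space_def by (intro free.span_minimal q.subspace_image subspace_hdom) auto
  then show thesis using assms that by blast
qed

section \<open>The cocyclic operators\<close>

text \<open>The operators are first defined on the vectors that represent cochains, by the universal
property.\<close>

definition \<tau>\<^sub>L where "\<tau>\<^sub>L n = induced n (rot (wcls n))"

definition \<delta>\<^sub>L where
  "\<delta>\<^sub>L n i = (if i \<le> n then induced n (face i (wcls (Suc n)))
     else (\<lambda>y. \<tau>\<^sub>L (Suc n) (induced n (face 0 (wcls (Suc n))) y)))"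

definition \<sigma>\<^sub>L where "\<sigma>\<^sub>L n j = induced n (degen j (wcls (n - 1)))"

lemma linear_\<tau>\<^sub>L: "Vector_Spaces.linear fscale fscale (\<tau>\<^sub>L n)"
  unfolding \<tau>\<^sub>L_def by (intro linear_induced adm_rot adm_wcls)

lemma linear_\<delta>\<^sub>L: "Vector_Spaces.linear fscale fscale (\<delta>\<^sub>L n i)"
  unfolding \<delta>\<^sub>L_def by (auto intro!: linear_comp[OF linear_\<tau>\<^sub>L] linear_induced adm_face adm_wcls)

lemma linear_\<sigma>\<^sub>L: "j \<le> n \<Longrightarrow> Vector_Spaces.linear fscale fscale (\<sigma>\<^sub>L (Suc n) j)"
  unfolding \<sigma>\<^sub>L_def by (intro linear_induced adm_degen) (simp_all add: adm_wcls)

lemma \<tau>\<^sub>L_wcls: "length w = Suc n \<Longrightarrow> \<tau>\<^sub>L n (wcls n w) = wcls n (rotate1 w)"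
  unfolding \<tau>\<^sub>L_def using induced_wcls[OF adm_rot[OF adm_wcls]] by simp

lemma \<delta>\<^sub>L_wcls: "length w = Suc n \<Longrightarrow> i \<le> n \<Longrightarrow> \<delta>\<^sub>L n i (wcls n w) = face i (wcls (Suc n)) w"
  unfolding \<delta>\<^sub>L_def using induced_wcls[OF adm_face[OF adm_wcls]] by simp

lemma \<sigma>\<^sub>L_wcls: "length w = Suc (Suc n) \<Longrightarrow> j \<le> n \<Longrightarrow> \<sigma>\<^sub>L (Suc n) j (wcls (Suc n) w) = degen j (wcls n) w"
  unfolding \<sigma>\<^sub>L_def using induced_wcls[OF adm_degen[OF adm_wcls]] by simp

lemma \<delta>\<^sub>L_last: "\<delta>\<^sub>L n (Suc n) y = \<tau>\<^sub>L (Suc n) (\<delta>\<^sub>L n 0 y)"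
  by (simp add: \<delta>\<^sub>L_def)

lemma linear_face:
  "Vector_Spaces.linear fscale fscale L \<Longrightarrow> L (face i F w) = face i (\<lambda>w. L (F w)) w"
  unfolding face_def by (rule sweedler_linear)

text \<open>A linear map passes through the Sweedler sum of a coface, so that composites of operators can
be evaluated on words from the inside out.\<close>

lemma map_\<delta>\<^sub>L_wcls:
  assumes "Vector_Spaces.linear fscale fscale L" "length w = Suc n" "i \<le> n"
    and "\<And>w. length w = Suc (Suc n) \<Longrightarrow> L (wcls (Suc n) w) = G w"
  shows "L (\<delta>\<^sub>L n i (wcls n w)) = face i G w"
  unfolding \<delta>\<^sub>L_wcls[OF assms(2,3)] linear_face[OF assms(1)]
  using assms by (intro face_cong) auto

lemma map_\<sigma>\<^sub>L_wcls:
  assumes "length w = Suc (Suc n)" "j \<le> n"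
    and "\<And>w. length w = Suc n \<Longrightarrow> L (wcls n w) = G w"
  shows "L (\<sigma>\<^sub>L (Suc n) j (wcls (Suc n) w)) = degen j G w"
  unfolding \<sigma>\<^sub>L_wcls[OF assms(1,2)] using assms by (simp add: degen_def)

lemma face_in_subspace:
  assumes "free.subspace S" "i < length w" "\<And>w'. length w' = Suc (length w) \<Longrightarrow> F w' \<in> S"
  shows "face i F w \<in> S"
  unfolding face_def sweedler_def swsum_def
  using assms by (intro free.lin_ext_in_subspace) auto

lemma \<tau>\<^sub>L_word_space: "y \<in> word_space n \<Longrightarrow> \<tau>\<^sub>L n y \<in> word_space n"
  by (rule word_space_mapI[OF linear_\<tau>\<^sub>L subspace_word_space, of n n n])
      (simp_all add: \<tau>\<^sub>L_wcls wcls_in_space)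

lemma \<delta>\<^sub>L_word_space: "i \<le> Suc n \<Longrightarrow> y \<in> word_space n \<Longrightarrow> \<delta>\<^sub>L n i y \<in> word_space (Suc n)"
proof -
  have *: "\<delta>\<^sub>L n i y \<in> word_space (Suc n)" if "i \<le> n" "y \<in> word_space n" for i
    using that by (intro word_space_mapI[OF linear_\<delta>\<^sub>L subspace_word_space _ that(2)])
      (auto simp: \<delta>\<^sub>L_wcls intro!: face_in_subspace[OF subspace_word_space] wcls_in_space)
  show "\<delta>\<^sub>L n i y \<in> word_space (Suc n)" if "i \<le> Suc n" "y \<in> word_space n"
    using that *[of i] *[of 0] by (cases "i \<le> n") (auto simp: le_Suc_eq \<delta>\<^sub>L_last \<tau>\<^sub>L_word_space)
qed

lemma \<sigma>\<^sub>L_word_space: "j \<le> n \<Longrightarrow> y \<in> word_space (Suc n) \<Longrightarrow> \<sigma>\<^sub>L (Suc n) j y \<in> word_space n"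
  by (rule word_space_mapI[OF linear_\<sigma>\<^sub>L subspace_word_space, of j n "Suc n" n])
      (simp_all add: \<sigma>\<^sub>L_wcls degen_def wcls_in_space)

lemma \<tau>\<^sub>L_\<delta>\<^sub>L:
  assumes "y \<in> word_space n" "i < n"
  shows "\<tau>\<^sub>L (Suc n) (\<delta>\<^sub>L n (Suc i) y) = \<delta>\<^sub>L n i (\<tau>\<^sub>L n y)"
proof (rule word_space_eqI[OF linear_comp[OF linear_\<tau>\<^sub>L linear_\<delta>\<^sub>L]
      linear_comp[OF linear_\<delta>\<^sub>L linear_\<tau>\<^sub>L] _ assms(1)])
  fix w :: "'c list" assume w: "length w = Suc n"
  have "\<tau>\<^sub>L (Suc n) (\<delta>\<^sub>L n (Suc i) (wcls n w)) = face (Suc i) (rot (wcls (Suc n))) w"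
    using w assms by (intro map_\<delta>\<^sub>L_wcls[OF linear_\<tau>\<^sub>L]) (simp_all add: \<tau>\<^sub>L_wcls)
  also have "\<dots> = \<delta>\<^sub>L n i (\<tau>\<^sub>L n (wcls n w))"
    using w assms by (subst face_rot) (simp_all add: \<tau>\<^sub>L_wcls \<delta>\<^sub>L_wcls)
  finally show "\<tau>\<^sub>L (Suc n) (\<delta>\<^sub>L n (Suc i) (wcls n w)) = \<delta>\<^sub>L n i (\<tau>\<^sub>L n (wcls n w))" .
qed

lemma \<tau>\<^sub>L_\<delta>\<^sub>L_last:
  assumes "y \<in> word_space n"
  shows "\<tau>\<^sub>L (Suc n) (\<delta>\<^sub>L n (Suc n) y) = \<delta>\<^sub>L n n (\<tau>\<^sub>L n y)"
  unfolding \<delta>\<^sub>L_last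
proof (rule word_space_eqI[OF linear_comp[OF linear_\<tau>\<^sub>L linear_comp[OF linear_\<tau>\<^sub>L linear_\<delta>\<^sub>L]]
      linear_comp[OF linear_\<delta>\<^sub>L linear_\<tau>\<^sub>L] _ assms(1)])
  fix w :: "'c list" assume w: "length w = Suc n"
  then obtain c v where c: "w = c # v" "length v = n" by (cases w) auto
  have "\<tau>\<^sub>L (Suc n) (\<tau>\<^sub>L (Suc n) (\<delta>\<^sub>L n 0 (wcls n w))) = face 0 (rot (rot (wcls (Suc n)))) w"
    using w by (intro map_\<delta>\<^sub>L_wcls[where L = "\<lambda>y. \<tau>\<^sub>L (Suc n) (\<tau>\<^sub>L (Suc n) y)"] linear_comp[OF
        linear_\<tau>\<^sub>L linear_\<tau>\<^sub>L])
      (simp_all add: \<tau>\<^sub>L_wcls)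
  also have "\<dots> = face n (wcls (Suc n)) (v @ [c])"
    using c by (simp add: face_at)
  also have "\<dots> = \<delta>\<^sub>L n n (\<tau>\<^sub>L n (wcls n w))"
    using c by (simp add: \<tau>\<^sub>L_wcls \<delta>\<^sub>L_wcls)
  finally show "\<tau>\<^sub>L (Suc n) (\<tau>\<^sub>L (Suc n) (\<delta>\<^sub>L n 0 (wcls n w))) = \<delta>\<^sub>L n n (\<tau>\<^sub>L n (wcls n w))" .
qed

lemma \<delta>\<^sub>L_\<delta>\<^sub>L_inner:
  assumes "y \<in> word_space n" "i \<le> j" "j \<le> n"
  shows "\<delta>\<^sub>L (Suc n) (Suc j) (\<delta>\<^sub>L n i y) = \<delta>\<^sub>L (Suc n) i (\<delta>\<^sub>L n j y)"
proof (rule word_space_eqI[OF linear_comp[OF linear_\<delta>\<^sub>L linear_\<delta>\<^sub>L]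
      linear_comp[OF linear_\<delta>\<^sub>L linear_\<delta>\<^sub>L] _ assms(1)])
  fix w :: "'c list" assume w: "length w = Suc n"
  have "\<delta>\<^sub>L (Suc n) (Suc j) (\<delta>\<^sub>L n i (wcls n w)) = face i (face (Suc j) (wcls (Suc (Suc n)))) w"
    using w assms by (intro map_\<delta>\<^sub>L_wcls[OF linear_\<delta>\<^sub>L]) (simp_all add: \<delta>\<^sub>L_wcls)
  also have "\<dots> = face j (face i (wcls (Suc (Suc n)))) w"
    using w assms adm_multilin[OF adm_wcls, of "Suc (Suc n)"]
      by (intro face_face[of "Suc n"]) simp_all
  also have "\<dots> = \<delta>\<^sub>L (Suc n) i (\<delta>\<^sub>L n j (wcls n w))"
    using w assms by (intro map_\<delta>\<^sub>L_wcls[OF linear_\<delta>\<^sub>L, symmetric]) (simp_all add: \<delta>\<^sub>L_wcls)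
  finally show "\<delta>\<^sub>L (Suc n) (Suc j) (\<delta>\<^sub>L n i (wcls n w)) = \<delta>\<^sub>L (Suc n) i (\<delta>\<^sub>L n j (wcls n w))" .
qed

text \<open>The identities that involve the last coface \<open>\<tau> \<delta>\<^sub>0\<close> follow formally from the inner ones:
\<open>\<tau>\<delta>\<^sub>0\<delta>\<^sub>i = \<tau>\<delta>\<^sub>i\<^sub>+\<^sub>1\<delta>\<^sub>0 = \<delta>\<^sub>i\<tau>\<delta>\<^sub>0\<close>, and if both cofaces are last, both sides are
\<open>\<tau>\<tau>\<delta>\<^sub>0\<delta>\<^sub>0\<close>.\<close>

lemma \<delta>\<^sub>L_\<delta>\<^sub>L:
  assumes y: "y \<in> word_space n" and "i \<le> j" "j \<le> Suc n"
  shows "\<delta>\<^sub>L (Suc n) (Suc j) (\<delta>\<^sub>L n i y) = \<delta>\<^sub>L (Suc n) i (\<delta>\<^sub>L n j y)"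
proof -
  consider "j \<le> n" | "j = Suc n" "i \<le> n" | "j = Suc n" "i = Suc n" using assms by linarith
  then show ?thesis
  proof cases
    case 1
    then show ?thesis using assms by (intro \<delta>\<^sub>L_\<delta>\<^sub>L_inner)
  next
    case 2
    have "\<delta>\<^sub>L (Suc n) (Suc j) (\<delta>\<^sub>L n i y) = \<tau>\<^sub>L (Suc (Suc n)) (\<delta>\<^sub>L (Suc n) (Suc i) (\<delta>\<^sub>L n 0 y))"
      using 2 y by (simp add: \<delta>\<^sub>L_last \<delta>\<^sub>L_\<delta>\<^sub>L_inner)
    also have "\<dots> = \<delta>\<^sub>L (Suc n) i (\<delta>\<^sub>L n j y)"
      using 2 y by (simp add: \<delta>\<^sub>L_last \<tau>\<^sub>L_\<delta>\<^sub>L \<delta>\<^sub>L_word_space)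
    finally show ?thesis .
  next
    case 3
    have d: "\<delta>\<^sub>L n 0 y \<in> word_space (Suc n)" using y by (simp add: \<delta>\<^sub>L_word_space)
    have "\<delta>\<^sub>L (Suc n) (Suc j) (\<delta>\<^sub>L n i y) =
        \<tau>\<^sub>L (Suc (Suc n)) (\<tau>\<^sub>L (Suc (Suc n)) (\<delta>\<^sub>L (Suc n) 1 (\<delta>\<^sub>L n 0 y)))"
      using 3 \<tau>\<^sub>L_\<delta>\<^sub>L[OF d, of 0] by (simp add: \<delta>\<^sub>L_last)
    also have "\<delta>\<^sub>L (Suc n) 1 (\<delta>\<^sub>L n 0 y) = \<delta>\<^sub>L (Suc n) 0 (\<delta>\<^sub>L n 0 y)"
      using \<delta>\<^sub>L_\<delta>\<^sub>L_inner[OF y, of 0 0] by simp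
    also have "\<tau>\<^sub>L (Suc (Suc n)) (\<tau>\<^sub>L (Suc (Suc n)) (\<delta>\<^sub>L (Suc n) 0 (\<delta>\<^sub>L n 0 y))) =
        \<delta>\<^sub>L (Suc n) i (\<delta>\<^sub>L n j y)"
      using 3 \<tau>\<^sub>L_\<delta>\<^sub>L_last[OF d] by (simp add: \<delta>\<^sub>L_last)
    finally show ?thesis .
  qed
qed

lemma \<sigma>\<^sub>L_\<sigma>\<^sub>L:
  assumes "y \<in> word_space (Suc (Suc n))" "i \<le> j" "j \<le> n"
  shows "\<sigma>\<^sub>L (Suc n) j (\<sigma>\<^sub>L (Suc (Suc n)) i y) = \<sigma>\<^sub>L (Suc n) i (\<sigma>\<^sub>L (Suc (Suc n)) (Suc j) y)"
proof (rule word_space_eqI[OF linear_comp[OF linear_\<sigma>\<^sub>L linear_\<sigma>\<^sub>L]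
      linear_comp[OF linear_\<sigma>\<^sub>L linear_\<sigma>\<^sub>L] _ assms(1)])
  fix w :: "'c list" assume w: "length w = Suc (Suc (Suc n))"
  have "\<sigma>\<^sub>L (Suc n) j (\<sigma>\<^sub>L (Suc (Suc n)) i (wcls (Suc (Suc n)) w)) = degen i (degen j (wcls n)) w"
    using w assms by (intro map_\<sigma>\<^sub>L_wcls[where L = "\<sigma>\<^sub>L (Suc n) j"]) (simp_all add: \<sigma>\<^sub>L_wcls)
  also have "\<dots> = degen (Suc j) (degen i (wcls n)) w"
    using w assms by (intro degen_degen) simp_all
  also have "\<dots> = \<sigma>\<^sub>L (Suc n) i (\<sigma>\<^sub>L (Suc (Suc n)) (Suc j) (wcls (Suc (Suc n)) w))"
    using w assms
      by (intro map_\<sigma>\<^sub>L_wcls[symmetric, where L = "\<sigma>\<^sub>L (Suc n) i"]) (simp_all add: \<sigma>\<^sub>L_wcls)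
  finally show "\<sigma>\<^sub>L (Suc n) j (\<sigma>\<^sub>L (Suc (Suc n)) i (wcls (Suc (Suc n)) w)) =
    \<sigma>\<^sub>L (Suc n) i (\<sigma>\<^sub>L (Suc (Suc n)) (Suc j) (wcls (Suc (Suc n)) w))" .
qed (use assms in auto)

lemma \<sigma>\<^sub>L_\<delta>\<^sub>L_less:
  assumes "y \<in> word_space (Suc n)" "i \<le> j" "j \<le> n"
  shows "\<sigma>\<^sub>L (Suc (Suc n)) (Suc j) (\<delta>\<^sub>L (Suc n) i y) = \<delta>\<^sub>L n i (\<sigma>\<^sub>L (Suc n) j y)"
proof (rule word_space_eqI[OF linear_comp[OF linear_\<sigma>\<^sub>L linear_\<delta>\<^sub>L]
      linear_comp[OF linear_\<delta>\<^sub>L linear_\<sigma>\<^sub>L] _ assms(1)])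
  fix w :: "'c list" assume w: "length w = Suc (Suc n)"
  have "\<sigma>\<^sub>L (Suc (Suc n)) (Suc j) (\<delta>\<^sub>L (Suc n) i (wcls (Suc n) w)) =
      face i (degen (Suc j) (wcls (Suc n))) w"
    using w assms by (intro map_\<delta>\<^sub>L_wcls[OF linear_\<sigma>\<^sub>L]) (simp_all add: \<sigma>\<^sub>L_wcls)
  also have "\<dots> = degen j (face i (wcls (Suc n))) w"
    using w assms adm_multilin[OF adm_wcls, of "Suc n"]
      by (intro face_degen_less[of "Suc n"]) simp_all
  also have "\<dots> = \<delta>\<^sub>L n i (\<sigma>\<^sub>L (Suc n) j (wcls (Suc n) w))"
    using w assms by (intro map_\<sigma>\<^sub>L_wcls[symmetric, where L = "\<delta>\<^sub>L n i"]) (simp_all add: \<delta>\<^sub>L_wcls)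
  finally show "\<sigma>\<^sub>L (Suc (Suc n)) (Suc j) (\<delta>\<^sub>L (Suc n) i (wcls (Suc n) w)) =
    \<delta>\<^sub>L n i (\<sigma>\<^sub>L (Suc n) j (wcls (Suc n) w))" .
qed (use assms in auto)

lemma \<sigma>\<^sub>L_\<delta>\<^sub>L_id:
  assumes "y \<in> word_space n" "j \<le> n" "i = j \<or> i = Suc j"
  shows "\<sigma>\<^sub>L (Suc n) j (\<delta>\<^sub>L n i y) = y"
proof (rule word_space_eqI[OF linear_comp[OF linear_\<sigma>\<^sub>L linear_\<delta>\<^sub>L]
      free.linear_id[unfolded id_def] _ assms(1)])
  fix w :: "'c list" assume w: "length w = Suc n"
  note m = adm_multilin[OF adm_wcls, of n]
  show "\<sigma>\<^sub>L (Suc n) j (\<delta>\<^sub>L n i (wcls n w)) = wcls n w"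
  proof (cases "i \<le> n")
    case True
    have "\<sigma>\<^sub>L (Suc n) j (\<delta>\<^sub>L n i (wcls n w)) = face i (degen j (wcls n)) w"
      using w True assms by (intro map_\<delta>\<^sub>L_wcls[OF linear_\<sigma>\<^sub>L]) (simp_all add: \<sigma>\<^sub>L_wcls)
    also have "\<dots> = wcls n w"
      using assms(3) face_degen_same[OF m w] face_degen_Suc[OF m w] True assms(2) by auto
    finally show ?thesis .
  next
    case False
    then have ij: "j = n" "i = Suc n" using assms by auto
    have "\<sigma>\<^sub>L (Suc n) n (\<tau>\<^sub>L (Suc n) (\<delta>\<^sub>L n 0 (wcls n w))) = face 0 (rot (degen n (wcls n))) w"
      using w by (intro map_\<delta>\<^sub>L_wcls[where L = "\<lambda>y. \<sigma>\<^sub>L (Suc n) n (\<tau>\<^sub>L (Suc n) y)"]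
        linear_comp[OF linear_\<sigma>\<^sub>L linear_\<tau>\<^sub>L]) (simp_all add: \<sigma>\<^sub>L_wcls \<tau>\<^sub>L_wcls)
    then show ?thesis using last_face_degen[OF adm_wcls w] ij by (simp add: \<delta>\<^sub>L_last)
  qed
qed (use assms in auto)

lemma \<tau>\<^sub>L_\<sigma>\<^sub>L:
  assumes "y \<in> word_space (Suc n)" "j < n"
  shows "\<tau>\<^sub>L n (\<sigma>\<^sub>L (Suc n) (Suc j) y) = \<sigma>\<^sub>L (Suc n) j (\<tau>\<^sub>L (Suc n) y)"
proof (rule word_space_eqI[OF linear_comp[OF linear_\<tau>\<^sub>L linear_\<sigma>\<^sub>L]
      linear_comp[OF linear_\<sigma>\<^sub>L linear_\<tau>\<^sub>L] _ assms(1)])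
  fix w :: "'c list" assume w: "length w = Suc (Suc n)"
  have "\<tau>\<^sub>L n (\<sigma>\<^sub>L (Suc n) (Suc j) (wcls (Suc n) w)) = degen (Suc j) (rot (wcls n)) w"
    using w assms by (intro map_\<sigma>\<^sub>L_wcls[where L = "\<tau>\<^sub>L n"]) (simp_all add: \<tau>\<^sub>L_wcls)
  also have "\<dots> = \<sigma>\<^sub>L (Suc n) j (\<tau>\<^sub>L (Suc n) (wcls (Suc n) w))"
    using w assms by (subst degen_rot) (simp_all add: \<tau>\<^sub>L_wcls \<sigma>\<^sub>L_wcls)
  finally show "\<tau>\<^sub>L n (\<sigma>\<^sub>L (Suc n) (Suc j) (wcls (Suc n) w)) =
      \<sigma>\<^sub>L (Suc n) j (\<tau>\<^sub>L (Suc n) (wcls (Suc n) w))" .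
qed (use assms in auto)

text \<open>For the last coface: \<open>\<sigma>\<^sub>j\<tau>\<delta>\<^sub>0 = \<tau>\<sigma>\<^sub>j\<^sub>+\<^sub>1\<delta>\<^sub>0 = \<tau>\<delta>\<^sub>0\<sigma>\<^sub>j\<close>.\<close>

lemma \<sigma>\<^sub>L_\<delta>\<^sub>L_greater:
  assumes y: "y \<in> word_space (Suc n)" and ij: "Suc j \<le> i" "i \<le> Suc n"
  shows "\<sigma>\<^sub>L (Suc (Suc n)) j (\<delta>\<^sub>L (Suc n) (Suc i) y) = \<delta>\<^sub>L n i (\<sigma>\<^sub>L (Suc n) j y)"
proof (cases "i \<le> n")
  case True
  show ?thesis
  proof (rule word_space_eqI[OF linear_comp[OF linear_\<sigma>\<^sub>L linear_\<delta>\<^sub>L]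
      linear_comp[OF linear_\<delta>\<^sub>L linear_\<sigma>\<^sub>L] _ assms(1)])
    fix w :: "'c list" assume w: "length w = Suc (Suc n)"
    have "\<sigma>\<^sub>L (Suc (Suc n)) j (\<delta>\<^sub>L (Suc n) (Suc i) (wcls (Suc n) w)) =
        face (Suc i) (degen j (wcls (Suc n))) w"
      using w ij True by (intro map_\<delta>\<^sub>L_wcls[OF linear_\<sigma>\<^sub>L]) (simp_all add: \<sigma>\<^sub>L_wcls)
    also have "\<dots> = degen j (face i (wcls (Suc n))) w"
      using w ij True face_degen_greater[of "Suc i" w j "wcls (Suc n)"] by simp
    also have "\<dots> = \<delta>\<^sub>L n i (\<sigma>\<^sub>L (Suc n) j (wcls (Suc n) w))"
      using w ij True by (intro map_\<sigma>\<^sub>L_wcls[symmetric, where L = "\<delta>\<^sub>L n i"]) (simp_all add: \<delta>\<^sub>L_wcls)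
    finally show "\<sigma>\<^sub>L (Suc (Suc n)) j (\<delta>\<^sub>L (Suc n) (Suc i) (wcls (Suc n) w)) =
      \<delta>\<^sub>L n i (\<sigma>\<^sub>L (Suc n) j (wcls (Suc n) w))" .
  qed (use assms in auto)
next
  case False
  then have i: "i = Suc n" using ij by simp
  have "\<sigma>\<^sub>L (Suc (Suc n)) j (\<delta>\<^sub>L (Suc n) (Suc i) y) =
      \<tau>\<^sub>L (Suc n) (\<sigma>\<^sub>L (Suc (Suc n)) (Suc j) (\<delta>\<^sub>L (Suc n) 0 y))"
    using i ij y by (simp add: \<delta>\<^sub>L_last \<tau>\<^sub>L_\<sigma>\<^sub>L \<delta>\<^sub>L_word_space)
  also have "\<dots> = \<delta>\<^sub>L n i (\<sigma>\<^sub>L (Suc n) j y)"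
    using i ij y by (simp add: \<delta>\<^sub>L_last \<sigma>\<^sub>L_\<delta>\<^sub>L_less)
  finally show ?thesis .
qed

lemma \<tau>\<^sub>L_\<sigma>\<^sub>L_0:
  assumes "y \<in> word_space (Suc n)"
  shows "\<tau>\<^sub>L n (\<sigma>\<^sub>L (Suc n) 0 y) = \<sigma>\<^sub>L (Suc n) n (\<tau>\<^sub>L (Suc n) (\<tau>\<^sub>L (Suc n) y))"
proof (rule word_space_eqI[OF linear_comp[OF linear_\<tau>\<^sub>L linear_\<sigma>\<^sub>L]
      linear_comp[OF linear_\<sigma>\<^sub>L linear_comp[OF linear_\<tau>\<^sub>L linear_\<tau>\<^sub>L]] _ assms(1)])
  fix w :: "'c list" assume w: "length w = Suc (Suc n)"
  then obtain c d v where "w = c # d # v" "length v = n"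
    by (cases w; cases "tl w") auto
  then show "\<tau>\<^sub>L n (\<sigma>\<^sub>L (Suc n) 0 (wcls (Suc n) w)) =
      \<sigma>\<^sub>L (Suc n) n (\<tau>\<^sub>L (Suc n) (\<tau>\<^sub>L (Suc n) (wcls (Suc n) w)))"
    using degen_at[of n v "wcls n" c d "[]"] by (simp add: \<tau>\<^sub>L_wcls \<sigma>\<^sub>L_wcls)
qed auto

lemma \<tau>\<^sub>L_order:
  assumes "y \<in> word_space n"
  shows "(\<tau>\<^sub>L n ^^ Suc n) y = y"
proof -
  have "Vector_Spaces.linear fscale fscale (\<tau>\<^sub>L n ^^ k)" for k
    by (induction k)
        (auto simp: id_def[symmetric] o_def intro: free.linear_id linear_comp linear_\<tau>\<^sub>L)
  moreover have "(\<tau>\<^sub>L n ^^ Suc n) (wcls n w) = wcls n w" if l: "length w = Suc n" for w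
  proof -
    have "(\<tau>\<^sub>L n ^^ k) (wcls n w) = wcls n (rotate k w)" for k
      using l by (induction k) (simp_all add: \<tau>\<^sub>L_wcls)
    then show ?thesis using rotate_id[of "Suc n" w] l by (simp del: funpow.simps rotate_Suc)
  qed
  ultimately show ?thesis
    by (rule word_space_eqI[OF _ free.linear_id[unfolded id_def] _ assms])
qed

section \<open>The operators on cosets and their values on elementary tensors\<close>

text \<open>The vector that represents a coset, read off from any of its elements.\<close>

definition coset_val :: "nat \<Rightarrow> ('k, 'r, 'c) cochain \<Rightarrow> ('c \<times> ('r + ('c list \<Rightarrow>\<^sub>0 'k) set) \<Rightarrow>\<^sub>0 'k)" where
  "coset_val n U = proj_along (hrel n) (SOME f. f \<in> U)"

definition coset_map where "coset_map n m L U = cochain_cls A C m (L (coset_val n U))"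

lemma cochains_eq_quot: "cochains A C n = quot (hdom n) (hrel n)"
  by (simp add: cochains_def htens_def)

lemma coset_val_cls [simp]: "coset_val n (cochain_cls A C n f) = proj_along (hrel n) f"
  unfolding coset_val_def cochain_cls_def by (rule proj_along_some_coset[OF subspace_hrel])

lemma cls_eq_iff: "cochain_cls A C n f = cochain_cls A C n g \<longleftrightarrow>
    proj_along (hrel n) f = proj_along (hrel n) g"
  unfolding cochain_cls_def by (rule coset_eq_proj_iff[OF subspace_hrel])

lemma carrier_cochains: "carrier (cochains A C n) = {cochain_cls A C n f |f. f \<in> hdom n}"
  by (simp add: cochains_eq_quot cochain_cls_def)

lemma coset_val_in_word_space: "x \<in> carrier (cochains A C n) \<Longrightarrow> coset_val n x \<in> word_space n"
  by (auto simp: carrier_cochains intro!: proj_in_word_space)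

lemma coset_val_inj:
  "x \<in> carrier (cochains A C n) \<Longrightarrow> y \<in> carrier (cochains A C n) \<Longrightarrow> coset_val n x = coset_val n y \<Longrightarrow> x =
      y"
  unfolding carrier_cochains using cls_eq_iff coset_val_cls by (elim CollectE exE conjE) metis

lemma cls_word_space: "y \<in> word_space n \<Longrightarrow> cochain_cls A C n y \<in> carrier (cochains A C n)"
  unfolding carrier_cochains
  by (erule word_space_hdom)
      (metis (mono_tags, lifting) cls_eq_iff mem_Collect_eq proj_along_idem[OF subspace_hrel])

lemma coset_map_carrier: "L (coset_val n x) \<in> word_space m \<Longrightarrow>
    coset_map n m L x \<in> carrier (cochains A C m)"
  unfolding coset_map_def by (rule cls_word_space)

lemma coset_val_map: "L (coset_val n x) \<in> word_space m \<Longrightarrow> coset_val m (coset_map n m L x) =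
    L (coset_val n x)"
  by (simp add: coset_map_def word_space_proj)

lemma coset_map_klinear:
  assumes "Vector_Spaces.linear fscale fscale L" "\<And>y. y \<in> word_space n \<Longrightarrow> L y \<in> word_space m"
  shows "klinear (cochains A C n) (cochains A C m) (coset_map n m L)"
  unfolding cochains_eq_quot
proof (rule klinear_quotI[OF subspace_hrel subspace_hrel linear_comp[OF assms(1) linear_proj_hrel]
    _ _ subspace_hdom])
  fix f show "coset_map n m L (f +o hrel n) = L (proj_along (hrel n) f) +o hrel m"
    using coset_val_cls[of n f] by (simp add: coset_map_def cochain_cls_def)
next
  fix x assume "x \<in> carrier (quot (hdom n) (hrel n))"
  then show "coset_map n m L x \<in> carrier (quot (hdom m) (hrel m))"
    unfolding cochains_eq_quot[symmetric]
      by (intro coset_map_carrier assms(2) coset_val_in_word_space)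
qed

definition coface where "coface n i = coset_map n (n + 1) (\<delta>\<^sub>L n i)"
definition codegen where "codegen n j = coset_map n (n - 1) (\<sigma>\<^sub>L n j)"
definition cyc where "cyc n = coset_map n n (\<tau>\<^sub>L n)"

lemma coface_carrier: "x \<in> carrier (cochains A C n) \<Longrightarrow> i \<le> Suc n \<Longrightarrow>
    coface n i x \<in> carrier (cochains A C (Suc n))"
  and coset_val_coface: "x \<in> carrier (cochains A C n) \<Longrightarrow> i \<le> Suc n \<Longrightarrow>
      coset_val (Suc n) (coface n i x) = \<delta>\<^sub>L n i (coset_val n x)"
  by (simp_all add: coface_def coset_map_carrier coset_val_map \<delta>\<^sub>L_word_space
      coset_val_in_word_space)

lemma codegen_carrier: "x \<in> carrier (cochains A C (Suc n)) \<Longrightarrow> j \<le> n \<Longrightarrow>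
    codegen (Suc n) j x \<in> carrier (cochains A C n)"
  and coset_val_codegen: "x \<in> carrier (cochains A C (Suc n)) \<Longrightarrow> j \<le> n \<Longrightarrow>
      coset_val n (codegen (Suc n) j x) = \<sigma>\<^sub>L (Suc n) j (coset_val (Suc n) x)"
  by (simp_all add: codegen_def coset_map_carrier coset_val_map \<sigma>\<^sub>L_word_space
      coset_val_in_word_space)

lemma cyc_carrier: "x \<in> carrier (cochains A C n) \<Longrightarrow> cyc n x \<in> carrier (cochains A C n)"
  and coset_val_cyc: "x \<in> carrier (cochains A C n) \<Longrightarrow> coset_val n (cyc n x) = \<tau>\<^sub>L n (coset_val n x)"
  by (simp_all add: cyc_def coset_map_carrier coset_val_map \<tau>\<^sub>L_word_space coset_val_in_word_space)

lemmas op_simps = coface_carrier coset_val_coface codegen_carrier coset_val_codegen cyc_carrier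
    coset_val_cyc coset_val_in_word_space

lemma cocyclic_cochains: "cocyclic_module (cochains A C) coface codegen cyc"
proof (intro cocyclic_module.intro cosimplicial_module.intro cocyclic_module_axioms.intro)
  fix n
  show "Module.module (ring_of_type_algebra :: 'k ring) (cochains A C n)"
    unfolding cochains_eq_quot by (rule quot_is_module[OF subspace_hdom subspace_hrel])
next
  fix n i :: nat assume "i \<le> n + 1"
  then show "klinear (cochains A C n) (cochains A C (n + 1)) (coface n i)"
    unfolding coface_def by (intro coset_map_klinear linear_\<delta>\<^sub>L) (simp add: \<delta>\<^sub>L_word_space)
next
  fix n j :: nat assume "j \<le> n"
  then show "klinear (cochains A C (n + 1)) (cochains A C n) (codegen (n + 1) j)"
    using coset_map_klinear[OF linear_\<sigma>\<^sub>L, of j n "Suc n" n] by (simp add: codegen_def \<sigma>\<^sub>L_word_space)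
next
  fix x n i j assume x: "x \<in> carrier (cochains A C n)" and ij: "i < j" "j \<le> n + 2"
  obtain j' where j: "j = Suc j'" using ij by (cases j) auto
  show "coface (n + 1) j (coface n i x) = coface (n + 1) i (coface n (j - 1) x)"
    using x ij j by (intro coset_val_inj[of _ "Suc (Suc n)"]) (simp_all add: op_simps \<delta>\<^sub>L_\<delta>\<^sub>L)
next
  fix x n i j assume x: "x \<in> carrier (cochains A C (n + 2))" and ij: "i \<le> j" "j \<le> n"
  show "codegen (n + 1) j (codegen (n + 2) i x) = codegen (n + 1) i (codegen (n + 2) (j + 1) x)"
    using x ij by (intro coset_val_inj[of _ n]) (simp_all add: op_simps \<sigma>\<^sub>L_\<sigma>\<^sub>L)
next
  fix x n i j assume x: "x \<in> carrier (cochains A C n)" and ij: "i < j" "j \<le> n"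
  obtain j' n' where j: "j = Suc j'" "n = Suc n'" using ij by (cases j; cases n) auto
  show "codegen (n + 1) j (coface n i x) = coface (n - 1) i (codegen n (j - 1) x)"
    using x ij j by (intro coset_val_inj[of _ n]) (simp_all add: op_simps \<sigma>\<^sub>L_\<delta>\<^sub>L_less)
next
  fix x n i j assume x: "x \<in> carrier (cochains A C n)" and ij: "j \<le> n" "i = j \<or> i = j + 1"
  have "i \<le> Suc n" using ij by auto
  then show "codegen (n + 1) j (coface n i x) = x"
    using x ij by (intro coset_val_inj[of _ n]) (simp_all add: op_simps \<sigma>\<^sub>L_\<delta>\<^sub>L_id)
next
  fix x n i j assume x: "x \<in> carrier (cochains A C n)" and ij: "j + 1 < i" "i \<le> n + 1"
  obtain i' n' where i: "i = Suc i'" "n = Suc n'" using ij by (cases i; cases n) auto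
  show "codegen (n + 1) j (coface n i x) = coface (n - 1) (i - 1) (codegen n j x)"
    using x ij i by (intro coset_val_inj[of _ n]) (simp_all add: op_simps \<sigma>\<^sub>L_\<delta>\<^sub>L_greater)
next
  fix n
  show "klinear (cochains A C n) (cochains A C n) (cyc n)"
    unfolding cyc_def by (intro coset_map_klinear linear_\<tau>\<^sub>L \<tau>\<^sub>L_word_space)
next
  fix x n i assume x: "x \<in> carrier (cochains A C n)" and i: "1 \<le> i" "i \<le> n + 1"
  obtain i' where i': "i = Suc i'" using i by (cases i) auto
  have "\<tau>\<^sub>L (Suc n) (\<delta>\<^sub>L n (Suc i') (coset_val n x)) = \<delta>\<^sub>L n i' (\<tau>\<^sub>L n (coset_val n x))"
    using x i i' \<tau>\<^sub>L_\<delta>\<^sub>L[of "coset_val n x" n i'] \<tau>\<^sub>L_\<delta>\<^sub>L_last[of "coset_val n x" n]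
      by (cases "i' = n") (auto simp: coset_val_in_word_space)
  then show "cyc (n + 1) (coface n i x) = coface n (i - 1) (cyc n x)"
    using x i i' by (intro coset_val_inj[of _ "Suc n"]) (simp_all add: op_simps)
next
  fix x n assume x: "x \<in> carrier (cochains A C n)"
  show "cyc (n + 1) (coface n 0 x) = coface n (n + 1) x"
    using x by (intro coset_val_inj[of _ "Suc n"]) (simp_all add: op_simps \<delta>\<^sub>L_last)
next
  fix x n j assume x: "x \<in> carrier (cochains A C (n + 1))" and j: "1 \<le> j" "j \<le> n"
  obtain j' where j': "j = Suc j'" using j by (cases j) auto
  show "cyc n (codegen (n + 1) j x) = codegen (n + 1) (j - 1) (cyc (n + 1) x)"
    using x j j' by (intro coset_val_inj[of _ n]) (simp_all add: op_simps \<tau>\<^sub>L_\<sigma>\<^sub>L)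
next
  fix x n assume x: "x \<in> carrier (cochains A C (n + 1))"
  show "cyc n (codegen (n + 1) 0 x) = codegen (n + 1) n (cyc (n + 1) (cyc (n + 1) x))"
    using x by (intro coset_val_inj[of _ n]) (simp_all add: op_simps \<tau>\<^sub>L_\<sigma>\<^sub>L_0)
next
  fix x n assume x: "x \<in> carrier (cochains A C n)"
  have "(cyc n ^^ k) x \<in> carrier (cochains A C n) \<and> coset_val n ((cyc n ^^ k) x) =
      (\<tau>\<^sub>L n ^^ k) (coset_val n x)" for k
    by (induction k) (use x in \<open>simp_all add: op_simps\<close>)
  then show "(cyc n ^^ (n + 1)) x = x"
    using x \<tau>\<^sub>L_order[OF coset_val_in_word_space[OF x]]
      by (intro coset_val_inj[of _ n]) (simp_all del: funpow.simps)
qed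

lemma coset_val_tensor0: "coset_val 0 (tensor0 A C c r) = wcls 0 [ract C c r]"
  unfolding tensor0_def coset_val_cls
    by (simp add: pair_cls_0_Inl flip: pair_cls_def del: Cpow.simps)

lemma coset_val_tensor: "0 < n \<Longrightarrow> coset_val n (tensor A C n f) = lin_ext fscale (wcls n) f"
  unfolding tensor_def coset_val_cls linear_lin_ext_commute[OF linear_proj_hrel] wcls_def
      word_pair_def by simp

lemma coset_val_tensor_gen: "0 < n \<Longrightarrow> coset_val n (tensor A C n (gen w)) = wcls n w"
  by (simp add: coset_val_tensor)

lemma coset_map_tensorI:
  assumes "0 < m" "L (coset_val n U) \<in> word_space m" "L (coset_val n U) = lin_ext fscale (wcls m) f"
  shows "coset_map n m L U = tensor A C m f"
  unfolding coset_map_def tensor_def cls_eq_iff word_space_proj[OF assms(2)] assms(3)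
  using assms(1)
  by (simp add: linear_lin_ext_commute[OF linear_proj_hrel] wcls_def word_pair_def
      proj_along_idem[OF subspace_hrel])

lemma coset_map_tensor0I:
  assumes "L (coset_val n U) = wcls 0 [ract C c r]"
  shows "coset_map n 0 L U = tensor0 A C c r"
  unfolding coset_map_def tensor0_def cls_eq_iff assms word_space_proj[OF
      wcls_in_space[of "[ract C c r]" 0, simplified]]
  by (simp add: pair_cls_0_Inl flip: pair_cls_def del: Cpow.simps)

lemma balanced2_ract_right:
  assumes "balanced2 C \<phi>"
  shows "balanced2 C (\<lambda>x y. \<phi> x (ract C y a))"
  using assms linC_ract[of "\<phi> _" a] unfolding balanced2_def by (auto simp: C.lact_ract)

lemma coface_tensor:
  assumes "length u + length v = n" "1 \<le> n" "f \<in> comult C c"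
  shows "coface n (length u) (tensor A C n (gen (u @ c # v))) =
    tensor A C (n + 1) (swsum fscale f (\<lambda>c1 c2. gen (u @ c1 # c2 # v)))"
proof -
  have b2: "balanced2 C (\<lambda>x y. wcls (Suc n) (u @ x # y # v))"
    using adm_multilin[OF adm_wcls, of "Suc n"] assms(1) by (intro balanced2_words) simp
  have "\<delta>\<^sub>L n (length u) (wcls n (u @ c # v)) =
      lin_ext fscale (wcls (Suc n)) (swsum fscale f (\<lambda>c1 c2. gen (u @ c1 # c2 # v)))"
    using assms C.swsum_eq_sweedler[OF b2 assms(3)] by (simp add: \<delta>\<^sub>L_wcls face_at lin_ext_of_swsum)
  then show ?thesis
    using assms \<delta>\<^sub>L_word_space[of "length u" n "wcls n (u @ c # v)"] wcls_in_space[of "u @ c # v" n]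
    unfolding coface_def by (intro coset_map_tensorI) (simp_all add: coset_val_tensor_gen)
qed

lemma balanced2_last:
  "length v = n \<Longrightarrow> balanced2 C (\<lambda>x y. wcls (Suc n) (y # v @ [x]))"
  using balanced2_words[of "[]" v "rot (wcls (Suc n))"] adm_multilin[OF adm_rot[OF adm_wcls],
      of "Suc n"]
  by simp

lemma \<delta>\<^sub>L_last_wcls: "length v = n \<Longrightarrow> \<delta>\<^sub>L n (Suc n) (wcls n (c # v)) =
    swC c (\<lambda>x y. wcls (Suc n) (y # v @ [x]))"
  using map_\<delta>\<^sub>L_wcls[OF linear_\<tau>\<^sub>L, of "c # v" n 0 "Suc n" "rot (wcls (Suc n))"]
    by (simp add: \<delta>\<^sub>L_last \<tau>\<^sub>L_wcls)

lemma coface_last_tensor: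
  assumes "length v = n" "1 \<le> n" "f \<in> comult C c"
  shows "coface n (n + 1) (tensor A C n (gen (c # v))) =
    tensor A C (n + 1) (swsum fscale f (\<lambda>c1 c2. gen (c2 # v @ [c1])))"
proof -
  have "\<delta>\<^sub>L n (Suc n) (wcls n (c # v)) =
      lin_ext fscale (wcls (Suc n)) (swsum fscale f (\<lambda>c1 c2. gen (c2 # v @ [c1])))"
    using assms C.swsum_eq_sweedler[OF balanced2_last[OF assms(1)] assms(3)]
    by (simp add: \<delta>\<^sub>L_last_wcls lin_ext_of_swsum)
  then show ?thesis
    using assms \<delta>\<^sub>L_word_space[of "Suc n" n "wcls n (c # v)"] wcls_in_space[of "c # v" n]
    unfolding coface_def by (intro coset_map_tensorI) (simp_all add: coset_val_tensor_gen)
qed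

lemma coface_tensor0:
  assumes "f \<in> comult C c"
  shows "coface 0 0 (tensor0 A C c r) =
      tensor A C 1 (swsum fscale f (\<lambda>c1 c2. gen [c1, hact C (tgt A r) c2]))"
    and "coface 0 1 (tensor0 A C c r) =
        tensor A C 1 (swsum fscale f (\<lambda>c1 c2. gen [c2, hact C (src A r) c1]))"
proof -
  have b2: "balanced2 C (\<lambda>x y. wcls 1 [x, y])"
    using balanced2_words[of "[]" "[]" "wcls 1"] adm_multilin[OF adm_wcls, of 1]
      by (simp add: numeral_2_eq_2)
  have b2': "balanced2 C (\<lambda>x y. wcls 1 [y, x])"
    using balanced2_last[of "[]" 0] by simp
  have bal: "wcls 1 [ract C y r, x] = wcls 1 [y, lact C r x]" for x y
    using multilin_balanced[OF adm_multilin[OF adm_wcls, of 1], of "[]" "[]"] by simp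
  have E0: "wcls 0 [ract C c r] \<in> word_space 0" by (simp add: wcls_in_space)
  have "\<delta>\<^sub>L 0 0 (wcls 0 [ract C c r]) =
      lin_ext fscale (wcls 1) (swsum fscale f (\<lambda>c1 c2. gen [c1, hact C (tgt A r) c2]))"
    using C.swsum_eq_sweedler[OF balanced2_ract_right[OF b2] assms, of r] C.sweedler_ract[OF b2,
        of c r]
    by (simp add: \<delta>\<^sub>L_wcls lin_ext_of_swsum hact_tgt)
  then show "coface 0 0 (tensor0 A C c r) =
      tensor A C 1 (swsum fscale f (\<lambda>c1 c2. gen [c1, hact C (tgt A r) c2]))"
    using \<delta>\<^sub>L_word_space[OF _ E0, of 0] unfolding coface_def
    by (simp add: coset_map_tensorI coset_val_tensor0)
  have "\<delta>\<^sub>L 0 1 (wcls 0 [ract C c r]) =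
      lin_ext fscale (wcls 1) (swsum fscale f (\<lambda>c1 c2. gen [c2, hact C (src A r) c1]))"
    using C.swsum_eq_sweedler[OF balanced2_ract_right[OF b2'] assms, of r] C.sweedler_ract[OF b2',
        of c r]
      \<delta>\<^sub>L_last_wcls[of "[]" 0 "ract C c r"]
    by (simp add: lin_ext_of_swsum hact_src bal[unfolded One_nat_def])
  then show "coface 0 1 (tensor0 A C c r) =
      tensor A C 1 (swsum fscale f (\<lambda>c1 c2. gen [c2, hact C (src A r) c1]))"
    using \<delta>\<^sub>L_word_space[OF _ E0, of 1] unfolding coface_def
    by (simp add: coset_map_tensorI coset_val_tensor0)
qed

text \<open>The counit of \<open>c\<close> may be absorbed by either neighbour, by balancing.  The operators absorb it
on the left.\<close>

lemma codegen_tensor: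
  assumes "length u + length v + 2 = n" "2 \<le> n"
  shows "codegen n (length u + 1) (tensor A C n (gen (c0 # u @ d # c # v))) =
      tensor A C (n - 1) (gen (c0 # u @ ract C d (counit C c) # v))"
    and "codegen n (length u) (tensor A C n (gen (c0 # u @ c # d # v))) =
      tensor A C (n - 1) (gen (c0 # u @ lact C (counit C c) d # v))"
proof -
  obtain m where n: "n = Suc m" "m = length u + length v + 1" using assms by (cases n) auto
  have "\<sigma>\<^sub>L (Suc m) (length u + 1) (wcls (Suc m) (c0 # u @ d # c # v)) =
      wcls m (c0 # u @ ract C d (counit C c) # v)"
    using n degen_at[of "length u + 1" "c0 # u" "wcls m" d c v] by (simp add: \<sigma>\<^sub>L_wcls)
  moreover have "wcls m (c0 # u @ ract C d (counit C c) # v) \<in> word_space m" using n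
    by (intro wcls_in_space) simp
  ultimately show "codegen n (length u + 1) (tensor A C n (gen (c0 # u @ d # c # v))) =
      tensor A C (n - 1) (gen (c0 # u @ ract C d (counit C c) # v))"
    unfolding codegen_def using n by (intro coset_map_tensorI) (simp_all add: coset_val_tensor_gen)
  obtain u' z where u': "c0 # u = u' @ [z]" "length u' = length u"
    by (metis append_butlast_last_id length_butlast length_Cons diff_Suc_1 list.distinct(1))
  have cu: "c0 # u @ x = u' @ z # x" for x
    using arg_cong[OF u'(1), of "\<lambda>y. y @ x"] by simp
  have "\<sigma>\<^sub>L (Suc m) (length u) (wcls (Suc m) (c0 # u @ c # d # v)) =
      wcls m (u' @ ract C z (counit C c) # d # v)"
    unfolding cu using n u'(2) degen_at[of "length u" u' "wcls m" z c "d # v"]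
      by (simp add: \<sigma>\<^sub>L_wcls)
  also have "\<dots> = wcls m (u' @ z # lact C (counit C c) d # v)"
    using n u'(2) by (intro multilin_balanced[OF adm_multilin[OF adm_wcls]]) simp
  also have "\<dots> = wcls m (c0 # u @ lact C (counit C c) d # v)"
    by (simp only: cu)
  finally have "\<sigma>\<^sub>L (Suc m) (length u) (wcls (Suc m) (c0 # u @ c # d # v)) =
      wcls m (c0 # u @ lact C (counit C c) d # v)" .
  moreover have "wcls m (c0 # u @ lact C (counit C c) d # v) \<in> word_space m" using n
    by (intro wcls_in_space) simp
  ultimately show "codegen n (length u) (tensor A C n (gen (c0 # u @ c # d # v))) =
      tensor A C (n - 1) (gen (c0 # u @ lact C (counit C c) d # v))"
    unfolding codegen_def using n by (intro coset_map_tensorI) (simp_all add: coset_val_tensor_gen)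
qed

lemma codegen_tensor_1: "codegen 1 0 (tensor A C 1 (gen [c0, c])) = tensor0 A C c0 (counit C c)"
  unfolding codegen_def using \<sigma>\<^sub>L_wcls[of "[c0, c]" 0 0]
  by (simp add: coset_map_tensor0I coset_val_tensor_gen)

lemma cyc_tensor:
  assumes "1 \<le> n" "length v = n"
  shows "cyc n (tensor A C n (gen (c # v))) = tensor A C n (gen (v @ [c]))"
  using assms wcls_in_space[of "v @ [c]" n] unfolding cyc_def
  by (intro coset_map_tensorI) (simp_all add: coset_val_tensor_gen \<tau>\<^sub>L_wcls)

lemma cyc_0:
  assumes "x \<in> carrier (cochains A C 0)"
  shows "cyc 0 x = x"
  using \<tau>\<^sub>L_order[OF coset_val_in_word_space[OF assms]] assms
  by (intro coset_val_inj[of _ 0]) (simp_all add: op_simps)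

end

theorem theorem3p1:
  fixes A :: "('k::field, 'r::{ring,monoid_mult}, 'h::{ring,monoid_mult}) para_hopf_data"
    and C :: "('k, 'r, 'h, 'c::ab_group_add) module_coring_data"
  assumes "para_hopf_algebroid A"
    and "module_coring A C"
  shows "\<exists>\<delta> \<sigma> \<tau>.
    cocyclic_module (cochains A C) \<delta> \<sigma> \<tau> \<and>
    (\<forall>n u c v f. 1 \<le> n \<and> length u + length v = n \<and> f \<in> comult C c \<longrightarrow>
      \<delta> n (length u) (tensor A C n (gen (u @ c # v))) =
        tensor A C (n + 1) (swsum fscale f (\<lambda>c1 c2. gen (u @ c1 # c2 # v)))) \<and>
    (\<forall>n c v f. 1 \<le> n \<and> length v = n \<and> f \<in> comult C c \<longrightarrow>
      \<delta> n (n + 1) (tensor A C n (gen (c # v))) =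
        tensor A C (n + 1) (swsum fscale f (\<lambda>c1 c2. gen (c2 # v @ [c1])))) \<and>
    (\<forall>c r f. f \<in> comult C c \<longrightarrow>
      \<delta> 0 0 (tensor0 A C c r) =
        tensor A C 1 (swsum fscale f (\<lambda>c1 c2. gen [c1, hact C (tgt A r) c2])) \<and>
      \<delta> 0 1 (tensor0 A C c r) =
        tensor A C 1 (swsum fscale f (\<lambda>c1 c2. gen [c2, hact C (src A r) c1]))) \<and>
    (\<forall>n c0 u c d v. 2 \<le> n \<and> length u + length v + 2 = n \<longrightarrow>
      \<sigma> n (length u) (tensor A C n (gen (c0 # u @ c # d # v))) =
        tensor A C (n - 1) (gen (c0 # u @ lact C (counit C c) d # v)) \<and>
      \<sigma> n (length u + 1) (tensor A C n (gen (c0 # u @ d # c # v))) =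
        tensor A C (n - 1) (gen (c0 # u @ ract C d (counit C c) # v))) \<and>
    (\<forall>c0 c. \<sigma> 1 0 (tensor A C 1 (gen [c0, c])) = tensor0 A C c0 (counit C c)) \<and>
    (\<forall>n c v. 1 \<le> n \<and> length v = n \<longrightarrow>
      \<tau> n (tensor A C n (gen (c # v))) = tensor A C n (gen (v @ [c]))) \<and>
    (\<forall>x\<in>carrier (cochains A C 0). \<tau> 0 x = x)"
proof -
  interpret para_hopf_algebroid A by fact
  interpret module_coring A C by fact
  interpret para_module_coring A C ..
  show ?thesis
    using cocyclic_cochains coface_tensor coface_last_tensor coface_tensor0 codegen_tensor
        codegen_tensor_1 cyc_tensor cyc_0
    by (intro exI[of _ coface] exI[of _ codegen] exI[of _ cyc]) (intro conjI allI impI ballI;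
        (elim conjE)?; simp)
qed

end
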